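(* Let $X$ be a finite-dimensional real vector space of dimension $n\ge 1$ equipped with any norm $\|\cdot\|$, let $\mu$ be the Lebesgue measure on $X$, and let $P$ be the perimeter functional corresponding to the chosen norm, \[ P(E):=\sup\Big\{\int_X\mathbf 1_E\,\mathrm{div}\,v\,d\mu\ :\ \|v\|_\infty\le1\Big\}, \] the supremum being taken over smooth vector fields $v$ with compact support on $X$, with $\|v\|_\infty:=\sup_{p\in X}\|v(p)\|$. Let $N\in\mathbb N\cup\{\infty\}$. Then for every $\mathbf m\in\mathbb R^N_+$ there exists a minimal generalized $N$-cluster $\mathbf E$ in $X$ with $\mathbf m^\infty(\mathbf E)=\mathbf m$.
   Context: $\mathbb R^N_+$ is the set of vectors (sequences if $N=\infty$) with nonnegative real components. An $N$-cluster in $X$, $N\in\mathbb N\cup\{\infty\}$, is $\mathbf E=(E_j)_{j=1}^N$ with each $E_j\subset X$ Borel (possibly empty) and $\mu(E_i\cap E_j)=0$ for $i\ne j$. One sets $\mathbf m(\mathbf E):=(\mu(E_j))_{j=1}^N$ and $P(\mathbf E):=\frac12\sum_{j\ge1}P(E_j)+\frac12P\big(\bigcup_{j\ge1}E_j\big)$. Let $X^\infty:=\mathbb Z\times X$ and $\phi_j\colon X\to X^\infty$, $\phi_j(x)=(j,x)$. A generalized $N$-cluster in $X$ is $\mathbf E=(E_i)_{i=1}^N$ with $E_i\subset X^\infty$ such that for each $j\in\mathbb Z$ the vector $\mathbf E^j$ with components $E_i^j:=\phi_j^{-1}(E_i)$, $i=1,\dots,N$, is an $N$-cluster in $X$. One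 sets $\mathbf m^\infty(\mathbf E):=\sum_{j\in\mathbb Z}\mathbf m(\mathbf E^j)$ and $P^\infty(\mathbf E):=\sum_{j\in\mathbb Z}P(\mathbf E^j)$. A generalized $N$-cluster $\mathbf E$ is minimal (isoperimetric) if $P^\infty(\mathbf E)=\inf\{P^\infty(\mathbf F):\mathbf F\text{ a generalized }N\text{-cluster in }X,\ \mathbf m^\infty(\mathbf F)=\mathbf m^\infty(\mathbf E)\}$. *)

theory Defs
  imports "HOL-Analysis.Analysis"
begin

text \<open>
  The ambient space is a type of class \<open>euclidean_space\<close>, which supplies coordinates, the Lebesgue
  measure \<open>lborel\<close>, and the usual topology, but \<^emph>\<open>not\<close> the norm: the norm of the statement
  is an arbitrary function \<open>nrm\<close> subject to the norm axioms, unrelated to the class operation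
  \<^const>\<open>norm\<close>. As all norms on the space are equivalent, Borel sets, smoothness and
  compactness do not depend on \<open>nrm\<close>.
\<close>

definition is_norm :: "('a::real_vector \<Rightarrow> real) \<Rightarrow> bool" where
  "is_norm nrm \<longleftrightarrow>
     (\<forall>x. 0 \<le> nrm x) \<and>
     (\<forall>x. nrm x = 0 \<longleftrightarrow> x = 0) \<and>
     (\<forall>a x. nrm (a *\<^sub>R x) = \<bar>a\<bar> * nrm x) \<and>
     (\<forall>x y. nrm (x + y) \<le> nrm x + nrm y)"

primrec times_cont_differentiable ::
    "nat \<Rightarrow> ('a::real_normed_vector \<Rightarrow> 'b::real_normed_vector) \<Rightarrow> bool" where
  "times_cont_differentiable 0 f \<longleftrightarrow> continuous_on UNIV f"
| "times_cont_differentiable (Suc k) f \<longleftrightarrow>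
     (\<forall>x. f differentiable (at x)) \<and>
     (\<forall>d. times_cont_differentiable k (\<lambda>x. frechet_derivative f (at x) d))"

definition smooth :: "('a::real_normed_vector \<Rightarrow> 'b::real_normed_vector) \<Rightarrow> bool" where
  "smooth f \<longleftrightarrow> (\<forall>k. times_cont_differentiable k f)"

definition divergence :: "('a::euclidean_space \<Rightarrow> 'a) \<Rightarrow> 'a \<Rightarrow> real" where
  "divergence v x = (\<Sum>b\<in>Basis. frechet_derivative v (at x) b \<bullet> b)"

definition sup_norm :: "('a \<Rightarrow> real) \<Rightarrow> ('a \<Rightarrow> 'a) \<Rightarrow> ereal" where
  "sup_norm nrm v = (SUP p. ereal (nrm (v p)))"

definition test_fields :: "('a::euclidean_space \<Rightarrow> real) \<Rightarrow> ('a \<Rightarrow> 'a) set" where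
  "test_fields nrm =
     {v. smooth v \<and> compact (closure {x. v x \<noteq> 0}) \<and> sup_norm nrm v \<le> 1}"

text \<open>
  The coercion \<^const>\<open>ennreal\<close> sends negative reals to 0; this does not affect the supremum,
  because the zero field is admissible and contributes the value 0.
\<close>

definition perimeter :: "('a::euclidean_space \<Rightarrow> real) \<Rightarrow> 'a set \<Rightarrow> ennreal" where
  "perimeter nrm E =
     (SUP v\<in>test_fields nrm. ennreal (\<integral>x. indicator E x * divergence v x \<partial>lborel))"

text \<open>
  Clusters are families indexed by \<open>nat\<close>, of which only the members with index in
  \<open>idx N\<close> are ever considered.
\<close>

definition idx :: "enat \<Rightarrow> nat set" where
  "idx N = {j. 1 \<le> j \<and> enat j \<le> N}"

definition cluster :: "enat \<Rightarrow> (nat \<Rightarrow> 'a::euclidean_space set) \<Rightarrow> bool" where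
  "cluster N E \<longleftrightarrow>
     (\<forall>j\<in>idx N. E j \<in> sets borel) \<and>
     (\<forall>i\<in>idx N. \<forall>j\<in>idx N. i \<noteq> j \<longrightarrow> emeasure lborel (E i \<inter> E j) = 0)"

definition cluster_measure :: "(nat \<Rightarrow> 'a::euclidean_space set) \<Rightarrow> nat \<Rightarrow> ennreal" where
  "cluster_measure E j = emeasure lborel (E j)"

definition cluster_perimeter ::
    "('a::euclidean_space \<Rightarrow> real) \<Rightarrow> enat \<Rightarrow> (nat \<Rightarrow> 'a set) \<Rightarrow> ennreal" where
  "cluster_perimeter nrm N E =
     1 / 2 * (\<Sum>\<^sub>\<infinity>j\<in>idx N. perimeter nrm (E j)) +
     1 / 2 * perimeter nrm (\<Union>j\<in>idx N. E j)"

definition layer :: "(nat \<Rightarrow> (int \<times> 'a) set) \<Rightarrow> int \<Rightarrow> nat \<Rightarrow> 'a set" where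
  "layer E j i = (\<lambda>x. (j, x)) -` E i"

definition gen_cluster :: "enat \<Rightarrow> (nat \<Rightarrow> (int \<times> 'a::euclidean_space) set) \<Rightarrow> bool" where
  "gen_cluster N E \<longleftrightarrow> (\<forall>j. cluster N (layer E j))"

definition gen_measure :: "(nat \<Rightarrow> (int \<times> 'a::euclidean_space) set) \<Rightarrow> nat \<Rightarrow> ennreal" where
  "gen_measure E i = (\<Sum>\<^sub>\<infinity>j\<in>UNIV. cluster_measure (layer E j) i)"

definition gen_perimeter ::
    "('a::euclidean_space \<Rightarrow> real) \<Rightarrow> enat \<Rightarrow> (nat \<Rightarrow> (int \<times> 'a) set) \<Rightarrow> ennreal" where
  "gen_perimeter nrm N E = (\<Sum>\<^sub>\<infinity>j\<in>UNIV. cluster_perimeter nrm N (layer E j))"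

definition minimal_gen_cluster ::
    "('a::euclidean_space \<Rightarrow> real) \<Rightarrow> enat \<Rightarrow> (nat \<Rightarrow> (int \<times> 'a) set) \<Rightarrow> bool" where
  "minimal_gen_cluster nrm N E \<longleftrightarrow>
     gen_cluster N E \<and>
     gen_perimeter nrm N E =
       (INF F\<in>{F. gen_cluster N F \<and> (\<forall>i\<in>idx N. gen_measure F i = gen_measure E i)}.
          gen_perimeter nrm N F)"

end

theory Submission
  imports Defs "HOL-Library.Diagonal_Subsequence"
begin

text \<open>
  Let \<open>J\<close> be the infimum of the energies and suppose it is finite.  A minimizing sequence of generalized
  clusters may spread its mass over ever more distant places and over ever more layers, but this costs
  nothing here: a generalized cluster has infinitely many layers, so every region in which mass
  accumulates may be given a layer of its own in the limit.  What has to be shown is that no mass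
  escapes accumulation altogether, and that energies do not jump up in the limit.

  Everything rests on one estimate, \<open>emeasure_translate_enter_le\<close>: a translate of a
  set \<open>A\<close> of finite measure by \<open>h\<close> exceeds \<open>A\<close> by a set of measure at most \<open>nrm h * perimeter nrm A\<close>.  Averaged over the small
  vectors \<open>h\<close> it says that the cells of a grid of mesh \<open>1 / p\<close> are, up to a set of measure
  \<open>O(perimeter nrm A / p)\<close>, either almost full of \<open>A\<close> or almost free of it (\<open>mixed_cells_le\<close>).  This replaces
  the usual theory of functions of bounded variation and has three consequences.

  \<^item> Sets of bounded perimeter are determined, up to a small error, by their volumes in finitely many cells;
    a diagonal argument therefore makes them converge locally in measure to a set
    (\<open>perimeter_bounded_loc_compact\<close>).
  \<^item> The part of a set lying in unit cells that contain little of it has small measure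
    (\<open>light_cells_le\<close>).  As only boundedly many unit cells can contain much of a set of given measure,
    following these cells along the sequence recovers all the mass (\<open>concentration_compactness\<close>).
  \<^item> A set of small perimeter has small measure (\<open>small_perimeter_imp_small_measure\<close>).  Hence a finite energy
    forces the prescribed volumes to be summable, which makes the union of infinitely many
    components pass to the limit (\<open>loc_tendsto_UN\<close>).

  Heavy cells whose mutual distance stays bounded are followed together; the remaining families move
  infinitely far apart.  Test fields with compact support around such families have disjoint supports
  eventually and add up to a single test field, so the perimeters of all limit pieces together are at
  most the limit of the perimeters (\<open>separated_perimeter_lsc\<close>).  The limit pieces, one per layer,
  form the minimizer.
\<close>

section \<open>Smooth functions\<close>

lemma times_cont_differentiable_continuous:
  "times_cont_differentiable k f \<Longrightarrow> continuous_on UNIV f"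
  by (cases k) (auto intro!: continuous_at_imp_continuous_on differentiable_imp_continuous_within)

lemma times_cont_differentiable_Suc:
  "times_cont_differentiable (Suc k) f \<Longrightarrow> times_cont_differentiable k f"
proof (induction k arbitrary: f)
  case 0
  then show ?case using times_cont_differentiable_continuous[of "Suc 0" f] by simp
next
  case (Suc k)
  then show ?case by simp
qed

text \<open>
  Differentiability of order \<open>k\<close> is defined through \<^const>\<open>frechet_derivative\<close>; the next two rules allow
  to argue with an explicitly given derivative instead.
\<close>

lemma times_cont_differentiable_SucI:
  assumes "\<And>x. (f has_derivative f' x) (at x)" "\<And>d. times_cont_differentiable k (\<lambda>x. f' x d)"
  shows "times_cont_differentiable (Suc k) f"
proof -
  have "frechet_derivative f (at x) = f' x" for x
    using assms(1) by (metis frechet_derivative_at)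
  then show ?thesis using assms by (auto simp: differentiable_def)
qed

lemma times_cont_differentiable_SucD:
  assumes "times_cont_differentiable (Suc k) f"
  shows "(f has_derivative frechet_derivative f (at x)) (at x)"
  using assms frechet_derivative_works by auto

lemma times_cont_differentiable_const: "times_cont_differentiable k (\<lambda>x. c)"
proof (induction k arbitrary: c)
  case (Suc k)
  show ?case by (rule times_cont_differentiable_SucI[OF has_derivative_const]) (rule Suc)
qed auto

lemma times_cont_differentiable_linear:
  assumes "bounded_linear f" shows "times_cont_differentiable k f"
proof (cases k)
  case 0 then show ?thesis using assms by (simp add: linear_continuous_on)
next
  case (Suc j)
  show ?thesis unfolding Suc
    by (rule times_cont_differentiable_SucI[OF bounded_linear_imp_has_derivative[OF assms]])
      (rule times_cont_differentiable_const)
qed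

lemma times_cont_differentiable_add:
  assumes "times_cont_differentiable k f" "times_cont_differentiable k g"
  shows "times_cont_differentiable k (\<lambda>x. f x + g x)"
  using assms
proof (induction k arbitrary: f g)
  case 0 then show ?case by (simp add: continuous_on_add)
next
  case (Suc k)
  show ?case
    by (rule times_cont_differentiable_SucI[OF has_derivative_add[OF
        times_cont_differentiable_SucD[OF Suc.prems(1)] times_cont_differentiable_SucD[OF Suc.prems(2)]]])
      (use Suc in simp)
qed

lemma times_cont_differentiable_bilinear:
  assumes "bounded_bilinear B" "times_cont_differentiable k f" "times_cont_differentiable k g"
  shows "times_cont_differentiable k (\<lambda>x. B (f x) (g x))"
  using assms(2,3)
proof (induction k arbitrary: f g)
  case 0 then show ?case by (simp add: bounded_bilinear.continuous_on[OF assms(1)])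
next
  case (Suc k)
  show ?case
    by (rule times_cont_differentiable_SucI[OF bounded_bilinear.FDERIV[OF assms(1)
        times_cont_differentiable_SucD[OF Suc.prems(1)] times_cont_differentiable_SucD[OF Suc.prems(2)]]],
        rule times_cont_differentiable_add; rule Suc.IH)
      (use Suc.prems times_cont_differentiable_Suc in auto)
qed

text \<open>
  An outer function of one real variable is enough: its derivative is multiplication by the
  number \<open>frechet_derivative f (at y) 1\<close>, so the chain rule stays within products and compositions
  of the same kind and the induction closes.
\<close>

lemma times_cont_differentiable_compose_real:
  fixes f :: "real \<Rightarrow> real"
  assumes "times_cont_differentiable k f" "times_cont_differentiable k q"
  shows "times_cont_differentiable k (\<lambda>x. f (q x))"
  using assms
proof (induction k arbitrary: f)
  case 0
  then show ?case by (simp add: continuous_on_compose2[of UNIV f])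
next
  case (Suc k)
  let ?F = "\<lambda>y. frechet_derivative f (at y) 1"
  have F: "(f has_derivative (\<lambda>h. h * ?F y)) (at y)" for y
  proof -
    have D: "(f has_derivative frechet_derivative f (at y)) (at y)"
      by (rule times_cont_differentiable_SucD[OF Suc.prems(1)])
    obtain c where c: "?F y = c" by simp
    have "frechet_derivative f (at y) = (\<lambda>h. h * c)"
      using linear.scaleR[OF has_derivative_linear[OF D], of _ 1] c by (auto simp: fun_eq_iff)
    with D have "(f has_derivative (\<lambda>h. h * c)) (at y)" by metis
    then show ?thesis unfolding c .
  qed
  show ?case
  proof (rule times_cont_differentiable_SucI)
    show "((\<lambda>x. f (q x)) has_derivative (\<lambda>h. frechet_derivative q (at x) h * ?F (q x))) (at x)" for x
      using has_derivative_compose[OF times_cont_differentiable_SucD[OF Suc.prems(2)] F] .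
    show "times_cont_differentiable k (\<lambda>x. frechet_derivative q (at x) d * ?F (q x))" for d
      by (rule times_cont_differentiable_bilinear[OF bounded_bilinear_mult])
        (use Suc times_cont_differentiable_Suc[OF Suc.prems(2)] in auto)
  qed
qed

lemma times_cont_differentiable_translate:
  assumes "times_cont_differentiable k f"
  shows "times_cont_differentiable k (\<lambda>x. f (x - a))"
  using assms
proof (induction k arbitrary: f)
  case 0
  then show ?case by (auto intro!: continuous_on_compose2[of UNIV f] continuous_intros)
next
  case (Suc k)
  show ?case
  proof (rule times_cont_differentiable_SucI)
    show "((\<lambda>x. f (x - a)) has_derivative frechet_derivative f (at (x - a))) (at x)" for x
      by (rule has_derivative_compose[OF _ times_cont_differentiable_SucD[OF Suc.prems(1)]])
        (auto intro!: derivative_eq_intros)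
  qed (use Suc in auto)
qed

lemma smooth_const: "smooth (\<lambda>x. c)"
  and smooth_linear: "bounded_linear f \<Longrightarrow> smooth f"
  and smooth_add: "smooth g \<Longrightarrow> smooth h \<Longrightarrow> smooth (\<lambda>x. g x + h x)"
  and smooth_bilinear: "bounded_bilinear B \<Longrightarrow> smooth u \<Longrightarrow> smooth w \<Longrightarrow> smooth (\<lambda>x. B (u x) (w x))"
  and smooth_translate: "smooth g \<Longrightarrow> smooth (\<lambda>x. g (x - a))"
  by (auto simp: smooth_def times_cont_differentiable_const times_cont_differentiable_linear
      times_cont_differentiable_add times_cont_differentiable_bilinear times_cont_differentiable_translate)

lemma smooth_compose_real:
  fixes f :: "real \<Rightarrow> real"
  shows "smooth f \<Longrightarrow> smooth q \<Longrightarrow> smooth (\<lambda>x. f (q x))"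
  by (simp add: smooth_def times_cont_differentiable_compose_real)

lemma smooth_sum: "(\<And>i. i \<in> I \<Longrightarrow> smooth (f i)) \<Longrightarrow> smooth (\<lambda>x. \<Sum>i\<in>I. f i x)"
  by (induction I rule: infinite_finite_induct) (auto intro: smooth_const smooth_add)

lemma smooth_mult:
  fixes f g :: "'a::real_normed_vector \<Rightarrow> real"
  shows "smooth f \<Longrightarrow> smooth g \<Longrightarrow> smooth (\<lambda>x. f x * g x)"
  by (rule smooth_bilinear[OF bounded_bilinear_mult])

lemma smooth_diff:
  fixes f g :: "'a::real_normed_vector \<Rightarrow> 'b::real_normed_vector"
  assumes "smooth f" "smooth g" shows "smooth (\<lambda>x. f x - g x)"
  using smooth_add[OF assms(1) smooth_bilinear[OF bounded_bilinear_scaleR smooth_const[of "-1"] assms(2)]]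
  by simp

lemma smooth_prod:
  fixes f :: "'i \<Rightarrow> 'a::real_normed_vector \<Rightarrow> real"
  shows "(\<And>i. i \<in> I \<Longrightarrow> smooth (f i)) \<Longrightarrow> smooth (\<lambda>x. \<Prod>i\<in>I. f i x)"
  by (induction I rule: infinite_finite_induct) (auto intro: smooth_const smooth_mult)

lemma smooth_power:
  fixes f :: "'a::real_normed_vector \<Rightarrow> real"
  shows "smooth f \<Longrightarrow> smooth (\<lambda>x. f x ^ n)"
  using smooth_prod[of "{..<n}" "\<lambda>_. f"] by simp

lemma smooth_has_derivative:
  "smooth f \<Longrightarrow> (f has_derivative frechet_derivative f (at x)) (at x)"
  unfolding smooth_def by (meson times_cont_differentiable_SucD)

lemma smooth_derivative: "smooth f \<Longrightarrow> smooth (\<lambda>x. frechet_derivative f (at x) d)"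
  unfolding smooth_def by (metis times_cont_differentiable.simps(2))

lemma smooth_continuous: "smooth f \<Longrightarrow> continuous_on UNIV f"
  unfolding smooth_def by (metis times_cont_differentiable_continuous)

section \<open>Smooth approximation of indicator functions of open sets\<close>

text \<open>
  The powers of \<open>t\<close> in the denominator make the family closed under differentiation up to linear
  combinations, so smoothness can be proved for all members simultaneously.
\<close>

definition flat_exp :: "nat \<Rightarrow> real \<Rightarrow> real" where
  "flat_exp j t = (if t > 0 then exp (- (1 / t)) / t ^ j else 0)"

lemma flat_exp_tendsto_0: "flat_exp j \<midarrow>0\<rightarrow> 0"
proof (rule filterlim_split_at)
  show "(flat_exp j \<longlongrightarrow> 0) (at_left 0)"
    by (rule tendsto_eventually) (auto simp: eventually_at_filter flat_exp_def)
  have "((\<lambda>u::real. u ^ j / exp u) \<longlongrightarrow> 0) at_top" for j :: nat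
    by (rule tendsto_power_div_exp_0)
  from filterlim_compose[OF this filterlim_inverse_at_top_right]
  have "((\<lambda>t::real. inverse t ^ j / exp (inverse t)) \<longlongrightarrow> 0) (at_right 0)" .
  then show "(flat_exp j \<longlongrightarrow> 0) (at_right 0)"
    by (rule Lim_transform_eventually)
      (auto simp: eventually_at_filter flat_exp_def exp_minus field_simps)
qed

lemma flat_exp_DERIV:
  "(flat_exp j has_real_derivative (- real j * flat_exp (Suc j) t + flat_exp (Suc (Suc j)) t)) (at t)"
proof -
  consider "t > 0" | "t < 0" | "t = 0" by linarith
  then show ?thesis
  proof cases
    case 1
    have "((\<lambda>t. exp (- (1 / t)) / t ^ j) has_real_derivative (- real j * flat_exp (Suc j) t + flat_exp (Suc (Suc j)) t)) (at t)"
      using 1 by (auto intro!: derivative_eq_intros simp: flat_exp_def field_simps)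
        (cases j; simp add: field_simps)
    moreover have "\<forall>\<^sub>F s in nhds t. exp (- (1 / s)) / s ^ j = flat_exp j s"
      using eventually_nhds_in_open[of "{0<..}" t] 1 by (auto simp: flat_exp_def elim!: eventually_mono)
    ultimately show ?thesis by (simp add: DERIV_cong_ev)
  next
    case 2
    have "\<forall>\<^sub>F s in nhds t. 0 = flat_exp j s"
      using eventually_nhds_in_open[of "{..<0}" t] 2 by (auto simp: flat_exp_def elim!: eventually_mono)
    then have "(flat_exp j has_real_derivative 0) (at t)"
      using DERIV_cong_ev[of t t "\<lambda>_. 0" "flat_exp j" 0 0] by simp
    then show ?thesis using 2 by (simp add: flat_exp_def)
  next
    case 3
    have "flat_exp j h / h = flat_exp (Suc j) h" for h
      by (simp add: flat_exp_def)
    then show ?thesis using 3 flat_exp_tendsto_0[of "Suc j"]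
      by (simp add: DERIV_def flat_exp_def[of _ 0])
  qed
qed

lemma smooth_flat_exp: "smooth (flat_exp j)"
  unfolding smooth_def
proof
  show "times_cont_differentiable k (flat_exp j)" for k
  proof (induction k arbitrary: j)
    case 0
    then show ?case using flat_exp_DERIV by (auto intro!: continuous_at_imp_continuous_on DERIV_isCont)
  next
    case (Suc k)
    show ?case
    proof (rule times_cont_differentiable_SucI)
      show "(flat_exp j has_derivative
         (*) (- real j * flat_exp (Suc j) t + flat_exp (Suc (Suc j)) t)) (at t)" for t
        using flat_exp_DERIV[of j t] by (simp add: has_field_derivative_def)
      show "times_cont_differentiable k (\<lambda>t. (- real j * flat_exp (Suc j) t + flat_exp (Suc (Suc j)) t) * d)" for d
        by (intro times_cont_differentiable_bilinear[OF bounded_bilinear_mult] times_cont_differentiable_add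
            times_cont_differentiable_const Suc)
    qed
  qed
qed

definition bump :: "'a::euclidean_space \<Rightarrow> real \<Rightarrow> 'a \<Rightarrow> real" where
  "bump c r x = flat_exp 0 (r\<^sup>2 - (x - c) \<bullet> (x - c))"

lemma smooth_bump: "smooth (bump c r)"
proof -
  have id: "smooth (\<lambda>x::'a. x - c)"
    by (rule smooth_translate[OF smooth_linear[OF bounded_linear_ident]])
  show ?thesis unfolding bump_def
    by (rule smooth_compose_real[OF smooth_flat_exp])
      (intro smooth_diff smooth_const smooth_bilinear[OF bounded_bilinear_inner] id)
qed

lemma bump_range: "0 \<le> bump c r x" "bump c r x < 1"
  by (auto simp: bump_def flat_exp_def)

lemma bump_pos_iff:
  assumes "r > 0" shows "bump c r x > 0 \<longleftrightarrow> x \<in> ball c r"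
proof -
  have "bump c r x > 0 \<longleftrightarrow> (norm (x - c))\<^sup>2 < r\<^sup>2"
    by (simp add: bump_def flat_exp_def dot_square_norm)
  also have "\<dots> \<longleftrightarrow> norm (x - c) < r"
    using assms by (meson norm_ge_zero less_imp_le power2_less_imp_less power_strict_mono zero_less_numeral)
  finally show ?thesis by (simp add: dist_norm norm_minus_commute)
qed

text \<open>
  Write \<open>U\<close> as a countable union of balls and let \<open>b\<^sub>i\<close> be a bump that is positive exactly on the
  \<open>i\<close>-th ball.  Then \<open>1 - (\<Prod>i<n. (1 - b\<^sub>i) ^ n)\<close> vanishes outside \<open>U\<close>; at a point of \<open>U\<close> some
  factor is the \<open>n\<close>-th power of a fixed number below 1, so the values tend to 1.
\<close>

lemma smooth_approx_open:
  fixes U :: "'a::euclidean_space set"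
  assumes "open U"
  obtains \<phi> :: "nat \<Rightarrow> 'a \<Rightarrow> real"
  where "\<And>n. smooth (\<phi> n)" "\<And>n. bounded {x. \<phi> n x \<noteq> 0}"
    "\<And>n x. 0 \<le> \<phi> n x" "\<And>n x. \<phi> n x \<le> 1"
    "\<And>x. (\<lambda>n. \<phi> n x) \<longlonglongrightarrow> indicator U x"
proof (cases "U = {}")
  case True
  show ?thesis by (rule that[of "\<lambda>_ _. 0"]) (auto simp: True smooth_const)
next
  case False
  let ?B = "{(c, r). 0 < r \<and> ball c r \<subseteq> U}"
  have "open S" if "S \<in> (\<lambda>(c, r). ball c r) ` ?B" for S using that by auto
  then obtain F' where F'1: "F' \<subseteq> (\<lambda>(c, r). ball c r) ` ?B" "countable F'"
      "\<Union>F' = \<Union>((\<lambda>(c, r). ball c r) ` ?B)"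
    by (rule Lindelof)
  have "\<Union>((\<lambda>(c, r). ball c r) ` ?B) = U"
  proof
    show "U \<subseteq> \<Union>((\<lambda>(c, r). ball c r) ` ?B)"
    proof
      fix x assume "x \<in> U"
      then obtain e where "e > 0" "ball x e \<subseteq> U" using assms open_contains_ball by blast
      then have "(x, e) \<in> ?B" "x \<in> ball x e" by auto
      then show "x \<in> \<Union>((\<lambda>(c, r). ball c r) ` ?B)" by blast
    qed
  qed auto
  with F'1 have F': "F' \<subseteq> (\<lambda>(c, r). ball c r) ` ?B" "countable F'" "\<Union>F' = U" by simp_all
  then have "F' \<noteq> {}" using False by auto
  have "\<exists>c r. 0 < r \<and> from_nat_into F' n = ball c r" for n
    using subsetD[OF F'(1) from_nat_into[OF \<open>F' \<noteq> {}\<close>, of n]] by auto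
  then obtain c r where cr: "\<And>n. 0 < r n" "\<And>n. from_nat_into F' n = ball (c n) (r n)" by metis
  have rF: "range (from_nat_into F') = F'" using F'(2) \<open>F' \<noteq> {}\<close> by (rule range_from_nat_into[rotated])
  have U: "U = (\<Union>n. ball (c n) (r n))"
    using arg_cong[OF rF, of Union] F'(3) by (simp add: cr(2))
  define \<phi> where "\<phi> n x = 1 - (\<Prod>i<n. (1 - bump (c i) (r i) x) ^ n)" for n x
  have rng: "0 \<le> (1 - bump (c i) (r i) x) ^ n" "(1 - bump (c i) (r i) x) ^ n \<le> 1" for i n x
    using bump_range[of "c i" "r i" x] by (auto intro!: power_le_one)
  have zero: "bump (c i) (r i) x = 0" if "x \<notin> ball (c i) (r i)" for i x
    using bump_pos_iff[OF cr(1), of "c i" i x] bump_range(1)[of "c i" "r i" x] that by linarith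
  show ?thesis
  proof (rule that[of \<phi>])
    show "smooth (\<phi> n)" for n
      unfolding \<phi>_def by (intro smooth_diff smooth_const smooth_prod smooth_power smooth_bump)
    have "{x. \<phi> n x \<noteq> 0} \<subseteq> (\<Union>i<n. ball (c i) (r i))" for n
    proof (rule subsetI, rule ccontr)
      fix x assume *: "x \<in> {x. \<phi> n x \<noteq> 0}" "x \<notin> (\<Union>i<n. ball (c i) (r i))"
      then have "(\<Prod>i<n. (1 - bump (c i) (r i) x) ^ n) = 1" using zero by (intro prod.neutral) auto
      then show False using * by (simp add: \<phi>_def)
    qed
    then show "bounded {x. \<phi> n x \<noteq> 0}" for n
      by (rule bounded_subset[rotated]) auto
    show "0 \<le> \<phi> n x" "\<phi> n x \<le> 1" for n x
      unfolding \<phi>_def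
      using prod_le_1[of "{..<n}" "\<lambda>i. (1 - bump (c i) (r i) x) ^ n"]
        prod_nonneg[of "{..<n}" "\<lambda>i. (1 - bump (c i) (r i) x) ^ n"] rng by auto
    show "(\<lambda>n. \<phi> n x) \<longlonglongrightarrow> indicator U x" for x
    proof (cases "x \<in> U")
      case False
      then have "bump (c i) (r i) x = 0" for i using zero U by blast
      then have "\<phi> n x = 0" for n by (simp add: \<phi>_def)
      then show ?thesis using False by simp
    next
      case True
      then obtain j where j: "x \<in> ball (c j) (r j)" using U by auto
      let ?q = "1 - bump (c j) (r j) x"
      have q: "0 \<le> ?q" "?q < 1" using bump_range[of "c j" "r j" x] bump_pos_iff[OF cr(1), of "c j" j x] j by auto
      have "(\<lambda>n. \<Prod>i<n. (1 - bump (c i) (r i) x) ^ n) \<longlonglongrightarrow> 0"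
      proof (rule tendsto_sandwich[OF _ _ tendsto_const LIMSEQ_realpow_zero[OF q]])
        show "\<forall>\<^sub>F n in sequentially. (\<Prod>i<n. (1 - bump (c i) (r i) x) ^ n) \<le> ?q ^ n"
          using eventually_gt_at_top[of j]
        proof eventually_elim
          case (elim n)
          have "(\<Prod>i<n. (1 - bump (c i) (r i) x) ^ n) = ?q ^ n * (\<Prod>i\<in>{..<n}-{j}. (1 - bump (c i) (r i) x) ^ n)"
            using elim by (subst prod.remove[of _ j]) auto
          also have "\<dots> \<le> ?q ^ n * 1"
            using rng q by (intro mult_left_mono prod_le_1) auto
          finally show ?case by simp
        qed
      qed (auto simp: rng prod_nonneg)
      from tendsto_diff[OF tendsto_const this, of 1] show ?thesis using True by (simp add: \<phi>_def)
    qed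
  qed
qed

section \<open>The perimeter controls translations\<close>

text \<open>
  Fields bounded by \<open>c\<close> instead of 1 are test fields after rescaling.
\<close>

lemma perimeter_ge_field:
  fixes A :: "'a::euclidean_space set"
  assumes nrm: "is_norm nrm" and v: "smooth v" "bounded {x. v x \<noteq> 0}"
    and c: "c > 0" "\<And>x. nrm (v x) \<le> c"
  shows "ennreal (\<integral>x. indicator A x * divergence v x \<partial>lborel) \<le> ennreal c * perimeter nrm A"
proof -
  let ?w = "\<lambda>x. (1 / c) *\<^sub>R v x"
  have "smooth ?w"
    by (rule smooth_bilinear[OF bounded_bilinear_scaleR smooth_const v(1)])
  moreover have "compact (closure {x. ?w x \<noteq> 0})"
    using v(2) c(1) by (simp add: compact_closure)
  moreover have "nrm (?w x) \<le> 1" for x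
    using nrm c by (simp add: is_norm_def)
  then have "sup_norm nrm ?w \<le> 1"
    unfolding sup_norm_def by (intro SUP_least) auto
  ultimately have w: "?w \<in> test_fields nrm" by (simp add: test_fields_def)
  have "frechet_derivative ?w (at x) = (\<lambda>h. (1 / c) *\<^sub>R frechet_derivative v (at x) h)" for x
    by (rule frechet_derivative_at[symmetric]) (intro has_derivative_scaleR_right smooth_has_derivative v)
  then have div: "divergence ?w x = (1 / c) * divergence v x" for x
    by (simp add: divergence_def sum_distrib_left)
  have "(\<integral>x. indicator A x * divergence ?w x \<partial>lborel) = (1 / c) * (\<integral>x. indicator A x * divergence v x \<partial>lborel)"
    unfolding div by (subst integral_mult_right_zero[symmetric]) (simp add: mult_ac)
  then have "(\<integral>x. indicator A x * divergence v x \<partial>lborel) = c * (\<integral>x. indicator A x * divergence ?w x \<partial>lborel)"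
    using c by simp
  then have "ennreal (\<integral>x. indicator A x * divergence v x \<partial>lborel)
      = ennreal c * ennreal (\<integral>x. indicator A x * divergence ?w x \<partial>lborel)"
    using c by (simp add: ennreal_mult')
  also have "\<dots> \<le> ennreal c * perimeter nrm A"
    unfolding perimeter_def by (intro mult_left_mono SUP_upper w) simp
  finally show ?thesis .
qed

lemma smooth_derivative_support:
  fixes f :: "'a::euclidean_space \<Rightarrow> 'b::real_normed_vector"
  assumes "bounded {x. f x \<noteq> 0}"
  obtains R where "R > 0" "\<And>x. norm x > R \<Longrightarrow> f x = 0" "\<And>x h. norm x > R \<Longrightarrow> frechet_derivative f (at x) h = 0"
proof -
  from assms obtain R where R: "R > 0" "\<And>x. f x \<noteq> 0 \<Longrightarrow> norm x \<le> R"
    unfolding bounded_pos by auto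
  show ?thesis
  proof (rule that[OF R(1)])
    show "f x = 0" if "norm x > R" for x using R(2) that by force
    show "frechet_derivative f (at x) h = 0" if "norm x > R" for x h
    proof -
      have "open {y. norm y > R}" by (intro open_Collect_less continuous_intros)
      then have "(f has_derivative (\<lambda>_. 0)) (at x)"
        by (rule has_derivative_transform_within_open[OF has_derivative_const[of 0]])
          (use R(2) that in force)+
      then show ?thesis using frechet_derivative_at by metis
    qed
  qed
qed

text \<open>
  The difference \<open>\<phi> (x - h) - \<phi> x\<close> is the integral over \<open>t\<close> in \<open>[0, 1]\<close> of the divergence at \<open>x\<close> of
  the field \<open>\<lambda>y. - \<phi> (y - t h) h\<close>, whose norm is at most \<open>nrm h\<close>.  Fubini's theorem then reduces the claim
  to the definition of the perimeter, for each \<open>t\<close> separately.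
\<close>

lemma perimeter_ge_translate_smooth:
  fixes A :: "'a::euclidean_space set"
  assumes nrm: "is_norm nrm" and A: "A \<in> sets borel"
    and \<phi>: "smooth \<phi>" "bounded {x. \<phi> x \<noteq> 0}" "\<And>x. 0 \<le> \<phi> x" "\<And>x. \<phi> x \<le> 1"
  shows "ennreal (\<integral>x. indicator A x * (\<phi> (x - h) - \<phi> x) \<partial>lborel) \<le> ennreal (nrm h) * perimeter nrm A"
proof (cases "h = 0 \<or> perimeter nrm A = top")
  case True
  then show ?thesis
    using nrm by (cases "h = 0") (auto simp: is_norm_def ennreal_mult_top order_less_le)
next
  case False
  then have h: "nrm h > 0" using nrm by (auto simp: is_norm_def order_less_le)
  from False obtain P where P: "P \<ge> 0" "perimeter nrm A = ennreal P"
    by (cases "perimeter nrm A") auto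
  define \<psi> where "\<psi> y = - frechet_derivative \<phi> (at y) h" for y
  have cont: "continuous_on UNIV \<psi>"
    unfolding \<psi>_def by (intro continuous_on_minus smooth_continuous smooth_derivative \<phi>)
  obtain R where R: "R > 0" "\<And>x. norm x > R \<Longrightarrow> \<phi> x = 0" "\<And>x. norm x > R \<Longrightarrow> \<psi> x = 0"
    using smooth_derivative_support[OF \<phi>(2)] unfolding \<psi>_def by (metis neg_equal_0_iff_equal)
  have "compact (\<psi> ` cball 0 R)"
    by (intro compact_continuous_image continuous_on_subset[OF cont]) auto
  from compact_imp_bounded[OF this]
  obtain C where C: "\<And>y. y \<in> cball 0 R \<Longrightarrow> norm (\<psi> y) \<le> C"
    unfolding bounded_iff by blast
  have "0 \<le> C" using order_trans[OF norm_ge_zero C[of 0]] R(1) by simp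
  then have C': "norm (\<psi> y) \<le> C" for y using C[of y] R(3)[of y] by (cases "norm y > R") auto
  have field: "(\<integral>x. indicator A x * \<psi> (x - t *\<^sub>R h) \<partial>lborel) \<le> nrm h * P" for t
  proof -
    let ?v = "\<lambda>x. \<phi> (x - t *\<^sub>R h) *\<^sub>R (- h)"
    have sm: "smooth ?v"
      by (rule smooth_bilinear[OF bounded_bilinear_scaleR smooth_translate[OF \<phi>(1)] smooth_const])
    have "{x. ?v x \<noteq> 0} \<subseteq> (+) (t *\<^sub>R h) ` {x. \<phi> x \<noteq> 0}"
    proof
      fix x assume "x \<in> {x. ?v x \<noteq> 0}"
      then have "x - t *\<^sub>R h \<in> {x. \<phi> x \<noteq> 0}" by auto
      then show "x \<in> (+) (t *\<^sub>R h) ` {x. \<phi> x \<noteq> 0}" by (rule rev_image_eqI) simp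
    qed
    then have bd: "bounded {x. ?v x \<noteq> 0}"
      by (rule bounded_subset[rotated]) (intro bounded_translation \<phi>)
    have nb: "nrm (?v x) \<le> nrm h" for x
    proof -
      have "?v x = (- \<phi> (x - t *\<^sub>R h)) *\<^sub>R h" by simp
      then have "nrm (?v x) = \<bar>- \<phi> (x - t *\<^sub>R h)\<bar> * nrm h"
        using nrm unfolding is_norm_def by presburger
      then have "nrm (?v x) = \<phi> (x - t *\<^sub>R h) * nrm h" using \<phi>(3)[of "x - t *\<^sub>R h"] by simp
      then show ?thesis using \<phi>(4)[of "x - t *\<^sub>R h"] h by (simp add: mult_left_le_one_le \<phi>(3))
    qed
    have "(?v has_derivative (\<lambda>d. frechet_derivative \<phi> (at (x - t *\<^sub>R h)) d *\<^sub>R (- h))) (at x)" for x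
      by (intro has_derivative_scaleR_left has_derivative_compose[OF _ smooth_has_derivative[OF \<phi>(1)]])
        (auto intro!: derivative_eq_intros)
    then have fd: "frechet_derivative ?v (at x) = (\<lambda>d. frechet_derivative \<phi> (at (x - t *\<^sub>R h)) d *\<^sub>R (- h))" for x
      by (metis frechet_derivative_at)
    have "divergence ?v x = \<psi> (x - t *\<^sub>R h)" for x
    proof -
      let ?D = "frechet_derivative \<phi> (at (x - t *\<^sub>R h))"
      interpret D: linear ?D
        using has_derivative_linear[OF smooth_has_derivative[OF \<phi>(1)]] .
      have "?D h = ?D (\<Sum>b\<in>Basis. (h \<bullet> b) *\<^sub>R b)" by (simp add: euclidean_representation)
      also have "\<dots> = (\<Sum>b\<in>Basis. ?D b * (h \<bullet> b))" by (simp add: D.sum D.scaleR mult.commute)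
      finally show ?thesis unfolding divergence_def fd by (simp add: \<psi>_def sum_negf)
    qed
    then have "ennreal (\<integral>x. indicator A x * \<psi> (x - t *\<^sub>R h) \<partial>lborel) \<le> ennreal (nrm h) * perimeter nrm A"
      using perimeter_ge_field[OF nrm sm bd h nb, of A] by simp
    also have "\<dots> = ennreal (nrm h * P)" using P h by (simp add: ennreal_mult')
    finally show ?thesis using P h by (simp add: ennreal_le_iff)
  qed
  define f where "f x t = indicator {0..1::real} t * (indicator A x * \<psi> (x - t *\<^sub>R h))" for x t
  have FTC: "(\<integral>t. f x t \<partial>lborel) = indicator A x * (\<phi> (x - h) - \<phi> x)" for x
  proof -
    have "((\<lambda>t. \<phi> (x - t *\<^sub>R h)) has_vector_derivative \<psi> (x - t *\<^sub>R h)) (at t within {0..1})" for t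
    proof -
      let ?D = "frechet_derivative \<phi> (at (x - t *\<^sub>R h))"
      interpret D: linear ?D
        using has_derivative_linear[OF smooth_has_derivative[OF \<phi>(1)]] .
      have "((\<lambda>t. \<phi> (x - t *\<^sub>R h)) has_derivative (\<lambda>s. ?D (- (s *\<^sub>R h)))) (at t within {0..1})"
        by (rule has_derivative_compose[OF _ smooth_has_derivative[OF \<phi>(1)]])
         (auto intro!: derivative_eq_intros)
      then show ?thesis
        by (simp add: has_vector_derivative_def \<psi>_def D.neg D.scaleR)
    qed
    moreover have "continuous_on {0..1} (\<lambda>t. \<psi> (x - t *\<^sub>R h))"
      by (intro continuous_on_compose2[OF cont] continuous_intros) auto
    ultimately have "(\<integral>t. indicator {0..1} t *\<^sub>R \<psi> (x - t *\<^sub>R h) \<partial>lborel) = \<phi> (x - 1 *\<^sub>R h) - \<phi> (x - 0 *\<^sub>R h)"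
      by (intro integral_FTC_atLeastAtMost) auto
    moreover have "(\<integral>t. f x t \<partial>lborel) = indicator A x * (\<integral>t. indicator {0..1} t *\<^sub>R \<psi> (x - t *\<^sub>R h) \<partial>lborel)"
      unfolding integral_mult_right_zero[symmetric] f_def by (rule Bochner_Integration.integral_cong) auto
    ultimately show ?thesis by simp
  qed
  have int: "integrable (lborel \<Otimes>\<^sub>M lborel) (case_prod f)"
    unfolding lborel_prod
  proof (rule integrableI_bounded_set[where A="cball 0 (R + norm h) \<times> {0..1}" and B=C])
    show "cball 0 (R + norm h) \<times> {0..1} \<in> sets (lborel :: ('a \<times> real) measure)"
      by (simp add: borel_closed closed_Times)
    have "(\<lambda>z. \<psi> (fst z - snd z *\<^sub>R h)) \<in> borel_measurable (borel :: ('a \<times> real) measure)"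
      by (intro borel_measurable_continuous_onI continuous_on_compose2[OF cont] continuous_intros) auto
    moreover have "(\<lambda>z::'a \<times> real. indicator A (fst z) :: real) \<in> borel_measurable borel"
      using A by (intro measurable_compose[OF _ borel_measurable_indicator]) (auto simp: borel_prod[symmetric])
    moreover have "(\<lambda>z::'a \<times> real. indicator {0..1} (snd z) :: real) \<in> borel_measurable borel"
      by (intro measurable_compose[OF _ borel_measurable_indicator]) (auto simp: borel_prod[symmetric])
    ultimately show "case_prod f \<in> borel_measurable lborel"
      by (auto simp: f_def case_prod_beta')
    have "compact (cball (0::'a) (R + norm h) \<times> {0..1::real})" by (intro compact_Times) auto
    then show "emeasure lborel (cball (0::'a) (R + norm h) \<times> {0..1::real}) < \<infinity>"
      by (intro emeasure_bounded_finite compact_imp_bounded)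
    show "AE z in lborel. z \<in> cball (0::'a) (R + norm h) \<times> {0..1} \<longrightarrow> norm (case z of (x, t) \<Rightarrow> f x t) \<le> C"
      using C' \<open>0 \<le> C\<close> by (auto simp: f_def indicator_def split: if_splits)
    have "f x t = 0" if "\<not> (norm x \<le> R + norm h \<and> 0 \<le> t \<and> t \<le> 1)" for x t
    proof (cases "0 \<le> t \<and> t \<le> 1")
      case True
      then have "norm (t *\<^sub>R h) \<le> norm h" by (simp add: mult_left_le_one_le)
      then have "norm (x - t *\<^sub>R h) > R" using that True norm_triangle_ineq2[of x "t *\<^sub>R h"] by linarith
      then show ?thesis using R(3) by (simp add: f_def)
    qed (auto simp: f_def)
    then show "AE z in lborel. z \<notin> cball (0::'a) (R + norm h) \<times> {0..1} \<longrightarrow> (case z of (x, t) \<Rightarrow> f x t) = 0"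
      by (auto simp: mem_Times_iff)
  qed
  have "(\<integral>x. indicator A x * (\<phi> (x - h) - \<phi> x) \<partial>lborel) = (\<integral>x. (\<integral>t. f x t \<partial>lborel) \<partial>lborel)"
    by (simp add: FTC)
  also have "\<dots> = (\<integral>t. (\<integral>x. f x t \<partial>lborel) \<partial>lborel)"
    by (rule lborel_pair.Fubini_integral[OF int, symmetric])
  also have "\<dots> \<le> (\<integral>t. indicator {0..1::real} t * (nrm h * P) \<partial>lborel)"
  proof (rule integral_mono)
    show "integrable lborel (\<lambda>t. \<integral>x. f x t \<partial>lborel)"
      by (rule lborel_pair.integrable_snd[OF int])
    show "(\<integral>x. f x t \<partial>lborel) \<le> indicator {0..1} t * (nrm h * P)" for t
      using field[of t] by (auto simp: f_def indicator_def)
  qed (auto intro!: integrable_real_mult_indicator)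
  also have "\<dots> = nrm h * P" by simp
  finally have "(\<integral>x. indicator A x * (\<phi> (x - h) - \<phi> x) \<partial>lborel) \<le> nrm h * P" .
  then have "ennreal (\<integral>x. indicator A x * (\<phi> (x - h) - \<phi> x) \<partial>lborel) \<le> ennreal (nrm h * P)"
    by (rule ennreal_leI)
  then show ?thesis using P h by (simp add: ennreal_mult')
qed

lemma lborel_integral_translate:
  fixes f :: "'a::euclidean_space \<Rightarrow> real"
  assumes "f \<in> borel_measurable borel"
  shows "(\<integral>x. f (x + a) \<partial>lborel) = (\<integral>x. f x \<partial>lborel)"
proof -
  have "(\<integral>x. f x \<partial>distr lborel borel ((+) a)) = (\<integral>x. f (a + x) \<partial>lborel)"
    by (rule integral_distr) (use assms in auto)
  then show ?thesis by (simp add: lborel_distr_plus add.commute)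
qed

lemma lborel_nn_integral_translate:
  fixes f :: "'a::euclidean_space \<Rightarrow> ennreal"
  assumes "f \<in> borel_measurable borel"
  shows "(\<integral>\<^sup>+x. f (x + a) \<partial>lborel) = (\<integral>\<^sup>+x. f x \<partial>lborel)"
proof -
  have "(\<integral>\<^sup>+x. f x \<partial>distr lborel borel ((+) a)) = (\<integral>\<^sup>+x. f (a + x) \<partial>lborel)"
    by (rule nn_integral_distr) (use assms in auto)
  then show ?thesis by (simp add: lborel_distr_plus add.commute)
qed

lemma translate_borel:
  fixes A :: "'a::euclidean_space set"
  assumes "A \<in> sets borel" shows "{x. x + a \<in> A} \<in> sets borel"
proof -
  have "(\<lambda>x. x + a) -` A \<inter> space borel \<in> sets borel"
    by (rule measurable_sets[OF _ assms]) simp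
  then show ?thesis by (simp add: vimage_def)
qed

lemma emeasure_lborel_translate:
  fixes A :: "'a::euclidean_space set"
  assumes "A \<in> sets borel" shows "emeasure lborel {x. x + a \<in> A} = emeasure lborel A"
  using lborel_nn_integral_translate[of "indicator A" a] assms translate_borel[OF assms, of a]
  by (simp add: indicator_def of_bool_def[symmetric] flip: nn_integral_indicator)

text \<open>
  The set \<open>B\<close> in question is where the difference of the two indicator functions equals 1.
  Testing this difference with smooth approximations of the indicator of an open set slightly larger
  than \<open>B\<close> gives the measure of \<open>B\<close> up to an arbitrarily small error.
\<close>

lemma emeasure_translate_enter_le:
  fixes A :: "'a::euclidean_space set"
  assumes nrm: "is_norm nrm" and A: "A \<in> sets borel" and fin: "emeasure lborel A < \<infinity>"
  shows "emeasure lborel {x. x + h \<in> A \<and> x \<notin> A} \<le> ennreal (nrm h) * perimeter nrm A"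
proof (cases "ennreal (nrm h) * perimeter nrm A = top")
  case True then show ?thesis by simp
next
  case False
  then obtain K where K: "K \<ge> 0" "ennreal (nrm h) * perimeter nrm A = ennreal K"
    by (cases "ennreal (nrm h) * perimeter nrm A") auto
  define A' where "A' = {x. x + h \<in> A}"
  have A': "A' \<in> sets borel" unfolding A'_def by (rule translate_borel[OF A])
  have fin': "emeasure lborel A' < \<infinity>" unfolding A'_def emeasure_lborel_translate[OF A] by (rule fin)
  let ?B = "A' - A"
  have B: "?B \<in> sets borel" using A A' by auto
  have finB: "emeasure lborel ?B < \<infinity>"
    by (rule le_less_trans[OF _ fin']) (use A' in \<open>auto intro!: emeasure_mono\<close>)
  have "measure lborel ?B \<le> K + e" if "e > 0" for e
  proof -
    obtain U where U: "open U" "?B \<subseteq> U" "emeasure lborel (U - ?B) < ennreal e"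
      using outer_regular_lborel[OF B \<open>e > 0\<close>] .
    obtain \<phi> :: "nat \<Rightarrow> 'a \<Rightarrow> real" where \<phi>: "\<And>n. smooth (\<phi> n)" "\<And>n. bounded {x. \<phi> n x \<noteq> 0}"
      "\<And>n x. 0 \<le> \<phi> n x" "\<And>n x. \<phi> n x \<le> 1" "\<And>x. (\<lambda>n. \<phi> n x) \<longlonglongrightarrow> indicator U x"
      using smooth_approx_open[OF U(1)] by blast
    have m\<phi>: "\<phi> n \<in> borel_measurable borel" for n
      by (intro borel_measurable_continuous_onI smooth_continuous \<phi>)
    let ?f = "\<lambda>x. indicator A' x - indicator A x :: real"
    have iA: "integrable lborel (indicat_real A)" "integrable lborel (indicat_real A')"
      using A A' fin fin' by auto
    have bnd: "\<bar>indicator A x * (\<phi> n y)\<bar> \<le> indicat_real A x" for x y n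
      using \<phi>(3,4)[of n y] by (auto simp: indicator_def)
    have int: "(\<integral>x. indicator A x * (\<phi> n (x - h) - \<phi> n x) \<partial>lborel) = (\<integral>x. ?f x * \<phi> n x \<partial>lborel)" for n
    proof -
      have i1: "integrable lborel (\<lambda>x. indicator A x * \<phi> n (x - h))"
        by (rule Bochner_Integration.integrable_bound[OF iA(1)])
          (use bnd A in \<open>auto intro!: borel_measurable_times measurable_compose[OF _ m\<phi>]\<close>)
      have i2: "integrable lborel (\<lambda>x. indicator A x * \<phi> n x)"
        by (rule Bochner_Integration.integrable_bound[OF iA(1)]) (use bnd A m\<phi> in auto)
      have i3: "integrable lborel (\<lambda>x. indicator A' x * \<phi> n x)"
        by (rule Bochner_Integration.integrable_bound[OF iA(2)])
          (use \<phi>(3,4) A' m\<phi> in \<open>auto simp: indicator_def\<close>)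
      have "(\<integral>x. indicator A x * \<phi> n (x - h) \<partial>lborel) = (\<integral>x. indicator A (x + h) * \<phi> n (x + h - h) \<partial>lborel)"
        by (rule lborel_integral_translate[symmetric])
          (use A in \<open>auto intro!: borel_measurable_times measurable_compose[OF _ m\<phi>]\<close>)
      also have "\<dots> = (\<integral>x. indicator A' x * \<phi> n x \<partial>lborel)"
        by (simp add: A'_def indicator_def)
      finally show ?thesis
        using i1 i2 i3 by (simp add: algebra_simps)
    qed
    have "(\<lambda>n. \<integral>x. ?f x * \<phi> n x \<partial>lborel) \<longlonglongrightarrow> (\<integral>x. ?f x * indicator U x \<partial>lborel)"
    proof (rule integral_dominated_convergence[where w="\<lambda>x. indicator A' x + indicator A x"])
      show "AE x in lborel. norm (?f x * \<phi> n x) \<le> indicator A' x + indicator A x" for n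
        using \<phi>(3,4)[of n] by (auto simp: indicator_def)
    qed (use A A' U(1) m\<phi> iA in \<open>auto intro!: tendsto_intros \<phi>(5)\<close>)
    then have "(\<integral>x. ?f x * indicator U x \<partial>lborel) \<le> K"
    proof (rule LIMSEQ_le_const2, intro exI allI impI)
      fix n
      have "ennreal (\<integral>x. ?f x * \<phi> n x \<partial>lborel) \<le> ennreal K"
        unfolding int[symmetric] K(2)[symmetric] by (rule perimeter_ge_translate_smooth[OF nrm A \<phi>(1-4)])
      then show "(\<integral>x. ?f x * \<phi> n x \<partial>lborel) \<le> K" using K(1) by (simp add: ennreal_le_iff)
    qed
    moreover have iUB: "integrable lborel (indicat_real (U - ?B))"
      using U B by (auto simp: less_top[symmetric] intro!: integrable_real_indicator order_less_trans[OF U(3)])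
    have iB: "integrable lborel (indicat_real ?B)" using B finB by auto
    \<comment> \<open>On \<open>U\<close> outside \<open>B\<close> the difference of the indicators may be negative, but not below -1.\<close>
    have "(\<integral>x. indicator ?B x - indicator (U - ?B) x \<partial>lborel) \<le> (\<integral>x. ?f x * indicator U x \<partial>lborel)"
    proof (rule integral_mono)
      show "integrable lborel (\<lambda>x. indicat_real ?B x - indicator (U - ?B) x)"
        using iUB iB by auto
      show "integrable lborel (\<lambda>x. ?f x * indicator U x)"
        using iA U(1) by (intro integrable_real_mult_indicator Bochner_Integration.integrable_diff) auto
      show "indicat_real ?B x - indicator (U - ?B) x \<le> ?f x * indicator U x" for x
        using U(2) by (auto simp: indicator_def)
    qed
    then have "measure lborel ?B - measure lborel (U - ?B) \<le> (\<integral>x. ?f x * indicator U x \<partial>lborel)"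
      using iUB iB B U(1) by (simp add: Bochner_Integration.integral_diff)
    moreover have "measure lborel (U - ?B) < e"
      using U(3) \<open>e > 0\<close> unfolding measure_def by (metis enn2real_less_iff order_less_trans ennreal_less_top)
    ultimately show ?thesis by linarith
  qed
  then have "measure lborel ?B \<le> K" by (rule field_le_epsilon)
  then have "emeasure lborel ?B \<le> ennreal K"
    using finB by (simp add: emeasure_eq_ennreal_measure ennreal_leI)
  moreover have "?B = {x. x + h \<in> A \<and> x \<notin> A}" by (auto simp: A'_def)
  ultimately show ?thesis using K by simp
qed

corollary emeasure_translate_leave_le:
  fixes A :: "'a::euclidean_space set"
  assumes nrm: "is_norm nrm" and A: "A \<in> sets borel" and fin: "emeasure lborel A < \<infinity>"
  shows "emeasure lborel {x. x \<in> A \<and> x + h \<notin> A} \<le> ennreal (nrm h) * perimeter nrm A"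
proof -
  have "{x. x + (- h) \<in> A \<and> x \<notin> A} = {x. x + (-h) \<in> A} \<inter> - A" by auto
  then have "{x. x + (- h) \<in> A \<and> x \<notin> A} \<in> sets borel"
    using A translate_borel[OF A, of "-h"] by auto
  from emeasure_lborel_translate[OF this, of h]
  have "emeasure lborel {x. x \<in> A \<and> x + h \<notin> A} = emeasure lborel {x. x + (- h) \<in> A \<and> x \<notin> A}"
    by simp
  also have "\<dots> \<le> ennreal (nrm (- h)) * perimeter nrm A"
    by (rule emeasure_translate_enter_le[OF assms])
  also have "nrm (- h) = nrm h"
    using nrm unfolding is_norm_def by (metis abs_minus_cancel abs_one mult_1 scaleR_minus1_left)
  finally show ?thesis .
qed

section \<open>Grid cells\<close>

text \<open>
  Grid cells are half-open cubes of side \<open>1 / p\<close>; \<open>grid_round p x\<close> is the lowest corner of the cell that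
  contains \<open>x\<close> and serves as its name.  Cells named by points that are not corners are empty.
\<close>

definition grid_round :: "real \<Rightarrow> 'a::euclidean_space \<Rightarrow> 'a" where
  "grid_round p x = (\<Sum>b\<in>Basis. (of_int \<lfloor>p * (x \<bullet> b)\<rfloor> / p) *\<^sub>R b)"

definition grid_cell :: "real \<Rightarrow> 'a::euclidean_space \<Rightarrow> 'a set" where
  "grid_cell p z = {y. grid_round p y = z}"

lemma grid_round_inner:
  "b \<in> Basis \<Longrightarrow> grid_round p x \<bullet> b = of_int \<lfloor>p * (x \<bullet> b)\<rfloor> / p"
  by (simp add: grid_round_def inner_sum_left inner_Basis if_distrib cong: if_cong)

lemma grid_round_eq_iff:
  assumes "p > 0"
  shows "grid_round p x = grid_round p y \<longleftrightarrow> (\<forall>b\<in>Basis. \<lfloor>p * (x \<bullet> b)\<rfloor> = \<lfloor>p * (y \<bullet> b)\<rfloor>)"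
  using assms by (auto simp: euclidean_eq_iff[where 'a='a] grid_round_inner)

lemma grid_round_measurable: "grid_round p \<in> borel_measurable borel"
  unfolding grid_round_def[abs_def]
  by (intro borel_measurable_sum borel_measurable_scaleR borel_measurable_divide borel_measurable_const
      measurable_compose[OF _ borel_measurable_real_floor]) auto

lemma grid_cell_borel: "grid_cell p z \<in> sets borel"
proof -
  have "grid_round p -` {z} \<inter> space borel \<in> sets borel"
    by (rule measurable_sets[OF grid_round_measurable]) auto
  then show ?thesis by (simp add: grid_cell_def vimage_def)
qed

lemma finite_grid_round_image:
  assumes "p > 0" "bounded S" shows "finite (grid_round p ` S)"
proof -
  from assms(2) obtain R where R: "\<And>x. x \<in> S \<Longrightarrow> norm x \<le> R" unfolding bounded_iff by blast
  let ?I = "{\<lfloor>- (p * R)\<rfloor>..\<lfloor>p * R\<rfloor>}"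
  have "grid_round p x \<in> (\<lambda>f. \<Sum>b\<in>Basis. (of_int (f b) / p) *\<^sub>R b) ` (Basis \<rightarrow>\<^sub>E ?I)" if "x \<in> S" for x
  proof (rule image_eqI)
    let ?f = "restrict (\<lambda>b. \<lfloor>p * (x \<bullet> b)\<rfloor>) Basis"
    show "grid_round p x = (\<Sum>b\<in>Basis. (of_int (?f b) / p) *\<^sub>R b)"
      unfolding grid_round_def by (rule sum.cong) auto
    have "\<bar>x \<bullet> b\<bar> \<le> R" if "b \<in> Basis" for b
      using Basis_le_norm[OF that, of x] R[OF \<open>x \<in> S\<close>] by linarith
    then have "p * (x \<bullet> b) \<le> p * R \<and> p * (- R) \<le> p * (x \<bullet> b)" if "b \<in> Basis" for b
      using abs_le_D1[of "x \<bullet> b" R] abs_le_D2[of "x \<bullet> b" R] that assms(1) by (intro conjI mult_left_mono) auto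
    then show "?f \<in> Basis \<rightarrow>\<^sub>E ?I" by (auto intro!: floor_mono)
  qed
  then have "grid_round p ` S \<subseteq> (\<lambda>f. \<Sum>b\<in>Basis. (of_int (f b) / p) *\<^sub>R b) ` (Basis \<rightarrow>\<^sub>E ?I)"
    by auto
  then show ?thesis by (rule finite_subset) (auto intro!: finite_PiE)
qed

lemma countable_range_grid_round:
  assumes "p > 0" shows "countable (range (grid_round p :: 'a \<Rightarrow> 'a::euclidean_space))"
proof -
  have "(UNIV :: 'a set) = (\<Union>n. ball 0 (real n))"
    using reals_Archimedean2 by auto
  then have "range (grid_round p :: 'a \<Rightarrow> 'a) = (\<Union>n. grid_round p ` ball 0 (real n))"
    by (metis image_UN)
  moreover have "countable (grid_round p ` ball (0::'a) (real n))" for n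
    by (intro countable_finite finite_grid_round_image assms) simp
  ultimately show ?thesis by (simp only: countable_UN[OF countableI_type])
qed

lemma grid_predicate_borel:
  assumes "p > 0" shows "{x. Q (grid_round p x)} \<in> sets borel"
proof -
  have "{x. Q (grid_round p x)} = (\<Union>z\<in>range (grid_round p) \<inter> Collect Q. grid_cell p z)"
    by (auto simp: grid_cell_def)
  also have "\<dots> \<in> sets borel"
    by (rule sets.countable_UN'') (auto intro: countable_Int1 countable_range_grid_round[OF assms] grid_cell_borel)
  finally show ?thesis .
qed

lemma same_cell_near:
  assumes "p > 0" "grid_round p x = grid_round p y" "b \<in> Basis"
  shows "\<bar>(y - x) \<bullet> b\<bar> < 1 / p"
proof -
  have "\<lfloor>p * (x \<bullet> b)\<rfloor> = \<lfloor>p * (y \<bullet> b)\<rfloor>"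
    using assms grid_round_eq_iff by blast
  then have "\<bar>p * (y \<bullet> b) - p * (x \<bullet> b)\<bar> < 1" by linarith
  then have "p * \<bar>(y - x) \<bullet> b\<bar> < 1"
    using assms(1) by (simp add: inner_diff_left abs_mult flip: right_diff_distrib)
  then show ?thesis using assms(1) by (simp add: field_simps)
qed

lemma emeasure_grid_cell:
  assumes p: "p > 0"
  shows "emeasure lborel (grid_cell p (grid_round p x :: 'a::euclidean_space)) = ennreal ((1 / p) ^ DIM('a))"
proof (rule antisym)
  let ?z = "grid_round p x" and ?w = "grid_round p x + (1 / p) *\<^sub>R (\<Sum>b\<in>Basis. b) :: 'a"
  have w: "?w \<bullet> b = ?z \<bullet> b + 1 / p" if "b \<in> Basis" for b
    using that by (simp add: inner_add_left inner_sum_left inner_Basis if_distrib cong: if_cong)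
  have z: "\<lfloor>p * (?z \<bullet> b)\<rfloor> = \<lfloor>p * (x \<bullet> b)\<rfloor>" "p * (?z \<bullet> b) = of_int \<lfloor>p * (x \<bullet> b)\<rfloor>" if "b \<in> Basis" for b
    using that p by (simp_all add: grid_round_inner)
  have iff: "y \<in> grid_cell p ?z \<longleftrightarrow> (\<forall>b\<in>Basis. ?z \<bullet> b \<le> y \<bullet> b \<and> y \<bullet> b < ?z \<bullet> b + 1 / p)" for y
  proof -
    have "y \<in> grid_cell p ?z \<longleftrightarrow> (\<forall>b\<in>Basis. p * (?z \<bullet> b) \<le> p * (y \<bullet> b) \<and> p * (y \<bullet> b) < p * (?z \<bullet> b) + 1)"
      unfolding grid_cell_def mem_Collect_eq grid_round_eq_iff[OF p]
      by (intro ball_cong refl) (simp only: z(2) floor_eq_iff)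
    also have "\<dots> \<longleftrightarrow> (\<forall>b\<in>Basis. ?z \<bullet> b \<le> y \<bullet> b \<and> y \<bullet> b < ?z \<bullet> b + 1 / p)"
      using p by (intro ball_cong refl) (simp add: field_simps)
    finally show ?thesis .
  qed
  have "box ?z ?w \<subseteq> grid_cell p ?z" "grid_cell p ?z \<subseteq> cbox ?z ?w"
    by (auto simp: iff mem_box w order_less_imp_le)
  then have "emeasure lborel (box ?z ?w) \<le> emeasure lborel (grid_cell p ?z)"
     "emeasure lborel (grid_cell p ?z) \<le> emeasure lborel (cbox ?z ?w)"
    by (auto intro!: emeasure_mono grid_cell_borel)
  moreover have "(\<Prod>b\<in>Basis. (?w - ?z) \<bullet> b) = (1 / p) ^ DIM('a)"
    using w by (simp add: inner_diff_left)
  ultimately show "emeasure lborel (grid_cell p ?z) \<le> ennreal ((1 / p) ^ DIM('a))"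
     "ennreal ((1 / p) ^ DIM('a)) \<le> emeasure lborel (grid_cell p ?z)"
    using p w by (simp_all add: emeasure_lborel_box_eq emeasure_lborel_cbox_eq)
qed

lemma nrm_le_coordinates:
  fixes nrm :: "'a::euclidean_space \<Rightarrow> real"
  assumes nrm: "is_norm nrm" and "\<And>b. b \<in> Basis \<Longrightarrow> \<bar>h \<bullet> b\<bar> \<le> d"
  shows "nrm h \<le> d * (\<Sum>b\<in>Basis. nrm b)"
proof -
  have sum: "nrm (\<Sum>b\<in>S. f b) \<le> (\<Sum>b\<in>S. nrm (f b))" if "finite S" for S and f :: "'a \<Rightarrow> 'a"
    using that
  proof (induction S)
    case empty
    have "nrm 0 = 0" using nrm unfolding is_norm_def by blast
    then show ?case by simp
  next
    case (insert b S)
    have "nrm (f b + (\<Sum>b\<in>S. f b)) \<le> nrm (f b) + nrm (\<Sum>b\<in>S. f b)"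
      using nrm by (simp add: is_norm_def)
    then show ?case using insert by simp
  qed
  have "nrm h = nrm (\<Sum>b\<in>Basis. (h \<bullet> b) *\<^sub>R b)" by (simp add: euclidean_representation)
  also have "\<dots> \<le> (\<Sum>b\<in>Basis. nrm ((h \<bullet> b) *\<^sub>R b))" by (rule sum) simp
  also have "\<dots> = (\<Sum>b\<in>Basis. \<bar>h \<bullet> b\<bar> * nrm b)" using nrm by (simp add: is_norm_def)
  also have "\<dots> \<le> (\<Sum>b\<in>Basis. d * nrm b)"
    using nrm assms(2) by (intro sum_mono mult_right_mono) (auto simp: is_norm_def)
  finally show ?thesis by (simp add: sum_distrib_left)
qed

text \<open>
  A vector joining two points of the same cell of side \<open>1 / p\<close> has \<open>nrm\<close> at most
  \<open>(\<Sum>b\<in>Basis. nrm b) / p\<close>, and such vectors fill a cube whose volume is \<open>2 ^ DIM('a)\<close> times that of the cell.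
\<close>

definition cell_const :: "('a::euclidean_space \<Rightarrow> real) \<Rightarrow> real" where
  "cell_const nrm = 2 ^ DIM('a) * (\<Sum>b\<in>Basis. nrm b)"

text \<open>
  Integrating over \<open>x \<in> D\<close> the measure of the part of the cell of \<open>x\<close> outside \<open>D\<close> amounts to counting pairs
  \<open>(x, x + h)\<close> in one cell with \<open>x\<close> inside and \<open>x + h\<close> outside \<open>D\<close>.  By Tonelli's theorem they may be counted
  for each \<open>h\<close> first, where the translation estimate applies; Markov's inequality does the rest.
  The set \<open>D\<close> will be a set of finite measure or the complement of one, so the translation estimate
  enters as a hypothesis.
\<close>

lemma mixed_cells_le:
  fixes D :: "'a::euclidean_space set"
  assumes nrm: "is_norm nrm" and D: "D \<in> sets borel" and p: "p > 0" and \<theta>: "\<theta> \<ge> 0"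
    and transl: "\<And>h. emeasure lborel {x. x \<in> D \<and> x + h \<notin> D} \<le> ennreal (nrm h) * P"
  shows "ennreal \<theta> * emeasure lborel {x \<in> D. ennreal (\<theta> * (1 / p) ^ DIM('a)) \<le>
            emeasure lborel (grid_cell p (grid_round p x) - D)}
     \<le> ennreal (cell_const nrm / p) * P"
proof -
  let ?v = "(1 / p) ^ DIM('a)" and ?c = "\<Sum>b\<in>Basis. nrm b"
  define S where "S = {x \<in> D. ennreal (\<theta> * ?v) \<le> emeasure lborel (grid_cell p (grid_round p x) - D)}"
  let ?B = "box (- ((1 / p) *\<^sub>R (\<Sum>b\<in>Basis. b))) ((1 / p) *\<^sub>R (\<Sum>b\<in>Basis. b)) :: 'a set"
  have c: "?c \<ge> 0" using nrm by (intro sum_nonneg) (simp add: is_norm_def)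
  have S: "S \<in> sets borel"
    using sets.Int[OF D grid_predicate_borel[OF p, of "\<lambda>z. ennreal (\<theta> * ?v) \<le> emeasure lborel (grid_cell p z - D)"]]
    by (simp add: Int_def S_def)
  have memB: "h \<in> ?B \<longleftrightarrow> (\<forall>b\<in>Basis. \<bar>h \<bullet> b\<bar> < 1 / p)" for h
  proof -
    define w where "w = (1 / p) *\<^sub>R (\<Sum>b\<in>Basis. b :: 'a)"
    have "w \<bullet> b = 1 / p" if "b \<in> Basis" for b
      using that by (simp add: w_def inner_sum_left inner_Basis)
    then have "((- w) \<bullet> b < h \<bullet> b \<and> h \<bullet> b < w \<bullet> b) = (\<bar>h \<bullet> b\<bar> < 1 / p)" if "b \<in> Basis" for b
      using that unfolding inner_minus_left by (metis abs_less_iff minus_less_iff)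
    then show ?thesis unfolding mem_box w_def by (intro ball_cong refl)
  qed
  have m1: "{z :: 'a \<times> 'a. fst z \<in> D} \<in> sets borel" "{z :: 'a \<times> 'a. fst z + snd z \<notin> D} \<in> sets borel"
    "{z :: 'a \<times> 'a. snd z \<in> ?B} \<in> sets borel"
  proof -
    have "fst -` D \<inter> space (borel :: ('a \<times> 'a) measure) \<in> sets borel"
      by (rule measurable_sets[OF borel_measurable_continuous_onI D]) (intro continuous_intros)
    then show "{z :: 'a \<times> 'a. fst z \<in> D} \<in> sets borel" by (simp add: vimage_def)
    have "(\<lambda>z. fst z + snd z) -` (- D) \<inter> space (borel :: ('a \<times> 'a) measure) \<in> sets borel"
      by (rule measurable_sets[OF borel_measurable_continuous_onI]) (use D in \<open>auto intro!: continuous_intros\<close>)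
    then show "{z :: 'a \<times> 'a. fst z + snd z \<notin> D} \<in> sets borel" by (simp add: vimage_def)
    have "snd -` ?B \<inter> space (borel :: ('a \<times> 'a) measure) \<in> sets borel"
      by (rule measurable_sets[OF borel_measurable_continuous_onI]) (auto intro!: continuous_intros)
    then show "{z :: 'a \<times> 'a. snd z \<in> ?B} \<in> sets borel" by (simp add: vimage_def)
  qed
  let ?M = "{z. fst z \<in> D} \<inter> {z. fst z + snd z \<notin> D} \<inter> {z. snd z \<in> ?B}"
  define F where "F x h = (indicator ?M (x, h) :: ennreal)" for x h
  have F: "case_prod F \<in> borel_measurable (lborel \<Otimes>\<^sub>M lborel)"
    unfolding lborel_prod F_def case_prod_beta' prod.collapse using m1 by simp
  have "ennreal (\<theta> * ?v) * emeasure lborel S = (\<integral>\<^sup>+x. ennreal (\<theta> * ?v) * indicator S x \<partial>lborel)"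
    by (rule nn_integral_cmult_indicator[symmetric]) (simp add: S)
  also have "\<dots> \<le> (\<integral>\<^sup>+x. (\<integral>\<^sup>+h. F x h \<partial>lborel) \<partial>lborel)"
  proof (rule nn_integral_mono)
    fix x :: 'a
    show "ennreal (\<theta> * ?v) * indicator S x \<le> (\<integral>\<^sup>+h. F x h \<partial>lborel)"
    proof (cases "x \<in> S")
      case True
      let ?C = "grid_cell p (grid_round p x) - D"
      have C: "?C \<in> sets borel" using D grid_cell_borel by auto
      have "ennreal (\<theta> * ?v) \<le> emeasure lborel ?C" using True by (simp add: S_def)
      also have "\<dots> = emeasure lborel {h. h + x \<in> ?C}"
        by (rule emeasure_lborel_translate[symmetric, OF C])
      also have "\<dots> = (\<integral>\<^sup>+h. indicator {h. h + x \<in> ?C} h \<partial>lborel)"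
        using translate_borel[OF C, of x] by simp
      also have "\<dots> \<le> (\<integral>\<^sup>+h. F x h \<partial>lborel)"
      proof (rule nn_integral_mono)
        fix h :: 'a
        have "(x, h) \<in> ?M" if "h + x \<in> ?C"
        proof -
          have "h \<in> ?B" unfolding memB
            using same_cell_near[OF p, of x "h + x"] that by (auto simp: grid_cell_def)
          then show ?thesis using that True by (auto simp: add.commute S_def)
        qed
        then show "indicator {h. h + x \<in> ?C} h \<le> F x h" by (auto simp: F_def indicator_def)
      qed
      finally show ?thesis using True by simp
    qed simp
  qed
  also have "\<dots> = (\<integral>\<^sup>+h. (\<integral>\<^sup>+x. F x h \<partial>lborel) \<partial>lborel)"
    by (rule lborel_pair.Fubini'[OF F, symmetric])
  also have "\<dots> \<le> (\<integral>\<^sup>+h. (ennreal (?c / p) * P) * indicator ?B h \<partial>lborel)"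
  proof (rule nn_integral_mono)
    fix h :: 'a
    show "(\<integral>\<^sup>+x. F x h \<partial>lborel) \<le> (ennreal (?c / p) * P) * indicator ?B h"
    proof (cases "h \<in> ?B")
      case True
      have "{x. x \<in> D \<and> x + h \<notin> D} = D \<inter> - {x. x + h \<in> D}" by auto
      then have "{x. x \<in> D \<and> x + h \<notin> D} \<in> sets borel"
        using D translate_borel[OF D, of h] by auto
      then have "emeasure lborel {x. x \<in> D \<and> x + h \<notin> D} = (\<integral>\<^sup>+x. indicator {x. x \<in> D \<and> x + h \<notin> D} x \<partial>lborel)"
        by simp
      moreover have "F x h = indicator {x. x \<in> D \<and> x + h \<notin> D} x" for x
        using True by (simp add: F_def indicator_def)
      ultimately have "(\<integral>\<^sup>+x. F x h \<partial>lborel) = emeasure lborel {x. x \<in> D \<and> x + h \<notin> D}" by simp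
      also have "\<dots> \<le> ennreal (nrm h) * P" by (rule transl)
      also have "\<dots> \<le> ennreal (?c / p) * P"
      proof (intro mult_right_mono ennreal_leI)
        have "\<bar>h \<bullet> b\<bar> \<le> 1 / p" if "b \<in> Basis" for b
          using True that unfolding memB by (simp add: order_less_imp_le)
        from nrm_le_coordinates[OF nrm this] show "nrm h \<le> ?c / p" by simp
      qed simp
      finally show ?thesis using True by simp
    qed (simp add: F_def)
  qed
  also have "\<dots> = (ennreal (?c / p) * P) * emeasure lborel ?B" by (simp add: nn_integral_cmult)
  also have "emeasure lborel ?B = ennreal (2 ^ DIM('a) * ?v)"
  proof -
    define w where "w = (1 / p) *\<^sub>R (\<Sum>b\<in>Basis. b :: 'a)"
    have w: "w \<bullet> b = 1 / p" if "b \<in> Basis" for b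
      using that by (simp add: w_def inner_sum_left inner_Basis)
    have "(\<Prod>b\<in>Basis. (w - - w) \<bullet> b) = (\<Prod>b\<in>(Basis :: 'a set). 2 / p)"
      by (rule prod.cong) (simp_all add: w inner_add_left)
    moreover have "\<forall>b\<in>Basis. (- w) \<bullet> b \<le> w \<bullet> b" using p by (simp add: w)
    ultimately show ?thesis unfolding w_def[symmetric]
      by (simp add: emeasure_lborel_box_eq power_divide)
  qed
  also have "(ennreal (?c / p) * P) * ennreal (2 ^ DIM('a) * ?v) = ennreal ?v * (ennreal (cell_const nrm / p) * P)"
  proof -
    have "ennreal (?c / p) * ennreal (2 ^ DIM('a) * ?v) = ennreal ?v * ennreal (cell_const nrm / p)"
      using c p by (subst (1 2) ennreal_mult'[symmetric]) (auto simp: cell_const_def mult_ac)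
    then show ?thesis by (metis mult.assoc mult.commute)
  qed
  finally have *: "ennreal ?v * (ennreal \<theta> * emeasure lborel S) \<le> ennreal ?v * (ennreal (cell_const nrm / p) * P)"
    using \<theta> by (simp add: ennreal_mult' mult_ac)
  have v: "?v > 0" using p by simp
  have "ennreal (1 / ?v) * (ennreal ?v * (ennreal \<theta> * emeasure lborel S)) \<le>
     ennreal (1 / ?v) * (ennreal ?v * (ennreal (cell_const nrm / p) * P))"
    by (rule mult_left_mono[OF *]) simp
  moreover have "ennreal (1 / ?v) * (ennreal ?v * X) = X" for X
    using v p by (simp add: mult.assoc[symmetric] ennreal_mult'[symmetric])
  ultimately show ?thesis by (simp add: S_def)
qed

lemma cell_const_nonneg: "is_norm nrm \<Longrightarrow> 0 \<le> cell_const nrm"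
  unfolding cell_const_def by (intro mult_nonneg_nonneg sum_nonneg) (auto simp: is_norm_def)

lemma mixed_cells_inside_le:
  fixes A :: "'a::euclidean_space set"
  assumes "is_norm nrm" "A \<in> sets borel" "emeasure lborel A < \<infinity>" "p > 0" "\<theta> \<ge> 0"
  shows "ennreal \<theta> * emeasure lborel {x \<in> A. ennreal (\<theta> * (1 / p) ^ DIM('a)) \<le>
            emeasure lborel (grid_cell p (grid_round p x) - A)}
     \<le> ennreal (cell_const nrm / p) * perimeter nrm A"
  using assms by (intro mixed_cells_le emeasure_translate_leave_le) auto

lemma mixed_cells_outside_le:
  fixes A :: "'a::euclidean_space set"
  assumes "is_norm nrm" "A \<in> sets borel" "emeasure lborel A < \<infinity>" "p > 0" "\<theta> \<ge> 0"
  shows "ennreal \<theta> * emeasure lborel {x. x \<notin> A \<and> ennreal (\<theta> * (1 / p) ^ DIM('a)) \<le>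
            emeasure lborel (A \<inter> grid_cell p (grid_round p x))}
     \<le> ennreal (cell_const nrm / p) * perimeter nrm A"
proof -
  have "{x. x \<in> - A \<and> x + h \<notin> - A} = {x. x + h \<in> A \<and> x \<notin> A}" for h by auto
  then have "emeasure lborel {x. x \<in> - A \<and> x + h \<notin> - A} \<le> ennreal (nrm h) * perimeter nrm A" for h
    using emeasure_translate_enter_le[OF assms(1-3), of h] by simp
  from mixed_cells_le[OF assms(1) _ assms(4,5) this] show ?thesis
    using assms(2) by (simp add: Diff_eq Int_commute)
qed

lemma grid_round_refine:
  assumes "p > (0::nat)" "grid_round (real p) x = grid_round (real p) y"
  shows "grid_round 1 x = grid_round 1 y"
proof -
  have *: "\<lfloor>s\<rfloor> \<le> \<lfloor>t\<rfloor>" if "\<lfloor>real p * s\<rfloor> = \<lfloor>real p * t\<rfloor>" for s t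
  proof -
    have "real_of_int (int p * \<lfloor>s\<rfloor>) \<le> real p * s" using assms(1) by simp
    then have "int p * \<lfloor>s\<rfloor> \<le> \<lfloor>real p * s\<rfloor>" by (simp only: le_floor_iff)
    then have "real_of_int (int p * \<lfloor>s\<rfloor>) \<le> real p * t" unfolding that by (simp only: le_floor_iff)
    then show ?thesis using assms(1) by (simp add: le_floor_iff)
  qed
  have "\<forall>b\<in>Basis. \<lfloor>real p * (x \<bullet> b)\<rfloor> = \<lfloor>real p * (y \<bullet> b)\<rfloor>"
    using assms grid_round_eq_iff[of "real p" x y] by simp
  then have "\<forall>b\<in>Basis. \<lfloor>x \<bullet> b\<rfloor> = \<lfloor>y \<bullet> b\<rfloor>"
    using * by (metis order_antisym)
  then show ?thesis by (simp add: grid_round_eq_iff)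
qed

lemma half_cell_outside:
  fixes A :: "'a::euclidean_space set"
  assumes A: "A \<in> sets borel" and p: "p > 0"
    and "emeasure lborel (A \<inter> grid_cell p (grid_round p x)) \<le> ennreal (1 / 2 * (1 / p) ^ DIM('a))"
  shows "ennreal (1 / 2 * (1 / p) ^ DIM('a)) \<le> emeasure lborel (grid_cell p (grid_round p x) - A)"
proof (rule ccontr)
  let ?D = "grid_cell p (grid_round p x)" and ?v = "(1 / p) ^ DIM('a)"
  assume *: "\<not> ?thesis"
  have "emeasure lborel ?D = emeasure lborel (A \<inter> ?D) + emeasure lborel (?D - A)"
    by (subst plus_emeasure) (use A grid_cell_borel[of p] in \<open>auto intro!: arg_cong[where f="emeasure lborel"]\<close>)
  also have "\<dots> \<le> ennreal (1 / 2 * ?v) + emeasure lborel (?D - A)"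
    using assms(3) by (intro add_right_mono)
  also have "\<dots> < ennreal (1 / 2 * ?v) + ennreal (1 / 2 * ?v)"
    using * by (simp only: ennreal_add_left_cancel_less) auto
  also have "\<dots> = ennreal ?v" using p by (subst ennreal_plus[symmetric]) auto
  finally show False using emeasure_grid_cell[OF p, of x] by simp
qed

text \<open>
  The threshold is half the volume of a cell of side \<open>1 / p\<close>.  A unit cell containing less than this
  of \<open>A\<close> consists of small cells each of which is at least half empty, hence mixed around each of its points in \<open>A\<close>.
\<close>

lemma light_cells_le:
  fixes A :: "'a::euclidean_space set" and p :: nat
  assumes nrm: "is_norm nrm" and A: "A \<in> sets borel" "emeasure lborel A < \<infinity>" and p: "p > 0"
  shows "emeasure lborel {x \<in> A. emeasure lborel (A \<inter> grid_cell 1 (grid_round 1 x)) < ennreal (1 / 2 * (1 / real p) ^ DIM('a))}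
    \<le> ennreal (2 * cell_const nrm / real p) * perimeter nrm A" (is "emeasure lborel ?L \<le> _")
proof -
  let ?S = "{x \<in> A. ennreal (1 / 2 * (1 / real p) ^ DIM('a)) \<le>
            emeasure lborel (grid_cell (real p) (grid_round (real p) x) - A)}"
  have "?L \<subseteq> ?S"
  proof
    fix x assume x: "x \<in> ?L"
    have "grid_cell (real p) (grid_round (real p) x) \<subseteq> grid_cell 1 (grid_round 1 x)"
      unfolding grid_cell_def using grid_round_refine[OF p] by blast
    then have "emeasure lborel (A \<inter> grid_cell (real p) (grid_round (real p) x))
        \<le> emeasure lborel (A \<inter> grid_cell 1 (grid_round 1 x))"
      by (intro emeasure_mono Int_mono order_refl) (simp_all add: A grid_cell_borel sets.Int)
    also have "\<dots> \<le> ennreal (1 / 2 * (1 / real p) ^ DIM('a))" using x by auto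
    finally show "x \<in> ?S" using half_cell_outside[OF A(1), of "real p" x] p x by auto
  qed
  moreover have S: "?S \<in> sets borel"
    using sets.Int[OF A(1) grid_predicate_borel[of "real p" "\<lambda>z. ennreal (1 / 2 * (1 / real p) ^ DIM('a)) \<le>
            emeasure lborel (grid_cell (real p) z - A)"]] p by (simp add: Int_def)
  ultimately have "emeasure lborel ?L \<le> emeasure lborel ?S" by (intro emeasure_mono) auto
  also have "\<dots> = ennreal 2 * (ennreal (1 / 2) * emeasure lborel ?S)"
  proof -
    have "ennreal 2 * ennreal (1 / 2) = 1" by (subst ennreal_mult'[symmetric]) auto
    then show ?thesis by (simp only: mult.assoc[symmetric] mult_1)
  qed
  also have "\<dots> \<le> ennreal 2 * (ennreal (cell_const nrm / real p) * perimeter nrm A)"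
    using p by (intro mult_left_mono mixed_cells_inside_le[OF nrm A]) auto
  also have "\<dots> = ennreal (2 * cell_const nrm / real p) * perimeter nrm A"
    using cell_const_nonneg[OF nrm] by (simp add: mult.assoc[symmetric] ennreal_mult'[symmetric] del: ennreal_numeral)
  finally show ?thesis .
qed

text \<open>
  This is a weak form of the isoperimetric inequality.  In a grid whose cells have twice the volume of
  \<open>A\<close>, every cell is at least half empty, so that all of \<open>A\<close> lies in mixed cells.
\<close>

lemma small_perimeter_imp_small_measure:
  fixes A :: "'a::euclidean_space set"
  assumes nrm: "is_norm nrm" and A: "A \<in> sets borel" "emeasure lborel A < \<infinity>"
    and small: "ennreal (4 * cell_const nrm) * perimeter nrm A < 1"
  shows "emeasure lborel A \<le> ennreal (4 * cell_const nrm) * perimeter nrm A"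
proof -
  define c where "c = cell_const nrm"
  have c: "c \<ge> 0" unfolding c_def by (rule cell_const_nonneg[OF nrm])
  obtain K where K: "K \<ge> 0" "ennreal (4 * c) * perimeter nrm A = ennreal K"
    using small unfolding c_def by (cases "ennreal (4 * cell_const nrm) * perimeter nrm A") auto
  have "K < 1" using small K by (simp add: c_def[symmetric] ennreal_less_one_iff)
  define m where "m = measure lborel A"
  have m: "emeasure lborel A = ennreal m" "m \<ge> 0"
    using A(2) unfolding m_def by (auto simp: emeasure_eq_ennreal_measure)
  have "m \<le> K"
  proof (cases "m = 0")
    case False
    define \<delta> where "\<delta> = root DIM('a) (2 * m)"
    have \<delta>: "\<delta> > 0" "\<delta> ^ DIM('a) = 2 * m" using False m(2) by (simp_all add: \<delta>_def real_root_pow_pos2)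
    define p where "p = 1 / \<delta>"
    have p: "p > 0" "1 / p = \<delta>" using \<delta> by (auto simp: p_def)
    have "{x \<in> A. ennreal (1 / 2 * (1 / p) ^ DIM('a)) \<le> emeasure lborel (grid_cell p (grid_round p x) - A)} = A"
    proof -
      have "emeasure lborel (A \<inter> grid_cell p (grid_round p x)) \<le> ennreal (1 / 2 * (1 / p) ^ DIM('a))" for x
      proof -
        have "emeasure lborel (A \<inter> grid_cell p (grid_round p x)) \<le> emeasure lborel A"
          by (intro emeasure_mono) (use A in auto)
        then show ?thesis using \<delta>(2) p(2) m(1) by simp
      qed
      then show ?thesis using half_cell_outside[OF A(1) p(1)] by blast
    qed
    then have "ennreal (1 / 2) * ennreal m \<le> ennreal (c / p) * perimeter nrm A"
      using mixed_cells_inside_le[OF nrm A p(1), of "1/2"] m(1) by (simp add: c_def)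
    also have "ennreal (c / p) = ennreal (\<delta> / 4) * ennreal (4 * c)"
      using c \<delta> by (simp add: ennreal_mult'[symmetric] p_def mult_ac)
    also have "\<dots> * perimeter nrm A = ennreal (\<delta> / 4 * K)"
      unfolding mult.assoc K(2) using \<delta> by (simp add: ennreal_mult'[symmetric])
    finally have "ennreal (1 / 2 * m) \<le> ennreal (\<delta> / 4 * K)"
      by (subst ennreal_mult') auto
    then have le: "m / 2 \<le> \<delta> / 4 * K"
      using \<delta> K by (simp add: ennreal_le_iff)
    \<comment> \<open>The estimate \<open>le\<close> reads \<open>\<delta> ^ DIM('a) \<le> K * \<delta>\<close> with \<open>K < 1\<close>, which excludes \<open>\<delta> \<ge> 1\<close>.
       This works in dimension one as well.\<close>
    have "\<delta> < 1"
    proof (rule ccontr)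
      assume "\<not> \<delta> < 1"
      then have "\<delta> ^ 1 \<le> \<delta> ^ DIM('a)" by (intro power_increasing) auto
      moreover have "\<delta> * K < \<delta> * 1" using \<delta>(1) \<open>K < 1\<close> by (intro mult_strict_left_mono) auto
      ultimately show False using le \<delta> by simp
    qed
    then have "\<delta> * K \<le> 1 * K" using K by (intro mult_right_mono) auto
    then show ?thesis using le K by simp
  qed (use K in simp)
  then show ?thesis using m K by (simp add: c_def[symmetric] ennreal_leI)
qed

section \<open>Local compactness of sets of bounded perimeter\<close>

lemma tendsto_0_ennrealI:
  fixes f :: "'b \<Rightarrow> ennreal"
  assumes "\<And>e. e > 0 \<Longrightarrow> \<forall>\<^sub>F x in F. f x \<le> ennreal e"
  shows "(f \<longlongrightarrow> 0) F"
proof (rule order_tendstoI)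
  fix a :: ennreal assume "0 < a"
  then obtain e where e: "0 < e" "ennreal e < a"
    using ennreal_rat_dense[of 0 a] by (metis dense ennreal_cases ennreal_less_zero_iff not_less_iff_gr_or_eq top.not_eq_extremum order_less_trans)
  show "\<forall>\<^sub>F x in F. f x < a"
    using assms[OF e(1)] by eventually_elim (use e in auto)
qed auto

text \<open>
  Local convergence in measure is strong enough for the limits of indicator functions to be indicator
  functions of sets, and weak enough to ignore what escapes to infinity.
\<close>

definition loc_tendsto :: "(nat \<Rightarrow> 'a::euclidean_space set) \<Rightarrow> 'a set \<Rightarrow> bool" where
  "loc_tendsto A F \<longleftrightarrow> F \<in> sets borel \<and>
     (\<forall>R. (\<lambda>k. emeasure lborel (sym_diff (A k) F \<inter> ball 0 R)) \<longlonglongrightarrow> 0)"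

lemma sym_diff_ball_borel:
  "A \<in> sets borel \<Longrightarrow> F \<in> sets borel \<Longrightarrow> sym_diff A F \<inter> ball x R \<in> sets lborel"
  by (simp add: sets.Un sets.Int sets.Diff)

text \<open>
  Along a subsequence \<open>r\<close> consecutive sets differ inside \<open>ball 0 j\<close> by at most \<open>(1/2) ^ j\<close> in measure, so
  outside a set of small measure membership in \<open>A (r j)\<close> is eventually constant, and the upper limit of the
  subsequence is the desired set.
\<close>

lemma loc_Cauchy_limit:
  fixes A :: "nat \<Rightarrow> 'a::euclidean_space set"
  assumes A: "\<And>k. A k \<in> sets borel"
    and Cauchy: "\<And>R e. e > 0 \<Longrightarrow> \<exists>K. \<forall>k\<ge>K. \<forall>l\<ge>K. emeasure lborel ((A k - A l) \<inter> ball 0 R) \<le> ennreal e"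
  obtains F where "loc_tendsto A F"
proof -
  have sd: "\<exists>K. \<forall>k\<ge>K. \<forall>l\<ge>K. emeasure lborel (sym_diff (A k) (A l) \<inter> ball 0 (real j)) \<le> ennreal ((1/2) ^ j)" for j
  proof -
    obtain K where K: "\<forall>k\<ge>K. \<forall>l\<ge>K. emeasure lborel ((A k - A l) \<inter> ball 0 (real j)) \<le> ennreal ((1/2) ^ j / 2)"
      using Cauchy[of "(1/2) ^ j / 2" "real j"] by auto
    have "emeasure lborel (sym_diff (A k) (A l) \<inter> ball 0 (real j)) \<le> ennreal ((1/2) ^ j)" if "k \<ge> K" "l \<ge> K" for k l
    proof -
      have "emeasure lborel (sym_diff (A k) (A l) \<inter> ball 0 (real j)) \<le>
         emeasure lborel ((A k - A l) \<inter> ball 0 (real j)) + emeasure lborel ((A l - A k) \<inter> ball 0 (real j))"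
        unfolding Int_Un_distrib2 by (rule emeasure_subadditive) (use A in auto)
      also have "\<dots> \<le> ennreal ((1/2) ^ j / 2) + ennreal ((1/2) ^ j / 2)"
        using K that by (intro add_mono) auto
      also have "\<dots> = ennreal ((1/2) ^ j)" by (subst ennreal_plus[symmetric]) auto
      finally show ?thesis .
    qed
    then show ?thesis by blast
  qed
  then obtain K where K: "\<And>j k l. k \<ge> K j \<Longrightarrow> l \<ge> K j \<Longrightarrow>
      emeasure lborel (sym_diff (A k) (A l) \<inter> ball 0 (real j)) \<le> ennreal ((1/2) ^ j)" by metis
  define r where "r j = (\<Sum>i\<le>j. K i)" for j
  have rK: "r j \<ge> K j" "r (Suc j) \<ge> K j" for j
    unfolding r_def using member_le_sum[of j "{..j}" K] member_le_sum[of j "{..Suc j}" K] by auto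
  define F where "F = (\<Inter>J. \<Union>j\<in>{J..}. A (r j))"
  have F: "F \<in> sets borel" unfolding F_def using A by (intro sets.countable_INT'' sets.countable_UN'') auto
  define D where "D j = sym_diff (A (r j)) (A (r (Suc j))) \<inter> ball 0 (real j)" for j
  have D: "D j \<in> sets lborel" "emeasure lborel (D j) \<le> ennreal ((1/2) ^ j)" for j
    unfolding D_def using A K rK by auto
  have FJ: "emeasure lborel (sym_diff (A (r J)) F \<inter> ball 0 (real J)) \<le> ennreal (2 * (1/2) ^ J)" for J
  proof -
    have "sym_diff (A (r J)) F \<inter> ball 0 (real J) \<subseteq> (\<Union>i. D (J + i))"
    proof (rule ccontr)
      assume "\<not> ?thesis"
      then obtain x where x: "x \<in> sym_diff (A (r J)) F" "x \<in> ball 0 (real J)" "\<And>i. x \<notin> D (J + i)" by blast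
      have "x \<in> A (r (J + i)) \<longleftrightarrow> x \<in> A (r J)" for i
      proof (induction i)
        case (Suc i)
        have "x \<in> ball 0 (real (J + i))" using x(2) by auto
        then have "x \<in> A (r (J + i)) \<longleftrightarrow> x \<in> A (r (Suc (J + i)))" using x(3)[of i] unfolding D_def by blast
        then show ?case using Suc by simp
      qed simp
      then have *: "x \<in> A (r j) \<longleftrightarrow> x \<in> A (r J)" if "j \<ge> J" for j
        using le_Suc_ex[OF that] by auto
      have "x \<in> F \<longleftrightarrow> x \<in> A (r J)"
      proof
        assume "x \<in> F"
        then obtain j where "j \<ge> J" "x \<in> A (r j)" unfolding F_def by blast
        then show "x \<in> A (r J)" using *[of j] by blast
      next
        assume "x \<in> A (r J)"
        then have "x \<in> A (r (max J I))" "max J I \<in> {I..}" for I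
          using *[of "max J I"] by simp_all
        then show "x \<in> F" unfolding F_def by blast
      qed
      then show False using x(1) by blast
    qed
    then have "emeasure lborel (sym_diff (A (r J)) F \<inter> ball 0 (real J)) \<le> emeasure lborel (\<Union>i. D (J + i))"
      by (rule emeasure_mono) (intro sets.countable_UN'' D(1) countableI_type)
    also have "\<dots> \<le> (\<Sum>i. emeasure lborel (D (J + i)))"
      by (rule emeasure_subadditive_countably) (use D(1) in blast)
    also have "\<dots> \<le> (\<Sum>i. ennreal ((1/2) ^ J * (1/2) ^ i))"
    proof (rule suminf_le)
      show "emeasure lborel (D (J + i)) \<le> ennreal ((1/2) ^ J * (1/2) ^ i)" for i
        using D(2)[of "J + i"] by (simp only: power_add)
    qed simp_all
    also have "\<dots> = ennreal (\<Sum>i. (1/2) ^ J * (1/2) ^ i)"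
      by (rule suminf_ennreal2) (auto intro!: summable_mult summable_geometric)
    also have "(\<Sum>i. (1/2) ^ J * (1/2::real) ^ i) = 2 * (1/2) ^ J"
      by (subst suminf_mult) (auto simp: suminf_geometric summable_geometric)
    finally show ?thesis .
  qed
  have "(\<lambda>k. emeasure lborel (sym_diff (A k) F \<inter> ball 0 R)) \<longlonglongrightarrow> 0" for R
  proof (rule tendsto_0_ennrealI)
    fix e :: real assume "e > 0"
    have "(\<lambda>J. 3 * (1/2::real) ^ J) \<longlonglongrightarrow> 3 * 0" by (intro tendsto_intros LIMSEQ_realpow_zero) auto
    then have "\<forall>\<^sub>F J in sequentially. 3 * (1/2::real) ^ J < e"
      using \<open>e > 0\<close> by (intro order_tendstoD(2)) simp_all
    moreover have "\<forall>\<^sub>F J in sequentially. R \<le> real J"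
      using eventually_ge_at_top[of "nat \<lceil>R\<rceil>"] by eventually_elim linarith
    ultimately have "\<forall>\<^sub>F J in sequentially. 3 * (1/2::real) ^ J < e \<and> R \<le> real J" by (rule eventually_conj)
    then obtain J where J: "3 * (1/2) ^ J < e" "R \<le> real J"
      using eventually_happens'[OF sequentially_bot] by blast
    show "\<forall>\<^sub>F k in sequentially. emeasure lborel (sym_diff (A k) F \<inter> ball 0 R) \<le> ennreal e"
      using eventually_ge_at_top[of "K J"]
    proof eventually_elim
      case (elim k)
      have "sym_diff (A k) F \<inter> ball 0 R \<subseteq>
         (sym_diff (A k) (A (r J)) \<inter> ball 0 (real J)) \<union> (sym_diff (A (r J)) F \<inter> ball 0 (real J))"
        using J(2) by auto
      then have "emeasure lborel (sym_diff (A k) F \<inter> ball 0 R) \<le>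
         emeasure lborel ((sym_diff (A k) (A (r J)) \<inter> ball 0 (real J)) \<union> (sym_diff (A (r J)) F \<inter> ball 0 (real J)))"
        by (rule emeasure_mono) (intro sets.Un sym_diff_ball_borel A F)
      also have "\<dots> \<le> emeasure lborel (sym_diff (A k) (A (r J)) \<inter> ball 0 (real J))
           + emeasure lborel (sym_diff (A (r J)) F \<inter> ball 0 (real J))"
        by (rule emeasure_subadditive) (intro sym_diff_ball_borel A F)+
      also have "\<dots> \<le> ennreal ((1/2) ^ J) + ennreal (2 * (1/2) ^ J)"
        by (rule add_mono[OF K[OF elim rK(1)] FJ])
      also have "\<dots> = ennreal (3 * (1/2) ^ J)" by (subst ennreal_plus[symmetric]) auto
      also have "\<dots> \<le> ennreal e" using J by (intro ennreal_leI) auto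
      finally show ?case .
    qed
  qed
  then show ?thesis using F that[of F] by (simp add: loc_tendsto_def)
qed

text \<open>
  If the volumes of \<open>A k\<close> and \<open>A l\<close> in a cell differ by at most half the volume of the cell, then the
  cell is mixed as soon as it contains a point of \<open>A k\<close> outside \<open>A l\<close>: a quarter of the cell is missing from \<open>A k\<close> or a
  quarter belongs to \<open>A l\<close>.  Mixed cells have small measure on a fine grid, uniformly in \<open>k\<close>, and
  only finitely many cells meet a given ball.
\<close>

lemma perimeter_bounded_loc_compact:
  fixes A :: "nat \<Rightarrow> 'a::euclidean_space set"
  assumes nrm: "is_norm nrm" and A: "\<And>k. A k \<in> sets borel" "\<And>k. emeasure lborel (A k) < \<infinity>"
    and C: "\<And>k. perimeter nrm (A k) \<le> ennreal C"
    and conv: "\<And>p z. p > 0 \<Longrightarrow> convergent (\<lambda>k. emeasure lborel (A k \<inter> grid_cell (real p) z))"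
  obtains F where "loc_tendsto A F"
proof (rule loc_Cauchy_limit[OF A(1)])
  fix R e :: real assume e: "e > 0"
  let ?c = "cell_const nrm"
  have c: "?c \<ge> 0" by (rule cell_const_nonneg[OF nrm])
  \<comment> \<open>Fine enough for the cells mixed with respect to \<open>A k\<close> or \<open>A l\<close> to have measure at most \<open>e / 2\<close> each.\<close>
  obtain p :: nat where p0: "8 * ?c * max C 0 / e < real p" using reals_Archimedean2 by blast
  have "0 \<le> 8 * ?c * max C 0 / e" using c e by simp
  with p0 have rp: "real p > 0" by linarith
  have p: "p > 0" "8 * ?c * max C 0 / real p \<le> e"
    using p0 e rp by (simp_all add: divide_less_eq divide_le_eq mult.commute)
  let ?v = "(1 / real p) ^ DIM('a)"
  have v: "?v > 0" using p by simp
  have fin: "finite (grid_round (real p) ` ball (0::'a) R)"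
    by (rule finite_grid_round_image) (use p in auto)
  let ?a = "\<lambda>k z. emeasure lborel (A k \<inter> grid_cell (real p) z)"
  have "\<exists>K. \<forall>k\<ge>K. \<forall>l\<ge>K. ?a k z \<le> ?a l z + ennreal (?v / 2)" for z
  proof -
    obtain L where L: "(\<lambda>k. ?a k z) \<longlonglongrightarrow> L" using conv[OF p(1)] by (auto simp: convergent_def)
    show ?thesis
    proof (cases "z \<in> range (grid_round (real p))")
      case False
      then have "grid_cell (real p) z = {}" by (auto simp: grid_cell_def)
      then show ?thesis by simp
    next
      case True
      then obtain x :: 'a where x: "z = grid_round (real p) x" by blast
      have v': "?a k z \<le> ennreal ?v" for k
      proof -
        have "?a k z \<le> emeasure lborel (grid_cell (real p) z)"
          by (rule emeasure_mono) (simp_all add: grid_cell_borel)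
        also have "\<dots> = ennreal ?v" unfolding x by (rule emeasure_grid_cell) (use p in simp)
        finally show ?thesis .
      qed
      have "L \<le> ennreal ?v" by (rule LIMSEQ_le_const2[OF L]) (use v' in blast)
      then have "L \<noteq> top" by (auto simp: top_unique)
      then obtain L' where L': "L = ennreal L'" "L' \<ge> 0" by (cases L) auto
      have a: "?a k z = ennreal (measure lborel (A k \<inter> grid_cell (real p) z))" for k
        using v'[of k] by (intro emeasure_eq_ennreal_measure) (auto simp: top_unique)
      have "(\<lambda>k. measure lborel (A k \<inter> grid_cell (real p) z)) \<longlonglongrightarrow> L'"
        using L unfolding L' a by (subst (asm) tendsto_ennreal_iff) (auto simp: L')
      then have "Cauchy (\<lambda>k. measure lborel (A k \<inter> grid_cell (real p) z))" by (rule LIMSEQ_imp_Cauchy)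
      then obtain K where K: "\<And>k l. k \<ge> K \<Longrightarrow> l \<ge> K \<Longrightarrow>
          dist (measure lborel (A k \<inter> grid_cell (real p) z)) (measure lborel (A l \<inter> grid_cell (real p) z)) < ?v / 2"
        using v unfolding Cauchy_def by (meson half_gt_zero)
      have "?a k z \<le> ?a l z + ennreal (?v / 2)" if "k \<ge> K" "l \<ge> K" for k l
      proof -
        have "measure lborel (A k \<inter> grid_cell (real p) z) \<le> measure lborel (A l \<inter> grid_cell (real p) z) + ?v / 2"
          using K[OF that] unfolding dist_real_def by linarith
        from ennreal_leI[OF this] show ?thesis unfolding a using v by (subst (asm) ennreal_plus) auto
      qed
      then show ?thesis by blast
    qed
  qed
  then obtain K where K: "\<And>z k l. k \<ge> K z \<Longrightarrow> l \<ge> K z \<Longrightarrow> ?a k z \<le> ?a l z + ennreal (?v / 2)" by metis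
  define K' where "K' = Max (insert 0 (K ` grid_round (real p) ` ball (0::'a) R))"
  have K': "K (grid_round (real p) x) \<le> K'" if "x \<in> ball 0 R" for x :: 'a
    unfolding K'_def using fin that by (intro Max_ge) auto
  have "emeasure lborel ((A k - A l) \<inter> ball 0 R) \<le> ennreal e" if kl: "k \<ge> K'" "l \<ge> K'" for k l
  proof -
    let ?S = "{x \<in> A k. ennreal (1 / 4 * ?v) \<le> emeasure lborel (grid_cell (real p) (grid_round (real p) x) - A k)}"
    let ?T = "{x. x \<notin> A l \<and> ennreal (1 / 4 * ?v) \<le> emeasure lborel (A l \<inter> grid_cell (real p) (grid_round (real p) x))}"
    have p': "real p > 0" using p by simp
    have "?S = A k \<inter> {x. ennreal (1 / 4 * ?v) \<le> emeasure lborel (grid_cell (real p) (grid_round (real p) x) - A k)}"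
      by blast
    also have "\<dots> \<in> sets borel"
      by (rule sets.Int[OF A(1) grid_predicate_borel[OF p', of "\<lambda>z. ennreal (1 / 4 * ?v) \<le> emeasure lborel (grid_cell (real p) z - A k)"]])
    finally have S: "?S \<in> sets borel" .
    have "?T = {x. ennreal (1 / 4 * ?v) \<le> emeasure lborel (A l \<inter> grid_cell (real p) (grid_round (real p) x))} - A l"
      by blast
    also have "\<dots> \<in> sets borel"
      by (rule sets.Diff[OF grid_predicate_borel[OF p', of "\<lambda>z. ennreal (1 / 4 * ?v) \<le> emeasure lborel (A l \<inter> grid_cell (real p) z)"] A(1)])
    finally have T: "?T \<in> sets borel" .
    note ST = S T
    have meas: "emeasure lborel S \<le> ennreal (4 * ?c * max C 0 / real p)"
      if "ennreal (1 / 4) * emeasure lborel S \<le> ennreal (?c / real p) * perimeter nrm (A j)" for S :: "'a set" and j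
    proof -
      have "emeasure lborel S = ennreal 4 * (ennreal (1 / 4) * emeasure lborel S)"
      proof -
        have "ennreal 4 * ennreal (1 / 4) = 1" by (subst ennreal_mult'[symmetric]) auto
        then show ?thesis by (simp only: mult.assoc[symmetric] mult_1)
      qed
      also have "\<dots> \<le> ennreal 4 * (ennreal (?c / real p) * ennreal (max C 0))"
        by (intro mult_left_mono order_trans[OF that] order_trans[OF C] ennreal_leI) auto
      also have "\<dots> = ennreal (4 * ?c * max C 0 / real p)"
        using c by (simp add: ennreal_mult'[symmetric] mult_ac del: ennreal_numeral)
      finally show ?thesis .
    qed
    have "(A k - A l) \<inter> ball 0 R \<subseteq> ?S \<union> ?T"
    proof (rule ccontr)
      assume "\<not> ?thesis"
      then obtain x where x: "x \<in> A k" "x \<notin> A l" "x \<in> ball 0 R" "x \<notin> ?S" "x \<notin> ?T" by blast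
      let ?z = "grid_round (real p) x"
      let ?D = "grid_cell (real p) ?z"
      have 1: "emeasure lborel (?D - A k) < ennreal (1 / 4 * ?v)" "?a l ?z < ennreal (1 / 4 * ?v)"
        using x by auto
      have "emeasure lborel ?D = ?a k ?z + emeasure lborel (?D - A k)"
        by (subst plus_emeasure) (use A(1) grid_cell_borel[of p] in \<open>auto intro!: arg_cong[where f="emeasure lborel"]\<close>)
      also have "\<dots> \<le> (?a l ?z + ennreal (?v / 2)) + emeasure lborel (?D - A k)"
        using K'[OF x(3)] kl by (intro add_right_mono K) auto
      also have "\<dots> \<le> (ennreal (1 / 4 * ?v) + ennreal (?v / 2)) + emeasure lborel (?D - A k)"
        using 1 by (intro add_right_mono) auto
      also have "\<dots> < (ennreal (1 / 4 * ?v) + ennreal (?v / 2)) + ennreal (1 / 4 * ?v)"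
        using 1(1) v by (simp only: ennreal_add_left_cancel_less) auto
      also have "\<dots> = ennreal ?v"
      proof -
        have "ennreal (1 / 4 * ?v) + ennreal (?v / 2) + ennreal (1 / 4 * ?v) = ennreal (1 / 4 * ?v + ?v / 2 + 1 / 4 * ?v)"
          using v by (subst ennreal_plus, simp, simp)+ simp
        then show ?thesis by simp
      qed
      finally show False using emeasure_grid_cell[of "real p" x] p by simp
    qed
    from emeasure_mono[OF this, of lborel]
    have "emeasure lborel ((A k - A l) \<inter> ball 0 R) \<le> emeasure lborel (?S \<union> ?T)"
      unfolding sets_lborel using sets.Un[OF ST] by blast
    also have "\<dots> \<le> emeasure lborel ?S + emeasure lborel ?T"
      by (rule emeasure_subadditive) (simp_all only: sets_lborel ST)
    also have "\<dots> \<le> ennreal (4 * ?c * max C 0 / real p) + ennreal (4 * ?c * max C 0 / real p)"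
    proof (rule add_mono)
      show "emeasure lborel ?S \<le> ennreal (4 * ?c * max C 0 / real p)"
        by (rule meas[OF mixed_cells_inside_le[OF nrm A p']]) simp
      show "emeasure lborel ?T \<le> ennreal (4 * ?c * max C 0 / real p)"
        by (rule meas[OF mixed_cells_outside_le[OF nrm A p']]) simp
    qed
    also have "\<dots> = ennreal (8 * ?c * max C 0 / real p)"
      using c by (subst ennreal_plus[symmetric]) (auto simp: field_simps)
    also have "\<dots> \<le> ennreal e" using p by (intro ennreal_leI)
    finally show ?thesis .
  qed
  then show "\<exists>K. \<forall>k\<ge>K. \<forall>l\<ge>K. emeasure lborel ((A k - A l) \<inter> ball 0 R) \<le> ennreal e" by blast
qed

lemma diagonal_convergent_subseq:
  fixes f :: "'i \<Rightarrow> nat \<Rightarrow> 'b::{linorder_topology, complete_linorder, second_countable_topology}"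
  assumes "countable I"
  obtains r :: "nat \<Rightarrow> nat" where "strict_mono r" "\<And>i. i \<in> I \<Longrightarrow> convergent (\<lambda>k. f i (r k))"
proof (cases "I = {}")
  case True
  show ?thesis by (rule that[of "\<lambda>n. n"]) (simp_all add: strict_mono_def True)
next
  case False
  interpret subseqs "\<lambda>n s. convergent (\<lambda>k. f (from_nat_into I n) (s k))"
  proof
    fix n and s :: "nat \<Rightarrow> nat"
    obtain l r where "strict_mono r" "((\<lambda>k. f (from_nat_into I n) (s k)) \<circ> r) \<longlonglongrightarrow> l"
      using compact_complete_linorder[of "\<lambda>k. f (from_nat_into I n) (s k)"] by blast
    then show "\<exists>r'. strict_mono r' \<and> convergent (\<lambda>k. f (from_nat_into I n) ((s \<circ> r') k))"
      by (auto simp: convergent_def o_def)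
  qed
  show ?thesis
  proof (rule that[OF subseq_diagseq])
    fix i assume "i \<in> I"
    then obtain n where n: "i = from_nat_into I n"
      using assms by (metis from_nat_into_surj)
    have "convergent (\<lambda>k. f (from_nat_into I n) ((diagseq \<circ> ((+) (Suc n))) k))"
    proof (rule diagseq_holds)
      fix r s :: "nat \<Rightarrow> nat" and n
      assume "strict_mono r" "convergent (\<lambda>k. f (from_nat_into I n) (s k))"
      then show "convergent (\<lambda>k. f (from_nat_into I n) ((s \<circ> r) k))"
        using convergent_subseq_convergent[of "\<lambda>k. f (from_nat_into I n) (s k)" r] by (simp add: o_def)
    qed
    then have "convergent (\<lambda>k. f i (diagseq (k + Suc n)))" by (simp add: n o_def add.commute)
    then show "convergent (\<lambda>k. f i (diagseq k))"
      using convergent_ignore_initial_segment[of "\<lambda>k. f i (diagseq k)" "Suc n"] by simp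
  qed
qed

section \<open>Sums of extended nonnegative reals\<close>

lemma ennreal_summable: "(f :: 'i \<Rightarrow> ennreal) summable_on I"
  by (rule nonneg_summable_on_complete) simp

lemma ennreal_infsum_SUP: "infsum (f :: 'i \<Rightarrow> ennreal) I = (SUP F\<in>{F. finite F \<and> F \<subseteq> I}. sum f F)"
  by (rule nonneg_infsum_complete) simp

lemma ennreal_sum_le_infsum: "finite F \<Longrightarrow> F \<subseteq> I \<Longrightarrow> sum f F \<le> infsum (f :: 'i \<Rightarrow> ennreal) I"
  unfolding ennreal_infsum_SUP by (rule SUP_upper) simp

lemma ennreal_infsum_le: "(\<And>F. finite F \<Longrightarrow> F \<subseteq> I \<Longrightarrow> sum f F \<le> b) \<Longrightarrow> infsum (f :: 'i \<Rightarrow> ennreal) I \<le> b"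
  unfolding ennreal_infsum_SUP by (rule SUP_least) simp

lemma ennreal_infsum_cmult: "infsum (\<lambda>i. c * f i) I = c * infsum (f :: 'i \<Rightarrow> ennreal) I"
  unfolding ennreal_infsum_SUP SUP_mult_left_ennreal by (simp add: sum_distrib_left)

lemma ennreal_infsum_sum:
  fixes f :: "'j \<Rightarrow> 'i \<Rightarrow> ennreal"
  assumes "finite J"
  shows "infsum (\<lambda>i. \<Sum>j\<in>J. f j i) I = (\<Sum>j\<in>J. infsum (f j) I)"
  using assms by (induction J rule: finite_induct) (simp_all add: infsum_add ennreal_summable)

lemma ennreal_infsum_mono:
  "(\<And>i. i \<in> I \<Longrightarrow> f i \<le> g i) \<Longrightarrow> infsum (f :: 'i \<Rightarrow> ennreal) I \<le> infsum g I"
  by (rule infsum_mono) (simp_all add: ennreal_summable)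

lemma ennreal_le_infsum: "i \<in> I \<Longrightarrow> f i \<le> infsum (f :: 'i \<Rightarrow> ennreal) I"
  using ennreal_sum_le_infsum[of "{i}" I f] by simp

text \<open>
  The suprema are approached independently of each other, one index at a time; the summand \<open>c\<close> collects
  the terms already chosen in the induction.
\<close>

lemma ennreal_sum_SUP_le:
  fixes f :: "'s \<Rightarrow> 'v \<Rightarrow> ennreal"
  assumes "finite S" "T \<noteq> {}" "\<And>v. (\<And>s. s \<in> S \<Longrightarrow> v s \<in> T) \<Longrightarrow> c + (\<Sum>s\<in>S. f s (v s)) \<le> p"
  shows "c + (\<Sum>s\<in>S. SUP v\<in>T. f s v) \<le> p"
  using assms(1,3)
proof (induction S arbitrary: c rule: finite_induct)
  case (insert a S)
  have "c + f a u + (\<Sum>s\<in>S. SUP v\<in>T. f s v) \<le> p" if u: "u \<in> T" for u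
  proof (rule insert.IH)
    fix v assume v: "\<And>s. s \<in> S \<Longrightarrow> v s \<in> T"
    have "(\<Sum>s\<in>S. f s ((v(a := u)) s)) = (\<Sum>s\<in>S. f s (v s))"
      using insert.hyps by (intro sum.cong) auto
    moreover have "c + (\<Sum>s\<in>insert a S. f s ((v(a := u)) s)) \<le> p"
      by (rule insert.prems) (use u v in auto)
    ultimately show "c + f a u + (\<Sum>s\<in>S. f s (v s)) \<le> p"
      using insert.hyps by (simp add: add.assoc)
  qed
  then have "(SUP u\<in>T. f a u + (c + (\<Sum>s\<in>S. SUP v\<in>T. f s v))) \<le> p"
    by (intro SUP_least) (simp add: ac_simps)
  then show ?case
    using insert.hyps unfolding ennreal_SUP_add_left[OF assms(2)] by (simp add: ac_simps)
qed simp

section \<open>Translated sets and test fields\<close>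

definition shift :: "'a::real_vector \<Rightarrow> 'a set \<Rightarrow> 'a set" where
  "shift z A = {x. x + z \<in> A}"

lemma shift_borel: "A \<in> sets borel \<Longrightarrow> shift (z :: 'a::euclidean_space) A \<in> sets borel"
  unfolding shift_def by (rule translate_borel)

lemma emeasure_shift: "A \<in> sets borel \<Longrightarrow> emeasure lborel (shift (z :: 'a::euclidean_space) A) = emeasure lborel A"
  unfolding shift_def by (rule emeasure_lborel_translate)

lemma zero_test_field: "is_norm nrm \<Longrightarrow> (\<lambda>_. 0) \<in> test_fields nrm"
proof -
  assume "is_norm nrm"
  then have "nrm 0 = 0" unfolding is_norm_def by blast
  then show ?thesis unfolding test_fields_def sup_norm_def by (simp add: smooth_const)
qed

lemma test_field_nrm_le:
  assumes "v \<in> test_fields nrm" shows "nrm (v x) \<le> 1"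
proof -
  have "ereal (nrm (v x)) \<le> sup_norm nrm v" unfolding sup_norm_def by (rule SUP_upper) simp
  also have "\<dots> \<le> 1" using assms by (simp add: test_fields_def)
  finally show ?thesis by simp
qed

lemma test_field_support:
  fixes v :: "'a::euclidean_space \<Rightarrow> 'a"
  assumes "v \<in> test_fields nrm"
  obtains R where "R > 0" "\<And>x. norm x \<ge> R \<Longrightarrow> v x = 0" "\<And>x. norm x \<ge> R \<Longrightarrow> divergence v x = 0"
proof -
  have "bounded (closure {x. v x \<noteq> 0})" using assms by (simp add: test_fields_def compact_imp_bounded)
  then have "bounded {x. v x \<noteq> 0}" using bounded_subset closure_subset by blast
  from smooth_derivative_support[OF this] obtain R where R: "R > 0" "\<And>x. norm x > R \<Longrightarrow> v x = 0"
    "\<And>x h. norm x > R \<Longrightarrow> frechet_derivative v (at x) h = 0" by blast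
  show ?thesis
  proof (rule that[of "R + 1"])
    show "R + 1 > 0" using R by simp
    show "v x = 0" "divergence v x = 0" if "norm x \<ge> R + 1" for x
    proof -
      have "norm x > R" using that by simp
      then show "v x = 0" "divergence v x = 0" using R(2,3) by (simp_all add: divergence_def)
    qed
  qed
qed

lemma divergence_continuous: "smooth v \<Longrightarrow> continuous_on UNIV (divergence v)"
  unfolding divergence_def[abs_def]
  by (intro continuous_on_sum continuous_on_inner continuous_on_const smooth_continuous smooth_derivative)

lemma divergence_bounded:
  fixes v :: "'a::euclidean_space \<Rightarrow> 'a"
  assumes "smooth v" "\<And>x. norm x \<ge> R \<Longrightarrow> divergence v x = 0"
  obtains C where "C \<ge> 0" "\<And>x. \<bar>divergence v x\<bar> \<le> C"
proof -
  have "compact (divergence v ` cball 0 R)"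
    by (intro compact_continuous_image continuous_on_subset[OF divergence_continuous[OF assms(1)]]) auto
  from compact_imp_bounded[OF this] obtain C where C: "\<And>y. y \<in> cball 0 R \<Longrightarrow> norm (divergence v y) \<le> C"
    unfolding bounded_iff by blast
  show ?thesis
  proof (rule that[of "max C 0"])
    show "\<bar>divergence v x\<bar> \<le> max C 0" for x
      using C[of x] assms(2)[of x] by (cases "norm x \<ge> R") auto
  qed simp
qed

lemma integrable_divergence:
  fixes v :: "'a::euclidean_space \<Rightarrow> 'a"
  assumes "smooth v" "\<And>x. norm x \<ge> R \<Longrightarrow> divergence v x = 0" "A \<in> sets borel"
  shows "integrable lborel (\<lambda>x. indicator A x * divergence v x)"
proof -
  obtain C where C: "C \<ge> 0" "\<And>x. \<bar>divergence v x\<bar> \<le> C" by (rule divergence_bounded[of v R, OF assms(1)]) (use assms(2) that in blast)+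
  have m: "divergence v \<in> borel_measurable borel"
    by (intro borel_measurable_continuous_onI divergence_continuous assms)
  show ?thesis
  proof (rule integrableI_bounded_set[where A="cball 0 R" and B=C])
    show "(\<lambda>x. indicator A x * divergence v x) \<in> borel_measurable lborel"
      using m assms(3) by simp
    show "emeasure lborel (cball (0::'a) R) < \<infinity>" by (intro emeasure_bounded_finite) simp
    show "AE x in lborel. x \<in> cball 0 R \<longrightarrow> norm (indicator A x * divergence v x) \<le> C"
      using C by (auto simp: indicator_def)
    show "AE x in lborel. x \<notin> cball 0 R \<longrightarrow> indicator A x * divergence v x = 0"
    proof (intro AE_I2 impI)
      fix x :: 'a assume "x \<notin> cball 0 R"
      then have "norm x \<ge> R" by simp
      then show "indicator A x * divergence v x = 0" by (simp add: assms(2))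
    qed
  qed simp
qed

lemma loc_tendsto_divergence:
  fixes v :: "'a::euclidean_space \<Rightarrow> 'a"
  assumes v: "v \<in> test_fields nrm" and A: "\<And>k. A k \<in> sets borel" and F: "loc_tendsto A F"
  shows "(\<lambda>k. \<integral>x. indicator (A k) x * divergence v x \<partial>lborel) \<longlonglongrightarrow> (\<integral>x. indicator F x * divergence v x \<partial>lborel)"
proof -
  obtain R where R0: "R > 0" "\<And>x. norm x \<ge> R \<Longrightarrow> v x = 0" and R2: "\<And>x. norm x \<ge> R \<Longrightarrow> divergence v x = 0"
    by (rule test_field_support[OF v]) (rule that)
  note R = R0(1) R2
  have sm: "smooth v" using v by (simp add: test_fields_def)
  obtain C where C: "C \<ge> 0" "\<And>x. \<bar>divergence v x\<bar> \<le> C" by (rule divergence_bounded[of v R, OF sm]) (use R(2) that in blast)+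
  have Fb: "F \<in> sets borel" using F by (simp add: loc_tendsto_def)
  let ?D = "\<lambda>k. sym_diff (A k) F \<inter> ball 0 R"
  have fin: "emeasure lborel (?D k) < \<infinity>" for k by (intro emeasure_bounded_finite bounded_Int) simp
  have "(\<lambda>k. emeasure lborel (?D k)) \<longlonglongrightarrow> 0" using F by (simp add: loc_tendsto_def)
  moreover have "emeasure lborel (?D k) = ennreal (measure lborel (?D k))" for k
    using fin[of k] by (intro emeasure_eq_ennreal_measure) auto
  ultimately have "(\<lambda>k. ennreal (measure lborel (?D k))) \<longlonglongrightarrow> 0" by simp
  then have "(\<lambda>k. measure lborel (?D k)) \<longlonglongrightarrow> 0" by (subst (asm) ennreal_tendsto_0_iff) auto
  then have lim: "(\<lambda>k. C * measure lborel (?D k)) \<longlonglongrightarrow> 0" by (rule tendsto_mult_right_zero)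
  have "norm ((\<integral>x. indicator (A k) x * divergence v x \<partial>lborel) - (\<integral>x. indicator F x * divergence v x \<partial>lborel))
      \<le> C * measure lborel (?D k)" for k
  proof -
    have Db: "?D k \<in> sets lborel" by (intro sym_diff_ball_borel A Fb)
    have iD: "integrable lborel (indicat_real (?D k))"
      by (rule integrable_real_indicator[OF Db fin])
    have i: "integrable lborel (\<lambda>x. indicator (A k) x * divergence v x)" "integrable lborel (\<lambda>x. indicator F x * divergence v x)"
      by (rule integrable_divergence[OF sm R(2)]; use A Fb in blast)+
    have "norm ((\<integral>x. indicator (A k) x * divergence v x \<partial>lborel) - (\<integral>x. indicator F x * divergence v x \<partial>lborel))
       = norm (\<integral>x. indicator (A k) x * divergence v x - indicator F x * divergence v x \<partial>lborel)"
      using i by simp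
    also have "\<dots> \<le> (\<integral>x. norm (indicator (A k) x * divergence v x - indicator F x * divergence v x) \<partial>lborel)"
      by (rule integral_norm_bound)
    also have "\<dots> \<le> (\<integral>x. C * indicator (?D k) x \<partial>lborel)"
    proof (rule integral_mono)
      show "norm (indicator (A k) x * divergence v x - indicator F x * divergence v x) \<le> C * indicator (?D k) x" for x
        using C R(2)[of x] by (cases "norm x \<ge> R") (auto simp: indicator_def)
    qed (use i iD in auto)
    also have "\<dots> = C * measure lborel (?D k)" using Db by simp
    finally show ?thesis .
  qed
  then have "(\<lambda>k. (\<integral>x. indicator (A k) x * divergence v x \<partial>lborel) - (\<integral>x. indicator F x * divergence v x \<partial>lborel)) \<longlonglongrightarrow> 0"
    by (intro Lim_null_comparison[OF _ lim]) simp
  then show ?thesis by (rule LIM_zero_cancel)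
qed

lemma divergence_translate:
  fixes v :: "'a::euclidean_space \<Rightarrow> 'a"
  assumes "smooth v" shows "divergence (\<lambda>x. v (x - z)) x = divergence v (x - z)"
proof -
  have "((\<lambda>x. v (x - z)) has_derivative frechet_derivative v (at (x - z))) (at x)"
    by (rule has_derivative_compose[OF _ smooth_has_derivative[OF assms]]) (auto intro!: derivative_eq_intros)
  then have "frechet_derivative (\<lambda>x. v (x - z)) (at x) = frechet_derivative v (at (x - z))"
    by (metis frechet_derivative_at)
  then show ?thesis by (simp add: divergence_def)
qed

lemma divergence_sum:
  fixes v :: "'s \<Rightarrow> 'a::euclidean_space \<Rightarrow> 'a"
  assumes "\<And>s. s \<in> S \<Longrightarrow> smooth (v s)"
  shows "divergence (\<lambda>x. \<Sum>s\<in>S. v s x) x = (\<Sum>s\<in>S. divergence (v s) x)"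
proof -
  have "((\<lambda>x. \<Sum>s\<in>S. v s x) has_derivative (\<lambda>h. \<Sum>s\<in>S. frechet_derivative (v s) (at x) h)) (at x)"
    by (intro has_derivative_sum smooth_has_derivative assms)
  then have "frechet_derivative (\<lambda>x. \<Sum>s\<in>S. v s x) (at x) = (\<lambda>h. \<Sum>s\<in>S. frechet_derivative (v s) (at x) h)"
    by (metis frechet_derivative_at)
  then show ?thesis by (simp add: divergence_def inner_sum_left sum.swap[of _ S])
qed

lemma integral_shift_divergence:
  fixes v :: "'a::euclidean_space \<Rightarrow> 'a"
  assumes "smooth v" "A \<in> sets borel"
  shows "(\<integral>x. indicator (shift z A) x * divergence v x \<partial>lborel) = (\<integral>x. indicator A x * divergence v (x - z) \<partial>lborel)"
proof -
  have m: "(\<lambda>x. divergence v (x - z)) \<in> borel_measurable borel"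
    by (intro borel_measurable_continuous_onI continuous_on_compose2[OF divergence_continuous[OF assms(1)]] continuous_intros) auto
  have "(\<integral>x. indicator A (x + z) * divergence v (x + z - z) \<partial>lborel) = (\<integral>x. indicator A x * divergence v (x - z) \<partial>lborel)"
    by (rule lborel_integral_translate) (use m assms(2) in simp)
  then show ?thesis by (simp add: shift_def indicator_def)
qed

lemma ennreal_sum_subadditive: "ennreal (\<Sum>i\<in>I. f i) \<le> (\<Sum>i\<in>I. ennreal (f i))"
proof (induction I rule: infinite_finite_induct)
  case (insert i I)
  have "ennreal (f i + sum f I) \<le> ennreal (max (f i) 0 + max (sum f I) 0)" by (intro ennreal_leI) simp
  also have "\<dots> = ennreal (f i) + ennreal (sum f I)"
    by (subst ennreal_plus) (auto simp: max_def ennreal_neg)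
  also have "\<dots> \<le> ennreal (f i) + (\<Sum>i\<in>I. ennreal (f i))" using insert.IH by (rule add_left_mono)
  finally show ?case using insert.hyps by simp
qed simp_all

text \<open>
  Test fields supported in balls of radius \<open>R\<close> whose centres have distance at least \<open>2 * R\<close> do not overlap, so their sum
  is again a test field.
\<close>

lemma separated_fields_le_perimeter:
  fixes A :: "'a::euclidean_space set"
  assumes nrm: "is_norm nrm" and S: "finite S" and A: "A \<in> sets borel"
    and v: "\<And>s. s \<in> S \<Longrightarrow> v s \<in> test_fields nrm"
    and R: "\<And>s x. s \<in> S \<Longrightarrow> norm x \<ge> R \<Longrightarrow> v s x = 0 \<and> divergence (v s) x = 0"
    and sep: "\<And>s t. s \<in> S \<Longrightarrow> t \<in> S \<Longrightarrow> s \<noteq> t \<Longrightarrow> norm (z s - z t) \<ge> 2 * R"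
  shows "ennreal (\<Sum>s\<in>S. \<integral>x. indicator (shift (z s) A) x * divergence (v s) x \<partial>lborel) \<le> perimeter nrm A"
proof -
  let ?w = "\<lambda>x. \<Sum>s\<in>S. v s (x - z s)"
  have sm: "smooth (v s)" if "s \<in> S" for s using v[OF that] by (simp add: test_fields_def)
  have w: "smooth ?w" by (intro smooth_sum smooth_translate sm)
  have "nrm (?w x) \<le> 1" for x
  proof (cases "\<exists>s\<in>S. norm (x - z s) < R")
    case True
    then obtain s where s: "s \<in> S" "norm (x - z s) < R" by blast
    have "v t (x - z t) = 0" if t: "t \<in> S - {s}" for t
    proof -
      have "2 * R \<le> norm (z s - z t)" using sep[of s t] s t by auto
      also have "\<dots> \<le> norm (x - z t) + norm (x - z s)"
        using norm_triangle_ineq4[of "x - z t" "x - z s"] by (simp add: algebra_simps)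
      finally have "norm (x - z t) \<ge> R" using s by simp
      then show ?thesis using R t by blast
    qed
    then have "?w x = v s (x - z s)" using S s by (subst sum.remove[of _ s]) (auto intro!: sum.neutral)
    then show ?thesis using test_field_nrm_le[OF v[OF s(1)]] by simp
  next
    case False
    then have "?w x = 0" using R by (intro sum.neutral) (auto simp: not_less)
    moreover have "nrm 0 = 0" using nrm unfolding is_norm_def by blast
    ultimately show ?thesis by simp
  qed
  then have "sup_norm nrm ?w \<le> 1" unfolding sup_norm_def by (intro SUP_least) simp
  moreover have "compact (closure {x. ?w x \<noteq> 0})"
  proof -
    have "{x. ?w x \<noteq> 0} \<subseteq> (\<Union>s\<in>S. ball (z s) R)"
    proof
      fix x assume "x \<in> {x. ?w x \<noteq> 0}"
      then obtain s where "s \<in> S" "v s (x - z s) \<noteq> 0" by (auto elim: sum.not_neutral_contains_not_neutral)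
      then show "x \<in> (\<Union>s\<in>S. ball (z s) R)"
        using R[of s "x - z s"] by (auto simp: dist_norm norm_minus_commute not_le[symmetric])
    qed
    moreover have "bounded (\<Union>s\<in>S. ball (z s) R)" using S by (intro bounded_UN) auto
    ultimately have "bounded {x. ?w x \<noteq> 0}" by (rule bounded_subset[rotated])
    then show ?thesis unfolding compact_closure .
  qed
  ultimately have "?w \<in> test_fields nrm" using w by (simp add: test_fields_def)
  then have "ennreal (\<integral>x. indicator A x * divergence ?w x \<partial>lborel) \<le> perimeter nrm A"
    unfolding perimeter_def by (rule SUP_upper)
  also have "(\<integral>x. indicator A x * divergence ?w x \<partial>lborel) =
     (\<integral>x. (\<Sum>s\<in>S. indicator A x * divergence (v s) (x - z s)) \<partial>lborel)"
    by (simp add: divergence_sum smooth_translate sm divergence_translate sum_distrib_left)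
  also have "\<dots> = (\<Sum>s\<in>S. \<integral>x. indicator A x * divergence (v s) (x - z s) \<partial>lborel)"
  proof (rule Bochner_Integration.integral_sum)
    fix s assume s: "s \<in> S"
    have "integrable lborel (\<lambda>x. indicator A x * divergence (\<lambda>x. v s (x - z s)) x)"
    proof (rule integrable_divergence[where R="R + norm (z s)"])
      show "smooth (\<lambda>x. v s (x - z s))" by (intro smooth_translate sm s)
      show "divergence (\<lambda>x. v s (x - z s)) x = 0" if "norm x \<ge> R + norm (z s)" for x
        unfolding divergence_translate[OF sm[OF s]]
        using R[OF s, of "x - z s"] norm_triangle_ineq2[of x "z s"] that by simp
    qed (rule A)
    then show "integrable lborel (\<lambda>x. indicator A x * divergence (v s) (x - z s))"
      by (simp add: divergence_translate sm s)
  qed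
  also have "\<dots> = (\<Sum>s\<in>S. \<integral>x. indicator (shift (z s) A) x * divergence (v s) x \<partial>lborel)"
    by (intro sum.cong refl integral_shift_divergence[symmetric] sm A)
  finally show ?thesis .
qed

lemma perimeter_shift_le:
  fixes A :: "'a::euclidean_space set"
  assumes nrm: "is_norm nrm" and A: "A \<in> sets borel"
  shows "perimeter nrm (shift z A) \<le> perimeter nrm A"
  unfolding perimeter_def[of nrm "shift z A"]
proof (rule SUP_least)
  fix v :: "'a \<Rightarrow> 'a" assume v: "v \<in> test_fields nrm"
  obtain R where R: "R > 0" "\<And>x. norm x \<ge> R \<Longrightarrow> v x = 0" "\<And>x. norm x \<ge> R \<Longrightarrow> divergence v x = 0"
    by (rule test_field_support[OF v]) (rule that)
  show "ennreal (\<integral>x. indicator (shift z A) x * divergence v x \<partial>lborel) \<le> perimeter nrm A"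
    using separated_fields_le_perimeter[OF nrm _ A, of "{()}" "\<lambda>_. v" R "\<lambda>_. z"] v R by simp
qed

section \<open>Limits seen through windows that move apart\<close>

text \<open>
  The sequences \<open>L s\<close> and \<open>Z s\<close> give the layer and the position of the window \<open>s\<close> through which the clusters are
  observed.  Different layers count as infinitely distant.
\<close>

definition separated :: "'s set \<Rightarrow> ('s \<Rightarrow> nat \<Rightarrow> int) \<Rightarrow> ('s \<Rightarrow> nat \<Rightarrow> 'a::real_normed_vector) \<Rightarrow> bool" where
  "separated S L Z \<longleftrightarrow> (\<forall>R. \<forall>s\<in>S. \<forall>t\<in>S. s \<noteq> t \<longrightarrow>
     (\<forall>\<^sub>F k in sequentially. L s k \<noteq> L t k \<or> norm (Z s k - Z t k) \<ge> R))"

lemma separated_subset: "separated S L Z \<Longrightarrow> T \<subseteq> S \<Longrightarrow> separated T L Z"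
  unfolding separated_def by blast

lemma separated_eventually:
  assumes "finite S" "separated S L Z"
  shows "\<forall>\<^sub>F k in sequentially. \<forall>s\<in>S. \<forall>t\<in>S. s \<noteq> t \<longrightarrow> L s k \<noteq> L t k \<or> norm (Z s k - Z t k) \<ge> R"
  by (intro eventually_ball_finite assms(1) ballI)
    (use assms(2) in \<open>auto simp: separated_def\<close>)

text \<open>
  The estimates below hold inside one layer, for all windows in it at once; this sums them
  over the layers.
\<close>

lemma sum_by_layers_le:
  fixes g :: "'s \<Rightarrow> real" and h :: "int \<Rightarrow> ennreal"
  assumes "finite S" "\<And>i. i \<in> L ` S \<Longrightarrow> ennreal (\<Sum>s\<in>{s\<in>S. L s = i}. g s) \<le> h i"
  shows "ennreal (\<Sum>s\<in>S. g s) \<le> infsum h UNIV"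
proof -
  have "ennreal (\<Sum>s\<in>S. g s) = ennreal (\<Sum>i\<in>L ` S. \<Sum>s\<in>{s\<in>S. L s = i}. g s)"
    using sum.image_gen[OF assms(1), of g L] by simp
  also have "\<dots> \<le> (\<Sum>i\<in>L ` S. ennreal (\<Sum>s\<in>{s\<in>S. L s = i}. g s))"
    by (rule ennreal_sum_subadditive)
  also have "\<dots> \<le> (\<Sum>i\<in>L ` S. h i)" by (rule sum_mono) (rule assms(2))
  also have "\<dots> \<le> infsum h UNIV" by (rule ennreal_sum_le_infsum) (use assms(1) in simp_all)
  finally show ?thesis .
qed

text \<open>
  Choose a test field for every limit set.  Translated to their windows, these fields have disjoint supports
  within each layer from some stage on, so their integrals together are bounded by the total perimeter at that
  stage; the integrals converge because the fields have compact support.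
\<close>

lemma separated_perimeter_lsc:
  fixes A :: "nat \<Rightarrow> int \<Rightarrow> 'a::euclidean_space set"
  assumes nrm: "is_norm nrm" and S: "finite S" and A: "\<And>k i. A k i \<in> sets borel"
    and sep: "separated S L Z"
    and F: "\<And>s. s \<in> S \<Longrightarrow> loc_tendsto (\<lambda>k. shift (Z s k) (A k (L s k))) (F s)"
    and lim: "(\<lambda>k. infsum (\<lambda>i. perimeter nrm (A k i)) UNIV) \<longlonglongrightarrow> p"
  shows "(\<Sum>s\<in>S. perimeter nrm (F s)) \<le> p"
proof -
  have "0 + (\<Sum>s\<in>S. ennreal (\<integral>x. indicator (F s) x * divergence (v s) x \<partial>lborel)) \<le> p"
    if v: "\<And>s. s \<in> S \<Longrightarrow> v s \<in> test_fields nrm" for v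
  proof -
    let ?I = "\<lambda>s u. \<integral>x. indicator (F s) x * divergence u x \<partial>lborel"
    \<comment> \<open>Fields with a negative integral would spoil the comparison with the sum of the truncated
       values, so they are replaced by the zero field.\<close>
    define u where "u s = (if ?I s (v s) \<ge> 0 then v s else (\<lambda>_. 0))" for s
    have u: "u s \<in> test_fields nrm" if "s \<in> S" for s
      using v[OF that] zero_test_field[OF nrm] by (simp add: u_def)
    have "divergence (\<lambda>_::'a. 0) x = 0" for x :: 'a
      by (simp add: divergence_def)
    then have Iu: "?I s (u s) \<ge> 0" "ennreal (?I s (u s)) = ennreal (?I s (v s))" for s
      by (auto simp: u_def ennreal_neg)
    have "\<exists>R. R > 0 \<and> (\<forall>x. norm x \<ge> R \<longrightarrow> u s x = 0 \<and> divergence (u s) x = 0)" if "s \<in> S" for s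
      by (rule test_field_support[OF u[OF that]]) blast
    then obtain R where R: "\<And>s. s \<in> S \<Longrightarrow> R s > 0"
      "\<And>s x. s \<in> S \<Longrightarrow> norm x \<ge> R s \<Longrightarrow> u s x = 0 \<and> divergence (u s) x = 0" by metis
    have R': "u s x = 0 \<and> divergence (u s) x = 0" if "s \<in> S" "norm x \<ge> sum R S" for s x
    proof (rule R(2)[OF that(1)])
      have "R s \<le> sum R S" using R(1) S that(1) by (intro member_le_sum) (auto intro: less_imp_le)
      then show "R s \<le> norm x" using that(2) by simp
    qed
    define J where "J k s = (\<integral>x. indicator (shift (Z s k) (A k (L s k))) x * divergence (u s) x \<partial>lborel)" for k s
    have "\<forall>\<^sub>F k in sequentially. ennreal (\<Sum>s\<in>S. J k s) \<le> infsum (\<lambda>i. perimeter nrm (A k i)) UNIV"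
      using separated_eventually[OF S sep, of "2 * sum R S"]
    proof eventually_elim
      case (elim k)
      show ?case
      proof (rule sum_by_layers_le[OF S, where L="\<lambda>s. L s k"])
        fix i
        let ?S = "{s \<in> S. L s k = i}"
        have "ennreal (\<Sum>s\<in>?S. \<integral>x. indicator (shift (Z s k) (A k i)) x * divergence (u s) x \<partial>lborel) \<le> perimeter nrm (A k i)"
        proof (rule separated_fields_le_perimeter[OF nrm _ A, where R="sum R S"])
          show "norm (Z s k - Z t k) \<ge> 2 * sum R S" if "s \<in> ?S" "t \<in> ?S" "s \<noteq> t" for s t
            using elim that by auto
        qed (use S u R' in auto)
        moreover have "(\<Sum>s\<in>?S. J k s) = (\<Sum>s\<in>?S. \<integral>x. indicator (shift (Z s k) (A k i)) x * divergence (u s) x \<partial>lborel)"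
          unfolding J_def by (rule sum.cong) auto
        ultimately show "ennreal (\<Sum>s\<in>?S. J k s) \<le> perimeter nrm (A k i)" by simp
      qed
    qed
    moreover have "(\<lambda>k. ennreal (\<Sum>s\<in>S. J k s)) \<longlonglongrightarrow> ennreal (\<Sum>s\<in>S. ?I s (u s))"
      unfolding J_def
      by (intro tendsto_ennrealI tendsto_sum loc_tendsto_divergence[OF u _ F] shift_borel A)
    ultimately have "ennreal (\<Sum>s\<in>S. ?I s (u s)) \<le> p"
      using tendsto_le[OF sequentially_bot lim] by blast
    then show ?thesis using Iu by (simp add: sum_ennreal[symmetric])
  qed
  then have "0 + (\<Sum>s\<in>S. SUP v\<in>test_fields nrm. ennreal (\<integral>x. indicator (F s) x * divergence v x \<partial>lborel)) \<le> p"
    by (intro ennreal_sum_SUP_le[OF S]) (use zero_test_field[OF nrm] in auto)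
  then show ?thesis by (simp add: perimeter_def)
qed

lemma separated_balls_mass_le:
  fixes A :: "int \<Rightarrow> 'a::euclidean_space set"
  assumes S: "finite S" and A: "\<And>i. A i \<in> sets borel"
    and sep: "\<forall>s\<in>S. \<forall>t\<in>S. s \<noteq> t \<longrightarrow> L s \<noteq> L t \<or> norm (Z s - Z t) \<ge> 2 * R"
  shows "(\<Sum>s\<in>S. emeasure lborel (shift (Z s) (A (L s)) \<inter> ball 0 R)) \<le> infsum (\<lambda>i. emeasure lborel (A i)) UNIV"
proof -
  have "emeasure lborel (shift (Z s) (A (L s)) \<inter> ball 0 R) = emeasure lborel (A (L s) \<inter> ball (Z s) R)" for s
  proof -
    have "shift (Z s) (A (L s)) \<inter> ball 0 R = shift (Z s) (A (L s) \<inter> ball (Z s) R)"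
      by (auto simp: shift_def dist_norm)
    then show ?thesis using A by (simp add: emeasure_shift)
  qed
  then have "(\<Sum>s\<in>S. emeasure lborel (shift (Z s) (A (L s)) \<inter> ball 0 R)) =
     (\<Sum>i\<in>L ` S. \<Sum>s\<in>{s\<in>S. L s = i}. emeasure lborel (A (L s) \<inter> ball (Z s) R))"
    using sum.image_gen[OF S, of "\<lambda>s. emeasure lborel (A (L s) \<inter> ball (Z s) R)" L] by simp
  also have "\<dots> \<le> (\<Sum>i\<in>L ` S. emeasure lborel (A i))"
  proof (rule sum_mono)
    fix i
    let ?S = "{s\<in>S. L s = i}"
    have "(\<Sum>s\<in>?S. emeasure lborel (A (L s) \<inter> ball (Z s) R)) = (\<Sum>s\<in>?S. emeasure lborel (A i \<inter> ball (Z s) R))"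
      by (rule sum.cong) auto
    also have "\<dots> = emeasure lborel (\<Union>s\<in>?S. A i \<inter> ball (Z s) R)"
    proof (rule sum_emeasure)
      show "disjoint_family_on (\<lambda>s. A i \<inter> ball (Z s) R) ?S"
        unfolding disjoint_family_on_def
      proof (intro ballI impI, rule ccontr)
        fix s t assume st: "s \<in> ?S" "t \<in> ?S" "s \<noteq> t" "A i \<inter> ball (Z s) R \<inter> (A i \<inter> ball (Z t) R) \<noteq> {}"
        then obtain x where "norm (Z s - x) < R" "norm (Z t - x) < R" by (auto simp: dist_norm)
        then have "norm (Z s - Z t) < 2 * R" using norm_triangle_ineq4[of "Z s - x" "Z t - x"] by simp
        moreover have "norm (Z s - Z t) \<ge> 2 * R" using sep st(1-3) by auto
        ultimately show False by simp
      qed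
    qed (use S A in auto)
    also have "\<dots> \<le> emeasure lborel (A i)" by (rule emeasure_mono) (use A in auto)
    finally show "(\<Sum>s\<in>?S. emeasure lborel (A (L s) \<inter> ball (Z s) R)) \<le> emeasure lborel (A i)" .
  qed
  also have "\<dots> \<le> infsum (\<lambda>i. emeasure lborel (A i)) UNIV"
    by (rule ennreal_sum_le_infsum) (use S in simp_all)
  finally show ?thesis .
qed

lemma emeasure_le_sym_diff:
  fixes A F B :: "'a::euclidean_space set"
  assumes "A \<in> sets borel" "F \<in> sets borel" "B \<in> sets borel" "B \<subseteq> ball 0 R"
  shows "emeasure lborel (A \<inter> B) \<le> emeasure lborel (F \<inter> B) + emeasure lborel (sym_diff A F \<inter> ball 0 R)"
proof -
  have "emeasure lborel (A \<inter> B) \<le> emeasure lborel ((F \<inter> B) \<union> (sym_diff A F \<inter> ball 0 R))"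
    by (rule emeasure_mono) (use assms(4) in blast, intro sets.Un sym_diff_ball_borel assms, use assms in simp)
  also have "\<dots> \<le> emeasure lborel (F \<inter> B) + emeasure lborel (sym_diff A F \<inter> ball 0 R)"
    by (rule emeasure_subadditive) (use assms in simp, intro sym_diff_ball_borel assms)
  finally show ?thesis .
qed

lemma emeasure_ball_exhaust:
  fixes F :: "'a::euclidean_space set"
  assumes "F \<in> sets borel"
  shows "(\<lambda>n. emeasure lborel (F \<inter> ball 0 (real n))) \<longlonglongrightarrow> emeasure lborel F"
proof -
  have "F = (\<Union>n. F \<inter> ball 0 (real n))" using reals_Archimedean2 by auto
  moreover have "(\<lambda>n. emeasure lborel (F \<inter> ball 0 (real n))) \<longlonglongrightarrow> emeasure lborel (\<Union>n. F \<inter> ball 0 (real n))"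
    by (rule Lim_emeasure_incseq) (use assms in \<open>auto simp: incseq_def\<close>)
  ultimately show ?thesis by simp
qed

text \<open>
  Inside balls of a fixed radius around the windows no mass is counted twice from some stage on; then
  the radius tends to infinity.
\<close>

lemma separated_mass_le:
  fixes A :: "nat \<Rightarrow> int \<Rightarrow> 'a::euclidean_space set"
  assumes S: "finite S" and A: "\<And>k i. A k i \<in> sets borel"
    and sep: "separated S L Z"
    and F: "\<And>s. s \<in> S \<Longrightarrow> loc_tendsto (\<lambda>k. shift (Z s k) (A k (L s k))) (F s)"
    and M: "\<And>k. infsum (\<lambda>i. emeasure lborel (A k i)) UNIV \<le> M"
  shows "(\<Sum>s\<in>S. emeasure lborel (F s)) \<le> M"
proof -
  have Fb: "F s \<in> sets borel" if "s \<in> S" for s using F[OF that] by (simp add: loc_tendsto_def)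
  let ?sd = "\<lambda>s k R. emeasure lborel (sym_diff (shift (Z s k) (A k (L s k))) (F s) \<inter> ball 0 R)"
  have "(\<Sum>s\<in>S. emeasure lborel (F s \<inter> ball 0 R)) \<le> M" for R
  proof -
    have "(\<lambda>k. M + (\<Sum>s\<in>S. ?sd s k R)) \<longlonglongrightarrow> M + (\<Sum>s\<in>S. 0)"
      by (intro tendsto_add tendsto_const tendsto_sum) (use F in \<open>simp add: loc_tendsto_def\<close>)
    moreover have "\<forall>\<^sub>F k in sequentially. (\<Sum>s\<in>S. emeasure lborel (F s \<inter> ball 0 R)) \<le> M + (\<Sum>s\<in>S. ?sd s k R)"
      using separated_eventually[OF S sep, of "2 * R"]
    proof eventually_elim
      case (elim k)
      have "(\<Sum>s\<in>S. emeasure lborel (F s \<inter> ball 0 R)) \<le>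
          (\<Sum>s\<in>S. emeasure lborel (shift (Z s k) (A k (L s k)) \<inter> ball 0 R) + ?sd s k R)"
      proof (rule sum_mono)
        fix s assume s: "s \<in> S"
        have "sym_diff (F s) (shift (Z s k) (A k (L s k))) = sym_diff (shift (Z s k) (A k (L s k))) (F s)" by blast
        then show "emeasure lborel (F s \<inter> ball 0 R) \<le> emeasure lborel (shift (Z s k) (A k (L s k)) \<inter> ball 0 R) + ?sd s k R"
          using emeasure_le_sym_diff[OF Fb[OF s] shift_borel[OF A], of "ball 0 R" R "Z s k" k "L s k"] by (simp only:) simp
      qed
      also have "\<dots> = (\<Sum>s\<in>S. emeasure lborel (shift (Z s k) (A k (L s k)) \<inter> ball 0 R)) + (\<Sum>s\<in>S. ?sd s k R)"
        by (rule sum.distrib)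
      also have "\<dots> \<le> M + (\<Sum>s\<in>S. ?sd s k R)"
        by (intro add_right_mono order_trans[OF separated_balls_mass_le[OF S A elim] M])
      finally show ?case .
    qed
    ultimately show ?thesis using tendsto_lowerbound[OF _ _ sequentially_bot] by simp
  qed
  moreover have "(\<lambda>n. \<Sum>s\<in>S. emeasure lborel (F s \<inter> ball 0 (real n))) \<longlonglongrightarrow> (\<Sum>s\<in>S. emeasure lborel (F s))"
    by (intro tendsto_sum emeasure_ball_exhaust Fb)
  ultimately show ?thesis by (intro LIMSEQ_le_const2) auto
qed

lemma grid_round_lattice:
  shows "grid_round 1 (x + grid_round 1 y) = grid_round 1 x + grid_round 1 y"
    and "grid_round 1 (grid_round 1 x - grid_round 1 y) = grid_round 1 x - grid_round 1 y"
  by (simp_all add: euclidean_eq_iff[where 'a='a] grid_round_inner inner_add_left inner_diff_left flip: of_int_diff)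

lemma bounded_grid_cell: "bounded (grid_cell 1 z)"
proof (cases "\<exists>x. x \<in> grid_cell 1 z")
  case False
  then have "grid_cell 1 z = {}" by blast
  then show ?thesis by simp
next
  case True
  then obtain x where x: "x \<in> grid_cell 1 z" by blast
  have "norm (y - x) \<le> real DIM('a)" if "y \<in> grid_cell 1 z" for y
  proof -
    have "norm (y - x) \<le> (\<Sum>b\<in>Basis. \<bar>(y - x) \<bullet> b\<bar>)" by (rule norm_le_l1)
    also have "\<dots> \<le> (\<Sum>b\<in>(Basis::'a set). 1)"
    proof (rule sum_mono)
      fix b :: 'a assume "b \<in> Basis"
      then show "\<bar>(y - x) \<bullet> b\<bar> \<le> 1" using same_cell_near[of 1 x y b] x that by (simp add: grid_cell_def)
    qed
    finally show ?thesis by simp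
  qed
  then have "grid_cell 1 z \<subseteq> cball x (real DIM('a))" by (auto simp: dist_norm norm_minus_commute)
  then show ?thesis using bounded_subset bounded_cball by blast
qed

lemma convergent_bool_eventually:
  assumes "convergent (\<lambda>k. if P k then 1 else 0 :: ennreal)"
  shows "(\<forall>\<^sub>F k in sequentially. P k) \<or> (\<forall>\<^sub>F k in sequentially. \<not> P k)"
proof -
  obtain L where L: "(\<lambda>k. if P k then 1 else 0 :: ennreal) \<longlonglongrightarrow> L" using assms by (auto simp: convergent_def)
  show ?thesis
  proof (cases "L > 0")
    case True
    from order_tendstoD(1)[OF L this] have "\<forall>\<^sub>F k in sequentially. P k"
      by eventually_elim (auto split: if_splits)
    then show ?thesis ..
  next
    case False
    then have "L < 1" by simp
    from order_tendstoD(2)[OF L this] have "\<forall>\<^sub>F k in sequentially. \<not> P k"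
      by eventually_elim (auto split: if_splits)
    then show ?thesis ..
  qed
qed

section \<open>Concentration of mass in heavy cells\<close>

lemma sum_cell_measures_le:
  fixes A :: "'l \<Rightarrow> 'a::euclidean_space set"
  assumes A: "\<And>l. A l \<in> sets borel" and H: "finite H"
  shows "(\<Sum>(l, z)\<in>H. emeasure lborel (A l \<inter> grid_cell 1 z)) \<le> (\<Sum>l\<in>fst ` H. emeasure lborel (A l))"
proof -
  have "(\<Sum>(l, z)\<in>H. emeasure lborel (A l \<inter> grid_cell 1 z))
     = (\<Sum>i\<in>fst ` H. \<Sum>w\<in>{w\<in>H. fst w = i}. emeasure lborel (A (fst w) \<inter> grid_cell 1 (snd w)))"
    using sum.image_gen[OF H, of "\<lambda>w. emeasure lborel (A (fst w) \<inter> grid_cell 1 (snd w))" fst]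
    by (simp add: case_prod_beta')
  also have "\<dots> \<le> (\<Sum>i\<in>fst ` H. emeasure lborel (A i))"
  proof (rule sum_mono)
    fix i
    let ?H = "{w\<in>H. fst w = i}"
    have "(\<Sum>w\<in>?H. emeasure lborel (A (fst w) \<inter> grid_cell 1 (snd w))) = (\<Sum>w\<in>?H. emeasure lborel (A i \<inter> grid_cell 1 (snd w)))"
      by (rule sum.cong) auto
    also have "\<dots> = emeasure lborel (\<Union>w\<in>?H. A i \<inter> grid_cell 1 (snd w))"
    proof (rule sum_emeasure)
      show "(\<lambda>w. A i \<inter> grid_cell 1 (snd w)) ` ?H \<subseteq> sets lborel"
        unfolding sets_lborel by (intro image_subsetI sets.Int A grid_cell_borel)
      show "disjoint_family_on (\<lambda>w. A i \<inter> grid_cell 1 (snd w)) ?H"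
        by (auto simp: disjoint_family_on_def grid_cell_def)
    qed (use H in simp)
    also have "\<dots> \<le> emeasure lborel (A i)" by (rule emeasure_mono) (blast, simp add: A)
    finally show "(\<Sum>w\<in>?H. emeasure lborel (A (fst w) \<inter> grid_cell 1 (snd w))) \<le> emeasure lborel (A i)" .
  qed
  finally show ?thesis .
qed

text \<open>
  Unit cells are named by layer and corner.  The threshold, half the volume of a cell of side \<open>1 / p\<close>, is that
  of \<open>light_cells_le\<close>.
\<close>

definition heavy_cells :: "nat \<Rightarrow> (int \<Rightarrow> 'a::euclidean_space set) \<Rightarrow> (int \<times> 'a) set" where
  "heavy_cells p A = {(l, z). z \<in> range (grid_round 1) \<and>
     ennreal (1 / 2 * (1 / real p) ^ DIM('a)) \<le> emeasure lborel (A l \<inter> grid_cell 1 z)}"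

lemma heavy_cells_finite:
  fixes A :: "int \<Rightarrow> 'a::euclidean_space set"
  assumes A: "\<And>l. A l \<in> sets borel" and p: "p > 0"
    and M: "infsum (\<lambda>l. emeasure lborel (A l)) UNIV \<le> ennreal m" "0 \<le> m"
    and n: "m < real n * (1 / 2 * (1 / real p) ^ DIM('a))"
  shows "finite (heavy_cells p A) \<and> card (heavy_cells p A) \<le> n"
proof -
  let ?e = "1 / 2 * (1 / real p) ^ DIM('a)"
  have small: "card H < n" if H: "finite H" "H \<subseteq> heavy_cells p A" for H
  proof -
    have "ennreal (real (card H) * ?e) = (\<Sum>w\<in>H. ennreal ?e)" by (subst sum_ennreal) simp_all
    also have "\<dots> \<le> (\<Sum>(l, z)\<in>H. emeasure lborel (A l \<inter> grid_cell 1 z))"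
      by (rule sum_mono) (use H in \<open>auto simp: heavy_cells_def\<close>)
    also have "\<dots> \<le> (\<Sum>l\<in>fst ` H. emeasure lborel (A l))" by (rule sum_cell_measures_le[OF A H(1)])
    also have "\<dots> \<le> infsum (\<lambda>l. emeasure lborel (A l)) UNIV" by (rule ennreal_sum_le_infsum) (use H in simp_all)
    also note M(1)
    finally have "real (card H) * ?e \<le> m" using M(2) by (simp add: ennreal_le_iff)
    then have "real (card H) * ?e < real n * ?e" using n by linarith
    then show ?thesis using p by (simp add: mult_less_cancel_right)
  qed
  have "finite (heavy_cells p A)"
  proof (rule ccontr)
    assume "infinite (heavy_cells p A)"
    from infinite_arbitrarily_large[OF this, of n] obtain H where "finite H" "card H = n" "H \<subseteq> heavy_cells p A" by blast
    then show False using small[of H] by simp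
  qed
  then show ?thesis using small[of "heavy_cells p A"] by simp
qed

text \<open>
  The enumeration uses the same number \<open>n\<close> of indices whatever the number of heavy cells, so that it can be
  followed along a sequence of sets; surplus indices point to an arbitrary cell.
\<close>

lemma heavy_cells_enumerate:
  fixes A :: "int \<Rightarrow> 'a::euclidean_space set"
  assumes "finite (heavy_cells p A)" "card (heavy_cells p A) \<le> n"
  obtains q :: "nat \<Rightarrow> int \<times> 'a" where "heavy_cells p A \<subseteq> q ` {..<n}" "\<And>j. snd (q j) \<in> range (grid_round 1)"
proof -
  obtain h where h: "bij_betw h {0..<card (heavy_cells p A)} (heavy_cells p A)"
    using ex_bij_betw_nat_finite[OF assms(1)] by blast
  define q where "q j = (if j < card (heavy_cells p A) then h j else (0, grid_round 1 0))" for j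
  show ?thesis
  proof (rule that[of q])
    show "heavy_cells p A \<subseteq> q ` {..<n}"
    proof
      fix w assume "w \<in> heavy_cells p A"
      then have "w \<in> h ` {0..<card (heavy_cells p A)}" using h by (simp add: bij_betw_def)
      then obtain j where "j < card (heavy_cells p A)" "w = h j" by auto
      then show "w \<in> q ` {..<n}" using assms(2) by (intro image_eqI[of _ _ j]) (auto simp: q_def)
    qed
    fix j
    show "snd (q j) \<in> range (grid_round 1)"
    proof (cases "j < card (heavy_cells p A)")
      case True
      then have "h j \<in> heavy_cells p A" using h by (auto simp: bij_betw_def)
      then show ?thesis using True by (auto simp: q_def heavy_cells_def)
    qed (simp add: q_def)
  qed
qed

lemma mass_le_cells_plus_light:
  fixes A :: "int \<Rightarrow> 'a::euclidean_space set"
  assumes nrm: "is_norm nrm" and A: "\<And>l. A l \<in> sets borel" "\<And>l. emeasure lborel (A l) < \<infinity>" and p: "p > 0"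
    and W: "finite W" "\<And>l z. (l, z) \<in> heavy_cells p A \<Longrightarrow> \<exists>w\<in>W. L w = l \<and> C w = z"
  shows "infsum (\<lambda>l. emeasure lborel (A l)) UNIV \<le>
     (\<Sum>w\<in>W. emeasure lborel (A (L w) \<inter> grid_cell 1 (C w)))
     + ennreal (2 * cell_const nrm / real p) * infsum (\<lambda>l. perimeter nrm (A l)) UNIV"
proof (rule ennreal_infsum_le)
  fix \<Lambda> :: "int set" assume \<Lambda>: "finite \<Lambda>"
  let ?g = "\<lambda>w. emeasure lborel (A (L w) \<inter> grid_cell 1 (C w))"
  let ?light = "\<lambda>l. {x \<in> A l. emeasure lborel (A l \<inter> grid_cell 1 (grid_round 1 x)) < ennreal (1 / 2 * (1 / real p) ^ DIM('a))}"
  have layer: "emeasure lborel (A l) \<le> (\<Sum>w\<in>W. if L w = l then ?g w else 0) + ennreal (2 * cell_const nrm / real p) * perimeter nrm (A l)" for l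
  proof -
    let ?W = "{w\<in>W. L w = l}"
    have "?light l = A l \<inter> {x. emeasure lborel (A l \<inter> grid_cell 1 (grid_round 1 x)) < ennreal (1 / 2 * (1 / real p) ^ DIM('a))}"
      by blast
    also have "\<dots> \<in> sets borel"
      by (rule sets.Int[OF A(1) grid_predicate_borel[of 1 "\<lambda>z. emeasure lborel (A l \<inter> grid_cell 1 z) < ennreal (1 / 2 * (1 / real p) ^ DIM('a))"]]) simp
    finally have light: "?light l \<in> sets lborel" unfolding sets_lborel .
    have heavy: "(\<Union>w\<in>?W. A (L w) \<inter> grid_cell 1 (C w)) \<in> sets lborel"
      by (rule sets.finite_UN) (use W(1) A grid_cell_borel[of 1] in auto)
    have "A l \<subseteq> (\<Union>w\<in>?W. A (L w) \<inter> grid_cell 1 (C w)) \<union> ?light l"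
    proof
      fix x assume x: "x \<in> A l"
      show "x \<in> (\<Union>w\<in>?W. A (L w) \<inter> grid_cell 1 (C w)) \<union> ?light l"
      proof (cases "x \<in> ?light l")
        case False
        then have "(l, grid_round 1 x) \<in> heavy_cells p A" using x by (simp add: heavy_cells_def not_less)
        from W(2)[OF this] obtain w where "w \<in> W" "L w = l" "C w = grid_round 1 x" by blast
        then show ?thesis using x by (auto simp: grid_cell_def)
      qed blast
    qed
    then have "emeasure lborel (A l) \<le> emeasure lborel ((\<Union>w\<in>?W. A (L w) \<inter> grid_cell 1 (C w)) \<union> ?light l)"
      by (rule emeasure_mono) (rule sets.Un[OF heavy light])
    also have "\<dots> \<le> emeasure lborel (\<Union>w\<in>?W. A (L w) \<inter> grid_cell 1 (C w)) + emeasure lborel (?light l)"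
      by (rule emeasure_subadditive[OF heavy light])
    also have "\<dots> \<le> (\<Sum>w\<in>?W. ?g w) + ennreal (2 * cell_const nrm / real p) * perimeter nrm (A l)"
    proof (rule add_mono)
      show "emeasure lborel (\<Union>w\<in>?W. A (L w) \<inter> grid_cell 1 (C w)) \<le> (\<Sum>w\<in>?W. ?g w)"
        by (rule emeasure_subadditive_finite) (use W(1) A grid_cell_borel[of 1] in auto)
      show "emeasure lborel (?light l) \<le> ennreal (2 * cell_const nrm / real p) * perimeter nrm (A l)"
        by (rule light_cells_le[OF nrm A p])
    qed
    also have "(\<Sum>w\<in>?W. ?g w) = (\<Sum>w\<in>W. if L w = l then ?g w else 0)"
      using W(1) by (rule sum.inter_filter)
    finally show ?thesis .
  qed
  have "(\<Sum>l\<in>\<Lambda>. emeasure lborel (A l)) \<le> (\<Sum>l\<in>\<Lambda>. (\<Sum>w\<in>W. if L w = l then ?g w else 0) + ennreal (2 * cell_const nrm / real p) * perimeter nrm (A l))"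
    by (rule sum_mono) (rule layer)
  also have "\<dots> = (\<Sum>w\<in>W. \<Sum>l\<in>\<Lambda>. if L w = l then ?g w else 0) + ennreal (2 * cell_const nrm / real p) * (\<Sum>l\<in>\<Lambda>. perimeter nrm (A l))"
    unfolding sum.distrib sum_distrib_left[symmetric] by (simp only: sum.swap[of _ \<Lambda> W])
  also have "\<dots> \<le> (\<Sum>w\<in>W. ?g w) + ennreal (2 * cell_const nrm / real p) * infsum (\<lambda>l. perimeter nrm (A l)) UNIV"
  proof (intro add_mono sum_mono mult_left_mono)
    show "(\<Sum>l\<in>\<Lambda>. if L w = l then ?g w else 0) \<le> ?g w" for w
      using \<Lambda> by (simp add: sum.delta)
    show "(\<Sum>l\<in>\<Lambda>. perimeter nrm (A l)) \<le> infsum (\<lambda>l. perimeter nrm (A l)) UNIV"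
      by (rule ennreal_sum_le_infsum) (use \<Lambda> in simp_all)
  qed simp
  finally show "(\<Sum>l\<in>\<Lambda>. emeasure lborel (A l)) \<le> (\<Sum>w\<in>W. ?g w) + ennreal (2 * cell_const nrm / real p) * infsum (\<lambda>l. perimeter nrm (A l)) UNIV" .
qed

text \<open>
  A window \<open>(i, p, j)\<close> follows the \<open>j\<close>-th among the unit cells that are heavy for component \<open>i\<close> at level \<open>p\<close>.
  After passing to a subsequence, two windows either keep a constant offset or move infinitely far
  apart; \<open>T\<close> contains one window for each class of windows with constant offset.  In the
  limit the sets \<open>F s i\<close> with \<open>s \<in> T\<close> see all heavy cells of all levels, and what they miss
  of component \<open>i\<close> is at most the light part, which is \<open>O(1 / p)\<close> for every \<open>p\<close>.  Level \<open>p\<close> refers to cells of side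
  \<open>1 / Suc p\<close>, so that level 0 makes sense.
\<close>

lemma concentration_compactness:
  fixes A :: "nat \<Rightarrow> nat \<Rightarrow> int \<Rightarrow> 'a::euclidean_space set" and m :: "nat \<Rightarrow> real"
  assumes nrm: "is_norm nrm"
    and A: "\<And>k i l. A k i l \<in> sets borel"
    and m: "\<And>i. 0 \<le> m i" "\<And>k i. infsum (\<lambda>l. emeasure lborel (A k i l)) UNIV = ennreal (m i)"
    and C: "\<And>k i. infsum (\<lambda>l. perimeter nrm (A k i l)) UNIV \<le> ennreal C"
  obtains r :: "nat \<Rightarrow> nat" and T :: "(nat \<times> nat \<times> nat) set" and L Z F
  where "strict_mono r" "separated T L Z"
    "\<And>s i. s \<in> T \<Longrightarrow> loc_tendsto (\<lambda>k. shift (Z s k) (A (r k) i (L s k))) (F s i)"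
    "\<And>i. ennreal (m i) \<le> infsum (\<lambda>s. emeasure lborel (F s i)) T"
proof -
  have Afin: "emeasure lborel (A k i l) \<le> ennreal (m i)" for k i l
    using ennreal_le_infsum[of l UNIV "\<lambda>l. emeasure lborel (A k i l)"] m(2) by simp
  have Afin': "emeasure lborel (A k i l) < \<infinity>" for k i l
    using le_less_trans[OF Afin[of k i l] ennreal_less_top] by simp
  have "\<exists>n. m i < real n * (1 / 2 * (1 / real (Suc p)) ^ DIM('a))" for i p
    using reals_Archimedean3[of "1 / 2 * (1 / real (Suc p)) ^ DIM('a)"] by simp
  then obtain M where M: "\<And>i p. m i < real (M i p) * (1 / 2 * (1 / real (Suc p)) ^ DIM('a))" by metis
  have ex_q: "\<exists>q. heavy_cells (Suc p) (A k i) \<subseteq> q ` {..<M i p} \<and> (\<forall>j. snd (q j) \<in> range (grid_round 1))" for k i p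
  proof -
    have "finite (heavy_cells (Suc p) (A k i)) \<and> card (heavy_cells (Suc p) (A k i)) \<le> M i p"
      by (rule heavy_cells_finite[OF A _ _ m(1) M]) (simp_all add: m(2))
    then show ?thesis using heavy_cells_enumerate[of "Suc p" "A k i" "M i p"] by metis
  qed
  define q where "q k i p = (SOME q. heavy_cells (Suc p) (A k i) \<subseteq> q ` {..<M i p} \<and> (\<forall>j. snd (q j) \<in> range (grid_round 1)))" for k i p
  have "heavy_cells (Suc p) (A k i) \<subseteq> q k i p ` {..<M i p} \<and> (\<forall>j. snd (q k i p j) \<in> range (grid_round 1))" for k i p
    unfolding q_def by (rule someI_ex[OF ex_q])
  then have q: "\<And>k i p. heavy_cells (Suc p) (A k i) \<subseteq> q k i p ` {..<M i p}"
    "\<And>k i p j. snd (q k i p j) \<in> range (grid_round 1)" by blast+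
  define L0 where "L0 s k = (case s of (i, p, j) \<Rightarrow> fst (q k i p j))" for s k
  define Z0 where "Z0 s k = (case s of (i, p, j) \<Rightarrow> snd (q k i p j))" for s k
  have Z0: "Z0 s k \<in> range (grid_round 1)" for s k
    unfolding Z0_def using q(2) by (simp split: prod.split)
  define D where "D = (\<lambda>(x, y). x - y) ` (range (grid_round 1) \<times> range (grid_round 1 :: 'a \<Rightarrow> 'a))"
  have D: "countable D" unfolding D_def
    by (intro countable_image countable_SIGMA countable_range_grid_round) simp_all
  have Z0D: "Z0 s k - Z0 t k \<in> D" for s t k
    unfolding D_def using Z0 by (intro image_eqI[of _ _ "(Z0 s k, Z0 t k)"]) auto
  \<comment> \<open>The first extraction decides, for all pairs of windows and all offsets, whether the pair
     eventually has this offset or eventually does not.\<close>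
  define f1 :: "(nat \<times> nat \<times> nat) \<times> (nat \<times> nat \<times> nat) \<times> 'a \<Rightarrow> nat \<Rightarrow> ennreal"
    where "f1 = (\<lambda>(s, t, d) k. if L0 s k = L0 t k \<and> Z0 s k - Z0 t k = d then 1 else 0)"
  obtain r1 where r1: "strict_mono r1" "\<And>w. w \<in> UNIV \<times> UNIV \<times> D \<Longrightarrow> convergent (\<lambda>k. f1 w (r1 k))"
    by (rule diagonal_convergent_subseq[of "UNIV \<times> UNIV \<times> D" f1])
      (use D in \<open>auto intro!: countable_SIGMA\<close>)
  define G where "G = (\<Union>p. range (grid_round (real (Suc p)) :: 'a \<Rightarrow> 'a))"
  have G: "countable G" unfolding G_def by (intro countable_UN countable_range_grid_round) simp_all
  \<comment> \<open>The second extraction makes the volumes in all grid cells converge, as seen from each window.\<close>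
  define f2 :: "(nat \<times> nat \<times> nat) \<times> nat \<times> nat \<times> 'a \<Rightarrow> nat \<Rightarrow> ennreal"
    where "f2 = (\<lambda>(s, i, p, z) k. emeasure lborel (shift (Z0 s (r1 k)) (A (r1 k) i (L0 s (r1 k))) \<inter> grid_cell (real p) z))"
  obtain r2 where r2: "strict_mono r2" "\<And>w. w \<in> UNIV \<times> UNIV \<times> UNIV \<times> G \<Longrightarrow> convergent (\<lambda>k. f2 w (r2 k))"
    by (rule diagonal_convergent_subseq[of "UNIV \<times> UNIV \<times> UNIV \<times> G" f2])
      (use G in \<open>auto intro!: countable_SIGMA\<close>)
  define r where "r k = r1 (r2 k)" for k
  have r: "strict_mono r" unfolding r_def using r1(1) r2(1) by (simp add: strict_mono_def)
  define L where "L s k = L0 s (r k)" for s k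
  define Z where "Z s k = Z0 s (r k)" for s k
  define near where "near s t d \<longleftrightarrow> (\<forall>\<^sub>F k in sequentially. L s k = L t k \<and> Z s k - Z t k = d)" for s t d
  have not_near: "\<forall>\<^sub>F k in sequentially. \<not> (L s k = L t k \<and> Z s k - Z t k = d)" if "d \<in> D" "\<not> near s t d" for s t d
  proof -
    have "convergent (\<lambda>k. f1 (s, t, d) (r1 k))" by (rule r1(2)) (use that in simp)
    from convergent_subseq_convergent[OF this r2(1)]
    have "convergent (\<lambda>k. if L s k = L t k \<and> Z s k - Z t k = d then 1 else 0 :: ennreal)"
      by (simp add: f1_def o_def L_def Z_def r_def)
    from convergent_bool_eventually[OF this] show ?thesis using that(2) unfolding near_def by blast
  qed
  have near_refl: "near s s 0" for s unfolding near_def by simp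
  have near_sym: "near t s (- d)" if "near s t d" for s t d
    using that unfolding near_def by eventually_elim auto
  have near_trans: "near s u (d + e)" if "near s t d" "near t u e" for s t u d e
    using that unfolding near_def by eventually_elim (auto simp: algebra_simps)
  define rep where "rep s = (SOME t. \<exists>d. near s t d)" for s
  have rep: "\<exists>d. near s (rep s) d" for s
    unfolding rep_def by (rule someI[of "\<lambda>t. \<exists>d. near s t d" s]) (use near_refl in blast)
  have rep_eq: "rep s = rep t" if "near s t d" for s t d
  proof -
    have "(\<exists>d. near s u d) \<longleftrightarrow> (\<exists>d. near t u d)" for u
      using near_trans[OF that] near_trans[OF near_sym[OF that]] by blast
    then show ?thesis by (simp add: rep_def)
  qed
  define T where "T = range rep"
  have sep: "separated T L Z"
    unfolding separated_def
  proof (intro allI ballI impI)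
    fix R s t assume st: "s \<in> T" "t \<in> T" "s \<noteq> t"
    have "\<not> near s t d" for d
    proof
      assume n: "near s t d"
      obtain s' t' where s': "s = rep s'" "t = rep t'" using st by (auto simp: T_def)
      have "rep s' = rep s" "rep t' = rep t" using rep[of s'] rep[of t'] rep_eq s' by blast+
      then show False using rep_eq[OF n] s' st(3) by simp
    qed
    then have 1: "\<forall>\<^sub>F k in sequentially. \<forall>d\<in>{d\<in>D. norm d < R}. \<not> (L s k = L t k \<and> Z s k - Z t k = d)"
    proof (intro eventually_ball_finite ballI)
      \<comment> \<open>Offsets are lattice points, and there are only finitely many of norm less than \<open>R\<close>.\<close>
      have "{d\<in>D. norm d < R} \<subseteq> grid_round 1 ` ball 0 R"
      proof
        fix d assume d: "d \<in> {d\<in>D. norm d < R}"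
        then have "grid_round 1 d = d" by (auto simp: D_def grid_round_lattice)
        then show "d \<in> grid_round 1 ` ball 0 R" using d by (intro image_eqI[of _ _ d]) simp_all
      qed
      then show "finite {d\<in>D. norm d < R}"
        by (rule finite_subset) (rule finite_grid_round_image, simp_all)
    qed (use not_near in blast)
    then show "\<forall>\<^sub>F k in sequentially. L s k \<noteq> L t k \<or> R \<le> norm (Z s k - Z t k)"
    proof eventually_elim
      case (elim k)
      have "Z s k - Z t k \<in> D" unfolding Z_def by (rule Z0D)
      then show ?case using elim by (auto simp: not_le[symmetric])
    qed
  qed
  let ?A = "\<lambda>s i k. shift (Z s k) (A (r k) i (L s k))"
  have sA: "?A s i k \<in> sets borel" for s i k by (intro shift_borel A)
  have "\<exists>F. loc_tendsto (?A s i) F" for s i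
  proof (rule perimeter_bounded_loc_compact[OF nrm, of "?A s i" C])
    fix k
    show "?A s i k \<in> sets borel" by (rule sA)
    show "emeasure lborel (?A s i k) < \<infinity>" unfolding emeasure_shift[OF A] by (rule Afin')
    have "perimeter nrm (?A s i k) \<le> perimeter nrm (A (r k) i (L s k))" by (rule perimeter_shift_le[OF nrm A])
    also have "\<dots> \<le> infsum (\<lambda>l. perimeter nrm (A (r k) i l)) UNIV" by (rule ennreal_le_infsum) simp
    also have "\<dots> \<le> ennreal C" by (rule C)
    finally show "perimeter nrm (?A s i k) \<le> ennreal C" .
  next
    fix p :: nat and z :: 'a assume p: "p > 0"
    show "convergent (\<lambda>k. emeasure lborel (?A s i k \<inter> grid_cell (real p) z))"
    proof (cases "z \<in> G")
      case True
      then have "convergent (\<lambda>k. f2 (s, i, p, z) (r2 k))" by (intro r2(2)) simp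
      then show ?thesis by (simp add: f2_def L_def Z_def r_def)
    next
      case False
      obtain p' where "p = Suc p'" using p gr0_implies_Suc by blast
      then have "grid_cell (real p) z = {}" using False by (auto simp: grid_cell_def G_def)
      then show ?thesis by (simp add: convergent_const)
    qed
  qed blast
  then obtain F where F: "\<And>s i. loc_tendsto (?A s i) (F s i)" by metis
  have Fb: "F s i \<in> sets borel" for s i using F[of s i] by (simp add: loc_tendsto_def)
  let ?sd = "\<lambda>s i k R. emeasure lborel (sym_diff (?A s i k) (F s i) \<inter> ball 0 R)"
  have mass: "ennreal (m i) \<le> infsum (\<lambda>s. emeasure lborel (F s i)) T + ennreal (2 * cell_const nrm / real (Suc p)) * ennreal C" for i p
  proof -
    let ?c = "ennreal (2 * cell_const nrm / real (Suc p)) * ennreal C"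
    have "\<forall>j. \<exists>d. near (i, p, j) (rep (i, p, j)) d" using rep by blast
    from choice[OF this] obtain d where d: "\<And>j. near (i, p, j) (rep (i, p, j)) (d j)" by blast
    \<comment> \<open>Every heavy cell is at one of these offsets from one of the chosen windows.  As \<open>W\<close> is a set,
       windows that follow the same cell are counted only once.\<close>
    define W where "W = (\<lambda>j. (rep (i, p, j), d j)) ` {..<M i p}"
    have W: "finite W" by (simp add: W_def)
    have "\<exists>R. grid_cell 1 z \<subseteq> ball 0 R" for z :: 'a
      using bounded_subset_ballD[OF bounded_grid_cell, of z 0] by blast
    then obtain R where R: "\<And>z::'a. grid_cell 1 z \<subseteq> ball 0 (R z)" by metis
    let ?lim = "\<Sum>(t, d)\<in>W. emeasure lborel (F t i \<inter> grid_cell 1 d)"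
    have "\<forall>\<^sub>F k in sequentially. \<forall>j\<in>{..<M i p}. L (i, p, j) k = L (rep (i, p, j)) k \<and> Z (i, p, j) k - Z (rep (i, p, j)) k = d j"
      by (intro eventually_ball_finite ballI) (use d in \<open>auto simp: near_def\<close>)
    then have "\<forall>\<^sub>F k in sequentially. ennreal (m i) \<le> ?lim + (\<Sum>(t, d)\<in>W. ?sd t i k (R d)) + ?c"
    proof eventually_elim
      case (elim k)
      have "ennreal (m i) \<le> (\<Sum>w\<in>W. emeasure lborel (A (r k) i (L (fst w) k) \<inter> grid_cell 1 (Z (fst w) k + snd w)))
         + ennreal (2 * cell_const nrm / real (Suc p)) * infsum (\<lambda>l. perimeter nrm (A (r k) i l)) UNIV"
        unfolding m(2)[of "r k" i, symmetric]
      proof (rule mass_le_cells_plus_light[OF nrm A Afin' _ W])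
        fix l z assume "(l, z) \<in> heavy_cells (Suc p) (A (r k) i)"
        then obtain j where j: "j < M i p" "(l, z) = q (r k) i p j" using q(1) by blast
        then have lz: "l = L (i, p, j) k" "z = Z (i, p, j) k"
          by (simp_all add: L_def Z_def L0_def Z0_def flip: j(2))
        have "L (i, p, j) k = L (rep (i, p, j)) k" "Z (i, p, j) k = Z (rep (i, p, j)) k + d j"
          using elim j(1) by (auto simp: algebra_simps)
        then show "\<exists>w\<in>W. L (fst w) k = l \<and> Z (fst w) k + snd w = z"
          unfolding lz using j(1) by (intro bexI[of _ "(rep (i, p, j), d j)"]) (auto simp: W_def)
      qed simp
      also have "\<dots> \<le> (\<Sum>w\<in>W. emeasure lborel (F (fst w) i \<inter> grid_cell 1 (snd w)) + ?sd (fst w) i k (R (snd w))) + ?c"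
      proof (intro add_mono sum_mono mult_left_mono C)
        fix w :: "(nat \<times> nat \<times> nat) \<times> 'a"
        obtain y where y: "Z (fst w) k = grid_round 1 y" using Z0[of "fst w" "r k"] by (auto simp: Z_def)
        have "shift (Z (fst w) k) (A (r k) i (L (fst w) k) \<inter> grid_cell 1 (Z (fst w) k + snd w))
            = ?A (fst w) i k \<inter> grid_cell 1 (snd w)"
          unfolding y by (auto simp: shift_def grid_cell_def grid_round_lattice add.commute)
        moreover have "A (r k) i (L (fst w) k) \<inter> grid_cell 1 (Z (fst w) k + snd w) \<in> sets borel"
          by (intro sets.Int A grid_cell_borel)
        ultimately have "emeasure lborel (A (r k) i (L (fst w) k) \<inter> grid_cell 1 (Z (fst w) k + snd w))
            = emeasure lborel (?A (fst w) i k \<inter> grid_cell 1 (snd w))"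
          by (metis emeasure_shift)
        also have "\<dots> \<le> emeasure lborel (F (fst w) i \<inter> grid_cell 1 (snd w)) + ?sd (fst w) i k (R (snd w))"
          by (rule emeasure_le_sym_diff[OF sA Fb grid_cell_borel R])
        finally show "emeasure lborel (A (r k) i (L (fst w) k) \<inter> grid_cell 1 (Z (fst w) k + snd w))
            \<le> emeasure lborel (F (fst w) i \<inter> grid_cell 1 (snd w)) + ?sd (fst w) i k (R (snd w))" .
      qed simp
      also have "\<dots> = ?lim + (\<Sum>(t, d)\<in>W. ?sd t i k (R d)) + ?c"
        unfolding sum.distrib case_prod_beta' ..
      finally show ?case .
    qed
    moreover have "(\<lambda>k. ?lim + (\<Sum>(t, d)\<in>W. ?sd t i k (R d)) + ?c) \<longlonglongrightarrow> ?lim + (\<Sum>w\<in>W. 0) + ?c"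
      unfolding case_prod_beta'
      by (intro tendsto_add tendsto_const tendsto_sum) (use F in \<open>simp add: loc_tendsto_def\<close>)
    ultimately have "ennreal (m i) \<le> ?lim + ?c"
      using tendsto_lowerbound[OF _ _ sequentially_bot] by simp
    also have "?lim \<le> infsum (\<lambda>s. emeasure lborel (F s i)) T"
    proof -
      have "?lim \<le> (\<Sum>t\<in>fst ` W. emeasure lborel (F t i))"
        by (rule sum_cell_measures_le[OF Fb W])
      also have "\<dots> \<le> infsum (\<lambda>s. emeasure lborel (F s i)) T"
        by (rule ennreal_sum_le_infsum) (use W in \<open>auto simp: W_def T_def\<close>)
      finally show ?thesis .
    qed
    finally show ?thesis by simp
  qed
  have "ennreal (m i) \<le> infsum (\<lambda>s. emeasure lborel (F s i)) T" for i
  proof -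
    have "(\<lambda>p. ennreal (2 * cell_const nrm / real (Suc p)) * ennreal C) \<longlonglongrightarrow> ennreal 0 * ennreal C"
    proof (rule tendsto_mult_ennreal)
      have "(\<lambda>p. 2 * cell_const nrm * inverse (real (Suc p))) \<longlonglongrightarrow> 2 * cell_const nrm * 0"
        by (intro tendsto_intros LIMSEQ_inverse_real_of_nat)
      then show "(\<lambda>p. ennreal (2 * cell_const nrm / real (Suc p))) \<longlonglongrightarrow> ennreal 0"
        by (intro tendsto_ennrealI) (simp add: divide_inverse)
    qed simp_all
    then have "(\<lambda>p. infsum (\<lambda>s. emeasure lborel (F s i)) T + ennreal (2 * cell_const nrm / real (Suc p)) * ennreal C)
        \<longlonglongrightarrow> infsum (\<lambda>s. emeasure lborel (F s i)) T + 0"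
      by (intro tendsto_add tendsto_const) simp
    then show ?thesis using LIMSEQ_le_const mass by fastforce
  qed
  then show ?thesis using that[OF r sep, of F] F by blast
qed

section \<open>Assembling the minimizer\<close>

text \<open>
  Only finitely many components matter up to a small error, by the summable bounds on the volumes.
\<close>

lemma loc_tendsto_UN:
  fixes X :: "nat \<Rightarrow> nat \<Rightarrow> 'a::euclidean_space set"
  assumes X: "\<And>k i. X k i \<in> sets borel" "\<And>k i. emeasure lborel (X k i) \<le> ennreal (m i)"
    and F: "\<And>i. loc_tendsto (\<lambda>k. X k i) (F i)" "\<And>i. emeasure lborel (F i) \<le> ennreal (m i)"
    and m: "summable m" "\<And>i. 0 \<le> m i"
  shows "loc_tendsto (\<lambda>k. \<Union>i. X k i) (\<Union>i. F i)"
  unfolding loc_tendsto_def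
proof (intro conjI allI)
  have Fb: "F i \<in> sets borel" for i using F(1)[of i] by (simp add: loc_tendsto_def)
  have UNb: "(\<Union>i. X k i) \<in> sets borel" "(\<Union>i. F i) \<in> sets borel" for k
    by (intro sets.countable_UN'' countableI_type X Fb)+
  then show "(\<Union>i. F i) \<in> sets borel" by simp
  fix R
  show "(\<lambda>k. emeasure lborel (sym_diff (\<Union>i. X k i) (\<Union>i. F i) \<inter> ball 0 R)) \<longlonglongrightarrow> 0"
  proof (rule tendsto_0_ennrealI)
    fix e :: real assume e: "e > 0"
    obtain n where n: "norm (\<Sum>i. m (i + n)) < e / 4"
      using suminf_exist_split[OF _ m(1), of "e / 4"] e by auto
    have tail: "(\<Sum>i. ennreal (m (i + n)) + ennreal (m (i + n))) \<le> ennreal (e / 2)"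
    proof -
      have s: "summable (\<lambda>i. 2 * m (i + n))"
        by (intro summable_mult summable_ignore_initial_segment m)
      have "(\<Sum>i. ennreal (m (i + n)) + ennreal (m (i + n))) = (\<Sum>i. ennreal (2 * m (i + n)))"
        by (intro suminf_cong) (simp add: ennreal_plus[symmetric] m(2) del: ennreal_plus)
      also have "\<dots> = ennreal (\<Sum>i. 2 * m (i + n))"
        by (rule suminf_ennreal2[OF _ s]) (simp add: m(2))
      also have "(\<Sum>i. 2 * m (i + n)) = 2 * (\<Sum>i. m (i + n))"
        by (rule suminf_mult) (intro summable_ignore_initial_segment m)
      finally show ?thesis using n by (auto intro!: ennreal_leI)
    qed
    let ?sd = "\<lambda>k i. sym_diff (X k i) (F i) \<inter> ball 0 R"
    have "(\<lambda>k. \<Sum>i<n. emeasure lborel (?sd k i)) \<longlonglongrightarrow> (\<Sum>i<n. 0)"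
      by (intro tendsto_sum) (use F(1) in \<open>simp add: loc_tendsto_def\<close>)
    then have "\<forall>\<^sub>F k in sequentially. (\<Sum>i<n. emeasure lborel (?sd k i)) < ennreal (e / 2)"
      by (rule order_tendstoD) (use e in simp)
    then show "\<forall>\<^sub>F k in sequentially. emeasure lborel (sym_diff (\<Union>i. X k i) (\<Union>i. F i) \<inter> ball 0 R) \<le> ennreal e"
    proof eventually_elim
      case (elim k)
      have b1: "(\<Union>i<n. ?sd k i) \<in> sets lborel"
        by (intro sets.finite_UN sym_diff_ball_borel X Fb) simp
      have b2: "(\<Union>i. X k (i + n) \<union> F (i + n)) \<in> sets lborel"
        unfolding sets_lborel by (intro sets.countable_UN'' countableI_type sets.Un X Fb)
      have "sym_diff (\<Union>i. X k i) (\<Union>i. F i) \<inter> ball 0 R \<subseteq> (\<Union>i<n. ?sd k i) \<union> (\<Union>i. X k (i + n) \<union> F (i + n))"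
      proof
        fix x assume x: "x \<in> sym_diff (\<Union>i. X k i) (\<Union>i. F i) \<inter> ball 0 R"
        then obtain i where i: "x \<in> sym_diff (X k i) (F i)" by blast
        show "x \<in> (\<Union>i<n. ?sd k i) \<union> (\<Union>i. X k (i + n) \<union> F (i + n))"
        proof (cases "i < n")
          case True
          then show ?thesis using x i by blast
        next
          case False
          then have "x \<in> X k ((i - n) + n) \<union> F ((i - n) + n)" using i by auto
          then show ?thesis by blast
        qed
      qed
      then have "emeasure lborel (sym_diff (\<Union>i. X k i) (\<Union>i. F i) \<inter> ball 0 R)
          \<le> emeasure lborel ((\<Union>i<n. ?sd k i) \<union> (\<Union>i. X k (i + n) \<union> F (i + n)))"
        by (rule emeasure_mono) (rule sets.Un[OF b1 b2])
      also have "\<dots> \<le> emeasure lborel (\<Union>i<n. ?sd k i) + emeasure lborel (\<Union>i. X k (i + n) \<union> F (i + n))"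
        by (rule emeasure_subadditive[OF b1 b2])
      also have "\<dots> \<le> ennreal (e / 2) + ennreal (e / 2)"
      proof (rule add_mono)
        have "emeasure lborel (\<Union>i<n. ?sd k i) \<le> (\<Sum>i<n. emeasure lborel (?sd k i))"
          by (rule emeasure_subadditive_finite) (use X Fb sym_diff_ball_borel in blast)+
        then show "emeasure lborel (\<Union>i<n. ?sd k i) \<le> ennreal (e / 2)" using elim by simp
        have "emeasure lborel (\<Union>i. X k (i + n) \<union> F (i + n)) \<le> (\<Sum>i. emeasure lborel (X k (i + n) \<union> F (i + n)))"
          by (rule emeasure_subadditive_countably) (use X Fb in auto)
        also have "\<dots> \<le> (\<Sum>i. ennreal (m (i + n)) + ennreal (m (i + n)))"
        proof (rule suminf_le)
          fix i
          have "emeasure lborel (X k (i + n) \<union> F (i + n)) \<le> emeasure lborel (X k (i + n)) + emeasure lborel (F (i + n))"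
            by (rule emeasure_subadditive) (use X Fb in simp_all)
          also have "\<dots> \<le> ennreal (m (i + n)) + ennreal (m (i + n))" by (intro add_mono X F)
          finally show "emeasure lborel (X k (i + n) \<union> F (i + n)) \<le> ennreal (m (i + n)) + ennreal (m (i + n))" .
        qed simp_all
        also note tail
        finally show "emeasure lborel (\<Union>i. X k (i + n) \<union> F (i + n)) \<le> ennreal (e / 2)" .
      qed
      also have "\<dots> = ennreal e" using e by (subst ennreal_plus[symmetric]) auto
      finally show ?case .
    qed
  qed
qed

lemma loc_tendsto_null_Int:
  fixes F G :: "'a::euclidean_space set"
  assumes A: "\<And>k. A k \<in> sets borel" "\<And>k. B k \<in> sets borel" "\<And>k. emeasure lborel (A k \<inter> B k) = 0"
    and F: "loc_tendsto A F" and G: "loc_tendsto B G"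
  shows "emeasure lborel (F \<inter> G) = 0"
proof -
  have b: "F \<in> sets borel" "G \<in> sets borel" using F G by (simp_all add: loc_tendsto_def)
  have "emeasure lborel (F \<inter> G \<inter> ball 0 R) \<le> 0" for R
  proof -
    let ?f = "\<lambda>k. emeasure lborel (sym_diff (A k) F \<inter> ball 0 R) + emeasure lborel (sym_diff (B k) G \<inter> ball 0 R)"
    have "?f \<longlonglongrightarrow> 0 + 0"
      by (intro tendsto_add) (use F G in \<open>simp_all add: loc_tendsto_def\<close>)
    moreover have "emeasure lborel (F \<inter> G \<inter> ball 0 R) \<le> ?f k" for k
    proof -
      let ?S = "sym_diff (A k) F \<inter> ball 0 R" and ?T = "sym_diff (B k) G \<inter> ball 0 R"
      have s: "?S \<in> sets lborel" "?T \<in> sets lborel" "A k \<inter> B k \<in> sets lborel"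
        by (intro sym_diff_ball_borel A b)+ (use A in simp)
      have "emeasure lborel (F \<inter> G \<inter> ball 0 R) \<le> emeasure lborel ((?S \<union> ?T) \<union> (A k \<inter> B k))"
        by (rule emeasure_mono) (blast, intro sets.Un s)
      also have "\<dots> \<le> emeasure lborel (?S \<union> ?T) + emeasure lborel (A k \<inter> B k)"
        by (rule emeasure_subadditive) (intro sets.Un s)+
      also have "\<dots> \<le> ?f k" unfolding A(3) using emeasure_subadditive[OF s(1,2)] by simp
      finally show ?thesis .
    qed
    ultimately show ?thesis using LIMSEQ_le_const[of ?f 0] by simp
  qed
  then have "(\<lambda>n. emeasure lborel (F \<inter> G \<inter> ball 0 (real n))) \<longlonglongrightarrow> 0" by simp
  moreover have "(\<lambda>n. emeasure lborel (F \<inter> G \<inter> ball 0 (real n))) \<longlonglongrightarrow> emeasure lborel (F \<inter> G)"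
    by (rule emeasure_ball_exhaust) (use b in simp)
  ultimately show ?thesis by (rule LIMSEQ_unique[rotated])
qed

lemma perimeter_empty: "perimeter nrm {} = 0"
proof (rule antisym)
  show "perimeter nrm {} \<le> 0" unfolding perimeter_def by (rule SUP_least) simp
qed simp

definition from_layers :: "(int \<Rightarrow> nat \<Rightarrow> 'a set) \<Rightarrow> nat \<Rightarrow> (int \<times> 'a) set" where
  "from_layers X i = {(l, x). x \<in> X l i}"

lemma layer_from_layers: "layer (from_layers X) l = X l"
  by (auto simp: layer_def from_layers_def fun_eq_iff)

lemma infsum_extend_zero:
  fixes g :: "int \<Rightarrow> ennreal"
  assumes "inj_on \<iota> T" "\<And>l. l \<notin> \<iota> ` T \<Longrightarrow> g l = 0"
  shows "infsum g UNIV = infsum (\<lambda>s. g (\<iota> s)) T"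
proof -
  have "infsum g UNIV = infsum g (\<iota> ` T)"
    by (rule infsum_cong_neutral) (use assms(2) in auto)
  also have "\<dots> = infsum (g \<circ> \<iota>) T" by (rule infsum_reindex[OF assms(1)])
  finally show ?thesis by (simp add: o_def)
qed

lemma ex_borel_of_measure:
  assumes "m \<ge> 0"
  obtains B :: "'a::euclidean_space set" where "B \<in> sets borel" "emeasure lborel B = ennreal m"
proof -
  define w :: 'a where "w = (\<Sum>b\<in>Basis. root DIM('a) m *\<^sub>R b)"
  have w: "w \<bullet> b = root DIM('a) m" if "b \<in> Basis" for b
    using that by (simp add: w_def inner_sum_left inner_Basis if_distrib cong: if_cong)
  have "(\<Prod>b\<in>Basis. (w - 0) \<bullet> b) = (\<Prod>b\<in>(Basis::'a set). root DIM('a) m)"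
    by (rule prod.cong) (use w in simp_all)
  then have "emeasure lborel (cbox 0 w) = ennreal m"
    using w assms by (simp add: emeasure_lborel_cbox_eq real_root_pow_pos2)
  then show ?thesis by (intro that[of "cbox 0 w"]) simp_all
qed

text \<open>
  Component \<open>i\<close> lives in layer \<open>i\<close> alone, which makes the components disjoint.
\<close>

lemma ex_gen_cluster:
  assumes m: "\<forall>i\<in>idx N. 0 \<le> m i"
  obtains E :: "nat \<Rightarrow> (int \<times> 'a::euclidean_space) set"
  where "gen_cluster N E" "\<forall>i\<in>idx N. gen_measure E i = ennreal (m i)"
proof -
  have "\<exists>B :: 'a set. B \<in> sets borel \<and> emeasure lborel B = ennreal (m i)" if "i \<in> idx N" for i
    using ex_borel_of_measure[of "m i"] m that by metis
  then obtain B :: "nat \<Rightarrow> 'a set" where B: "\<And>i. i \<in> idx N \<Longrightarrow> B i \<in> sets borel"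
    "\<And>i. i \<in> idx N \<Longrightarrow> emeasure lborel (B i) = ennreal (m i)" by metis
  define X where "X l i = (if l = int i then B i else {})" for l i
  show ?thesis
  proof (rule that[of "from_layers X"])
    show "gen_cluster N (from_layers X)"
      unfolding gen_cluster_def cluster_def layer_from_layers using B(1) by (auto simp: X_def)
    show "\<forall>i\<in>idx N. gen_measure (from_layers X) i = ennreal (m i)"
    proof
      fix i assume i: "i \<in> idx N"
      have "gen_measure (from_layers X) i = infsum (\<lambda>s. emeasure lborel (X (int s) i)) {i}"
        unfolding gen_measure_def cluster_measure_def layer_from_layers
        by (rule infsum_extend_zero) (auto simp: X_def)
      then show "gen_measure (from_layers X) i = ennreal (m i)" using B(2)[OF i] by (simp add: X_def)
    qed
  qed
qed

lemma twice_cluster_perimeter: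
  "2 * cluster_perimeter nrm N E = infsum (\<lambda>j. perimeter nrm (E j)) (idx N) + perimeter nrm (\<Union>j\<in>idx N. E j)"
proof -
  have "2 * (1 / 2 * x) = x" for x :: ennreal
    by (simp add: mult.assoc[symmetric] ennreal_times_divide)
  then show ?thesis unfolding cluster_perimeter_def distrib_left by simp
qed

lemma twice_gen_perimeter:
  "2 * gen_perimeter nrm N E = infsum (\<lambda>l. infsum (\<lambda>j. perimeter nrm (layer E l j)) (idx N)
      + perimeter nrm (\<Union>j\<in>idx N. layer E l j)) UNIV"
  unfolding gen_perimeter_def ennreal_infsum_cmult[symmetric] twice_cluster_perimeter ..

text \<open>
  All but finitely many components have such a small perimeter that it bounds their measure.
\<close>

lemma summable_measures:
  fixes A :: "nat \<Rightarrow> int \<Rightarrow> 'a::euclidean_space set"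
  assumes nrm: "is_norm nrm" and A: "\<And>i l. A i l \<in> sets borel"
    and m: "\<And>i. 0 \<le> m i" "\<And>i. infsum (\<lambda>l. emeasure lborel (A i l)) UNIV = ennreal (m i)"
    and C: "\<And>I. finite I \<Longrightarrow> (\<Sum>i\<in>I. infsum (\<lambda>l. perimeter nrm (A i l)) UNIV) \<le> ennreal C"
  shows "summable m"
proof -
  define c where "c = 4 * cell_const nrm"
  have c: "c \<ge> 0" unfolding c_def using cell_const_nonneg[OF nrm] by simp
  let ?P = "\<lambda>i. infsum (\<lambda>l. perimeter nrm (A i l)) UNIV"
  have small: "ennreal (m i) \<le> ennreal c * ?P i" if "ennreal c * ?P i < 1" for i
  proof -
    have "emeasure lborel (A i l) \<le> ennreal c * perimeter nrm (A i l)" for l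
      unfolding c_def
    proof (rule small_perimeter_imp_small_measure[OF nrm A])
      have "emeasure lborel (A i l) \<le> ennreal (m i)"
        using ennreal_le_infsum[of l UNIV "\<lambda>l. emeasure lborel (A i l)"] m(2) by simp
      then show "emeasure lborel (A i l) < \<infinity>" using le_less_trans[OF _ ennreal_less_top] by simp
      have "ennreal c * perimeter nrm (A i l) \<le> ennreal c * ?P i"
        by (intro mult_left_mono ennreal_le_infsum) simp_all
      then show "ennreal (4 * cell_const nrm) * perimeter nrm (A i l) < 1" using that unfolding c_def by simp
    qed
    then have "infsum (\<lambda>l. emeasure lborel (A i l)) UNIV \<le> infsum (\<lambda>l. ennreal c * perimeter nrm (A i l)) UNIV"
      by (intro ennreal_infsum_mono)
    then show ?thesis by (simp add: m(2) ennreal_infsum_cmult)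
  qed
  have sumP: "(\<Sum>i\<in>I. ennreal c * ?P i) \<le> ennreal (c * max C 0)" if "finite I" for I
  proof -
    have "(\<Sum>i\<in>I. ennreal c * ?P i) = ennreal c * (\<Sum>i\<in>I. ?P i)" by (simp add: sum_distrib_left)
    also have "\<dots> \<le> ennreal c * ennreal (max C 0)"
      by (intro mult_left_mono order_trans[OF C[OF that]] ennreal_leI) simp_all
    finally show ?thesis using c by (simp add: ennreal_mult')
  qed
  define B where "B = {i. \<not> ennreal c * ?P i < 1}"
  have "finite B"
  proof (rule ccontr)
    assume "infinite B"
    obtain n :: nat where n: "c * max C 0 < real n" using reals_Archimedean2 by blast
    from infinite_arbitrarily_large[OF \<open>infinite B\<close>, of n] obtain H where H: "finite H" "card H = n" "H \<subseteq> B" by blast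
    have "ennreal (real n) = (\<Sum>i\<in>H. 1)" using H by (simp add: ennreal_of_nat_eq_real_of_nat)
    also have "\<dots> \<le> (\<Sum>i\<in>H. ennreal c * ?P i)" by (rule sum_mono) (use H in \<open>auto simp: B_def not_less\<close>)
    also have "\<dots> \<le> ennreal (c * max C 0)" by (rule sumP[OF H(1)])
    finally show False using n c by (simp add: ennreal_le_iff)
  qed
  have "(\<Sum>i\<in>I. m i) \<le> (\<Sum>i\<in>B. m i) + c * max C 0" if I: "finite I" for I
  proof -
    have "ennreal (\<Sum>i\<in>I - B. m i) = (\<Sum>i\<in>I - B. ennreal (m i))" by (rule sum_ennreal[symmetric]) (rule m)
    also have "\<dots> \<le> (\<Sum>i\<in>I - B. ennreal c * ?P i)"
      by (rule sum_mono) (use small in \<open>auto simp: B_def\<close>)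
    also have "\<dots> \<le> ennreal (c * max C 0)" by (rule sumP) (use I in simp)
    finally have "(\<Sum>i\<in>I - B. m i) \<le> c * max C 0" using c by (simp add: ennreal_le_iff)
    moreover have "(\<Sum>i\<in>I. m i) = (\<Sum>i\<in>I \<inter> B. m i) + (\<Sum>i\<in>I - B. m i)"
      using I by (rule sum.Int_Diff)
    moreover have "(\<Sum>i\<in>I \<inter> B. m i) \<le> (\<Sum>i\<in>B. m i)"
      using \<open>finite B\<close> m(1) by (intro sum_mono2) auto
    ultimately show ?thesis by linarith
  qed
  then have "(\<Sum>i<n. m i) \<le> (\<Sum>i\<in>B. m i) + c * max C 0" for n by simp
  with m(1) show ?thesis by (rule summableI_nonneg_bounded)
qed

text \<open>
  The limit pieces provided by \<open>concentration_compactness\<close> have the right total volumes by \<open>separated_mass_le\<close>.  Their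
  energy is bounded by applying \<open>separated_perimeter_lsc\<close> to each component and to the union of the components; this
  needs the limits of these perimeters to exist, which is arranged beforehand by passing to a subsequence.
\<close>

lemma gen_cluster_of_minimizing_sequence:
  fixes nrm :: "'a::euclidean_space \<Rightarrow> real"
    and E :: "nat \<Rightarrow> nat \<Rightarrow> (int \<times> 'a) set"
  assumes nrm: "is_norm nrm" and m: "\<forall>i\<in>idx N. 0 \<le> m i"
    and E: "\<And>k. gen_cluster N (E k)" "\<And>k i. i \<in> idx N \<Longrightarrow> gen_measure (E k) i = ennreal (m i)"
    and lim: "(\<lambda>k. gen_perimeter nrm N (E k)) \<longlonglongrightarrow> J" and bdd: "\<And>k. gen_perimeter nrm N (E k) \<le> ennreal C"
  obtains G where "gen_cluster N G" "\<And>i. i \<in> idx N \<Longrightarrow> gen_measure G i = ennreal (m i)"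
    "gen_perimeter nrm N G \<le> J"
proof -
  \<comment> \<open>Components outside the index set are made empty, so that all families are indexed by all of
     \<^typ>\<open>nat\<close>.\<close>
  define A0 where "A0 k i l = (if i \<in> idx N then layer (E k) l i else {})" for k i l
  define n where "n i = (if i \<in> idx N then m i else 0)" for i
  have n0: "0 \<le> n i" for i using m by (simp add: n_def)
  have A0b: "A0 k i l \<in> sets borel" for k i l
    using E(1)[of k] by (simp add: A0_def gen_cluster_def cluster_def)
  have A0m: "infsum (\<lambda>l. emeasure lborel (A0 k i l)) UNIV = ennreal (n i)" for k i
    using E(2)[of i k] by (simp add: A0_def n_def gen_measure_def cluster_measure_def)
  let ?P = "\<lambda>k i. infsum (\<lambda>l. perimeter nrm (A0 k i l)) UNIV"
  let ?U = "\<lambda>k l. \<Union>i. A0 k i l"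
  let ?PU = "\<lambda>k. infsum (\<lambda>l. perimeter nrm (?U k l)) UNIV"
  have U: "?U k l = (\<Union>i\<in>idx N. layer (E k) l i)" for k l
    by (auto simp: A0_def split: if_splits)
  have P_out: "?P k i = 0" if "i \<notin> idx N" for k i
    using that by (simp add: A0_def perimeter_empty)
  have energy: "(\<Sum>i\<in>I. ?P k i) + ?PU k \<le> 2 * gen_perimeter nrm N (E k)" if I: "finite I" for I k
  proof -
    have "(\<Sum>i\<in>I. ?P k i) = (\<Sum>i\<in>I \<inter> idx N. ?P k i)"
      by (rule sum.mono_neutral_right) (use I P_out in auto)
    also have "\<dots> + ?PU k = infsum (\<lambda>l. (\<Sum>i\<in>I \<inter> idx N. perimeter nrm (A0 k i l)) + perimeter nrm (?U k l)) UNIV"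
      using I by (subst infsum_add[OF ennreal_summable ennreal_summable]) (simp add: ennreal_infsum_sum)
    also have "\<dots> \<le> 2 * gen_perimeter nrm N (E k)"
      unfolding twice_gen_perimeter U
    proof (intro ennreal_infsum_mono add_right_mono)
      fix l
      have "(\<Sum>i\<in>I \<inter> idx N. perimeter nrm (A0 k i l)) = (\<Sum>i\<in>I \<inter> idx N. perimeter nrm (layer (E k) l i))"
        by (rule sum.cong) (auto simp: A0_def)
      also have "\<dots> \<le> infsum (\<lambda>i. perimeter nrm (layer (E k) l i)) (idx N)"
        by (rule ennreal_sum_le_infsum) (use I in auto)
      finally show "(\<Sum>i\<in>I \<inter> idx N. perimeter nrm (A0 k i l)) \<le> infsum (\<lambda>i. perimeter nrm (layer (E k) l i)) (idx N)" .
    qed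
    finally show ?thesis .
  qed
  define C' where "C' = 2 * max C 0"
  have two_C: "2 * gen_perimeter nrm N (E k) \<le> ennreal C'" for k
  proof -
    have "2 * gen_perimeter nrm N (E k) \<le> 2 * ennreal (max C 0)"
      by (intro mult_left_mono order_trans[OF bdd] ennreal_leI) simp_all
    also have "\<dots> = ennreal C'" by (simp add: C'_def ennreal_mult')
    finally show ?thesis .
  qed
  have sumC: "(\<Sum>i\<in>I. ?P k i) \<le> ennreal C'" if "finite I" for I k
  proof -
    have "(\<Sum>i\<in>I. ?P k i) \<le> (\<Sum>i\<in>I. ?P k i) + ?PU k" by simp
    also have "\<dots> \<le> ennreal C'" by (rule order_trans[OF energy[OF that] two_C])
    finally show ?thesis .
  qed
  have PC: "?P k i \<le> ennreal C'" for k i using sumC[of "{i}" k] by simp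
  have summ: "summable n"
    by (rule summable_measures[OF nrm, of "A0 0"]) (use A0b n0 A0m sumC in auto)
  define f where "f w k = (case w of None \<Rightarrow> ?PU k | Some i \<Rightarrow> ?P k i)" for w k
  obtain r0 where r0: "strict_mono r0" "\<And>w. w \<in> UNIV \<Longrightarrow> convergent (\<lambda>k. f w (r0 k))"
    by (rule diagonal_convergent_subseq[of UNIV f]) auto
  have "convergent (\<lambda>k. ?PU (r0 k))" using r0(2)[of None] by (simp add: f_def)
  then obtain pu where pu: "(\<lambda>k. ?PU (r0 k)) \<longlonglongrightarrow> pu" by (auto simp: convergent_def)
  have "convergent (\<lambda>k. ?P (r0 k) i)" for i using r0(2)[of "Some i"] by (simp add: f_def)
  then have "\<forall>i. \<exists>p. (\<lambda>k. ?P (r0 k) i) \<longlonglongrightarrow> p" by (simp add: convergent_def)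
  from choice[OF this] obtain p where p: "\<And>i. (\<lambda>k. ?P (r0 k) i) \<longlonglongrightarrow> p i" by blast
  have sum_p: "(\<Sum>i\<in>I. p i) + pu \<le> 2 * J" if "finite I" for I
  proof -
    have l: "(\<lambda>k. gen_perimeter nrm N (E (r0 k))) \<longlonglongrightarrow> J"
      using LIMSEQ_subseq_LIMSEQ[OF lim r0(1)] by (simp add: o_def)
    have "(\<lambda>k. 2 * gen_perimeter nrm N (E (r0 k))) \<longlonglongrightarrow> 2 * J"
      by (rule ennreal_tendsto_cmult[OF _ l]) simp
    moreover have "(\<lambda>k. (\<Sum>i\<in>I. ?P (r0 k) i) + ?PU (r0 k)) \<longlonglongrightarrow> (\<Sum>i\<in>I. p i) + pu"
      by (intro tendsto_add tendsto_sum p pu)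
    ultimately show ?thesis
      by (rule tendsto_le[OF sequentially_bot]) (use energy[OF that] in simp)
  qed
  obtain r and T :: "(nat \<times> nat \<times> nat) set" and L Z F0 where r: "strict_mono r" and sep: "separated T L Z"
    and F0: "\<And>s i. s \<in> T \<Longrightarrow> loc_tendsto (\<lambda>k. shift (Z s k) (A0 (r0 (r k)) i (L s k))) (F0 s i)"
    and nF0: "\<And>i. ennreal (n i) \<le> infsum (\<lambda>s. emeasure lborel (F0 s i)) T"
    by (rule concentration_compactness[OF nrm, of "\<lambda>k. A0 (r0 k)" n C', OF A0b n0 A0m PC]) blast
  define F where "F s i = (if i \<in> idx N then F0 s i else {})" for s i
  have F: "loc_tendsto (\<lambda>k. shift (Z s k) (A0 (r0 (r k)) i (L s k))) (F s i)" if "s \<in> T" for s i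
    using F0[OF that, of i] by (cases "i \<in> idx N") (simp_all add: F_def A0_def shift_def loc_tendsto_def)
  have nF: "ennreal (n i) \<le> infsum (\<lambda>s. emeasure lborel (F s i)) T" for i
    using nF0[of i] by (cases "i \<in> idx N") (simp_all add: F_def n_def)
  define A where "A k = A0 (r0 (r k))" for k
  have Fb: "F s i \<in> sets borel" if "s \<in> T" for s i using F[OF that] by (simp add: loc_tendsto_def)
  have FA: "loc_tendsto (\<lambda>k. shift (Z s k) (A k i (L s k))) (F s i)" if "s \<in> T" for s i
    unfolding A_def by (rule F[OF that])
  have Ab: "A k i l \<in> sets borel" for k i l unfolding A_def by (rule A0b)
  have mass: "infsum (\<lambda>s. emeasure lborel (F s i)) T = ennreal (n i)" for i
  proof (rule antisym[OF _ nF])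
    show "infsum (\<lambda>s. emeasure lborel (F s i)) T \<le> ennreal (n i)"
    proof (rule ennreal_infsum_le)
      fix S assume S: "finite S" "S \<subseteq> T"
      show "(\<Sum>s\<in>S. emeasure lborel (F s i)) \<le> ennreal (n i)"
        by (rule separated_mass_le[where A="\<lambda>k. A k i", OF S(1) Ab separated_subset[OF sep S(2)]])
          (use FA S in \<open>auto simp: A_def A0m\<close>)
    qed
  qed
  have Fn: "emeasure lborel (F s i) \<le> ennreal (n i)" if "s \<in> T" for s i
    using ennreal_le_infsum[OF that, of "\<lambda>s. emeasure lborel (F s i)"] mass by simp
  have An: "emeasure lborel (A k i l) \<le> ennreal (n i)" for k i l
    using ennreal_le_infsum[of l UNIV "\<lambda>l. emeasure lborel (A k i l)"] by (simp add: A_def A0m)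
  have perim: "(\<Sum>s\<in>S. perimeter nrm (F s i)) \<le> p i" if S: "finite S" "S \<subseteq> T" for S i
  proof (rule separated_perimeter_lsc[where A="\<lambda>k. A k i", OF nrm S(1) Ab separated_subset[OF sep S(2)]])
    show "(\<lambda>k. infsum (\<lambda>l. perimeter nrm (A k i l)) UNIV) \<longlonglongrightarrow> p i"
      using LIMSEQ_subseq_LIMSEQ[OF p r] by (simp add: o_def A_def)
  qed (use FA S in auto)
  have FU: "loc_tendsto (\<lambda>k. shift (Z s k) (\<Union>i. A k i (L s k))) (\<Union>i. F s i)" if s: "s \<in> T" for s
  proof -
    have "shift (Z s k) (\<Union>i. A k i (L s k)) = (\<Union>i. shift (Z s k) (A k i (L s k)))" for k
      by (auto simp: shift_def)
    moreover have "loc_tendsto (\<lambda>k. \<Union>i. shift (Z s k) (A k i (L s k))) (\<Union>i. F s i)"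
      by (rule loc_tendsto_UN[where m=n])
        (use FA[OF s] Fn[OF s] summ n0 An in \<open>simp_all add: shift_borel Ab emeasure_shift\<close>)
    ultimately show ?thesis by simp
  qed
  have perimU: "(\<Sum>s\<in>S. perimeter nrm (\<Union>i. F s i)) \<le> pu" if S: "finite S" "S \<subseteq> T" for S
  proof (rule separated_perimeter_lsc[where A="\<lambda>k l. \<Union>i. A k i l", OF nrm S(1) _ separated_subset[OF sep S(2)]])
    show "(\<lambda>k. infsum (\<lambda>l. perimeter nrm (\<Union>i. A k i l)) UNIV) \<longlonglongrightarrow> pu"
      using LIMSEQ_subseq_LIMSEQ[OF pu r] by (simp add: o_def A_def)
    show "(\<Union>i. A k i l) \<in> sets borel" for k l by (intro sets.countable_UN'' countableI_type Ab)
  qed (use FU S in auto)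
  \<comment> \<open>Each limit window receives a layer of its own.\<close>
  define \<iota> where "\<iota> s = int (to_nat (s :: nat \<times> nat \<times> nat))" for s
  have \<iota>: "inj \<iota>" unfolding \<iota>_def by (intro injI) simp
  define X where "X l i = (if l \<in> \<iota> ` T \<and> i \<in> idx N then F (inv \<iota> l) i else {})" for l i
  have X1: "X (\<iota> s) i = F s i" if "s \<in> T" "i \<in> idx N" for s i using that \<iota> by (simp add: X_def inv_f_f)
  have X2: "X l = (\<lambda>_. {})" if "l \<notin> \<iota> ` T" for l using that by (simp add: X_def fun_eq_iff)
  have inj: "inj_on \<iota> T" using \<iota> by (rule inj_on_subset) simp
  show ?thesis
  proof (rule that[of "from_layers X"])
    show "gen_cluster N (from_layers X)"
      unfolding gen_cluster_def cluster_def layer_from_layers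
    proof (intro allI conjI ballI impI)
      fix l i j assume ij: "i \<in> idx N" "j \<in> idx N" "i \<noteq> j"
      show "emeasure lborel (X l i \<inter> X l j) = 0"
      proof (cases "l \<in> \<iota> ` T")
        case True
        then obtain s where s: "l = \<iota> s" "s \<in> T" by blast
        have "emeasure lborel (F s i \<inter> F s j) = 0"
        proof (rule loc_tendsto_null_Int[OF _ _ _ FA[OF s(2)] FA[OF s(2)]])
          fix k
          let ?l = "L s k"
          have "emeasure lborel (A k i ?l \<inter> A k j ?l) = 0"
            using E(1)[of "r0 (r k)"] ij by (simp add: A_def A0_def gen_cluster_def cluster_def)
          moreover have "shift (Z s k) (A k i ?l) \<inter> shift (Z s k) (A k j ?l) = shift (Z s k) (A k i ?l \<inter> A k j ?l)"
            by (auto simp: shift_def)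
          ultimately show "emeasure lborel (shift (Z s k) (A k i ?l) \<inter> shift (Z s k) (A k j ?l)) = 0"
            by (simp add: emeasure_shift Ab sets.Int)
        qed (intro shift_borel Ab)+
        then show ?thesis using s ij by (simp add: X1)
      qed (simp add: X2)
    next
      fix l i
      show "X l i \<in> sets borel"
      proof (cases "l \<in> \<iota> ` T \<and> i \<in> idx N")
        case True
        then obtain s where "l = \<iota> s" "s \<in> T" by blast
        then show ?thesis using True Fb by (simp add: X1)
      qed (auto simp: X_def)
    qed
    show "gen_measure (from_layers X) i = ennreal (m i)" if i: "i \<in> idx N" for i
    proof -
      have "gen_measure (from_layers X) i = infsum (\<lambda>s. emeasure lborel (X (\<iota> s) i)) T"
        unfolding gen_measure_def cluster_measure_def layer_from_layers
        by (rule infsum_extend_zero[OF inj]) (simp add: X2)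
      also have "\<dots> = infsum (\<lambda>s. emeasure lborel (F s i)) T"
        by (rule infsum_cong) (simp add: X1 i)
      also have "\<dots> = ennreal (m i)" using i by (simp add: mass n_def)
      finally show ?thesis .
    qed
    show "gen_perimeter nrm N (from_layers X) \<le> J"
    proof -
      let ?Q = "\<lambda>s. infsum (\<lambda>i. perimeter nrm (F s i)) (idx N) + perimeter nrm (\<Union>i. F s i)"
      have "2 * gen_perimeter nrm N (from_layers X) = infsum (\<lambda>s. infsum (\<lambda>i. perimeter nrm (X (\<iota> s) i)) (idx N)
          + perimeter nrm (\<Union>i\<in>idx N. X (\<iota> s) i)) T"
        unfolding twice_gen_perimeter layer_from_layers
        by (rule infsum_extend_zero[OF inj]) (simp add: X2 perimeter_empty)
      also have "\<dots> = infsum ?Q T"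
      proof (rule infsum_cong)
        fix s assume s: "s \<in> T"
        have "infsum (\<lambda>i. perimeter nrm (X (\<iota> s) i)) (idx N) = infsum (\<lambda>i. perimeter nrm (F s i)) (idx N)"
          by (rule infsum_cong) (simp add: X1 s)
        moreover have "(\<Union>i\<in>idx N. X (\<iota> s) i) = (\<Union>i. F s i)"
          using X1[OF s] by (auto simp: F_def split: if_splits)
        ultimately show "infsum (\<lambda>i. perimeter nrm (X (\<iota> s) i)) (idx N) + perimeter nrm (\<Union>i\<in>idx N. X (\<iota> s) i) = ?Q s"
          by simp
      qed
      also have "\<dots> \<le> 2 * J"
      proof (rule ennreal_infsum_le)
        fix S assume S: "finite S" "S \<subseteq> T"
        have "(\<Sum>s\<in>S. ?Q s) = infsum (\<lambda>i. \<Sum>s\<in>S. perimeter nrm (F s i)) (idx N) + (\<Sum>s\<in>S. perimeter nrm (\<Union>i. F s i))"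
          using S(1) by (simp add: sum.distrib ennreal_infsum_sum)
        also have "\<dots> \<le> infsum p (idx N) + pu"
          by (intro add_mono ennreal_infsum_mono perim perimU S)
        also have "\<dots> = (SUP I\<in>{I. finite I \<and> I \<subseteq> idx N}. sum p I + pu)"
          unfolding ennreal_infsum_SUP by (rule ennreal_SUP_add_left[symmetric]) auto
        also have "\<dots> \<le> 2 * J" by (rule SUP_least) (use sum_p in simp)
        finally show "(\<Sum>s\<in>S. ?Q s) \<le> 2 * J" .
      qed
      finally have "2 * gen_perimeter nrm N (from_layers X) \<le> 2 * J" .
      then show ?thesis by (simp add: ennreal_mult_le_mult_iff)
    qed
  qed
qed

theorem corollary6p1:
  fixes nrm :: "'a::euclidean_space \<Rightarrow> real"
    and N :: enat
    and m :: "nat \<Rightarrow> real"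
  assumes "is_norm nrm"
    and "\<forall>i\<in>idx N. 0 \<le> m i"
  shows "\<exists>E :: nat \<Rightarrow> (int \<times> 'a) set.
           minimal_gen_cluster nrm N E \<and> (\<forall>i\<in>idx N. gen_measure E i = ennreal (m i))"
proof -
  define V where "V = {F :: nat \<Rightarrow> (int \<times> 'a) set. gen_cluster N F \<and> (\<forall>i\<in>idx N. gen_measure F i = ennreal (m i))}"
  let ?J = "INF F\<in>V. gen_perimeter nrm N F"
  obtain E0 :: "nat \<Rightarrow> (int \<times> 'a) set" where "gen_cluster N E0" "\<forall>i\<in>idx N. gen_measure E0 i = ennreal (m i)"
    by (rule ex_gen_cluster[OF assms(2)])
  then have E0: "E0 \<in> V" by (simp add: V_def)
  then have V: "V \<noteq> {}" by blast
  have "\<exists>G\<in>V. gen_perimeter nrm N G \<le> ?J"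
  proof (cases "?J = top")
    case True
    then show ?thesis using E0 by (intro bexI[of _ E0]) simp_all
  next
    case False
    have "gen_perimeter nrm N ` V \<noteq> {}" using V by simp
    from ennreal_Inf_countable_INF[OF this] obtain f where f: "decseq f" "range f \<subseteq> gen_perimeter nrm N ` V"
      "?J = (INF k. f k)" by auto
    have flim: "f \<longlonglongrightarrow> ?J" unfolding f(3) by (rule LIMSEQ_INF[OF f(1)])
    have "\<forall>k. \<exists>G. G \<in> V \<and> gen_perimeter nrm N G = f k"
    proof
      fix k
      have "f k \<in> gen_perimeter nrm N ` V" using f(2) by blast
      then show "\<exists>G. G \<in> V \<and> gen_perimeter nrm N G = f k" by (auto simp: image_iff)
    qed
    from choice[OF this] obtain E where E: "\<And>k. E k \<in> V" "\<And>k. gen_perimeter nrm N (E k) = f k" by blast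
    obtain C where C: "?J = ennreal C" "C \<ge> 0" using False by (cases ?J) auto
    have "?J < ennreal (C + 1)" unfolding C by (rule ennreal_lessI) (use C in simp_all)
    \<comment> \<open>Early terms of the sequence may have infinite energy and are dropped.\<close>
    from order_tendstoD(2)[OF flim this] obtain k0 where k0: "\<And>k. k \<ge> k0 \<Longrightarrow> f k < ennreal (C + 1)"
      unfolding eventually_sequentially by blast
    obtain G where "gen_cluster N G" "\<And>i. i \<in> idx N \<Longrightarrow> gen_measure G i = ennreal (m i)"
      "gen_perimeter nrm N G \<le> ?J"
    proof (rule gen_cluster_of_minimizing_sequence[OF assms, of "\<lambda>k. E (k + k0)" ?J "C + 1"])
      show "(\<lambda>k. gen_perimeter nrm N (E (k + k0))) \<longlonglongrightarrow> ?J"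
        unfolding E(2) by (rule LIMSEQ_ignore_initial_segment[OF flim])
      show "gen_perimeter nrm N (E (k + k0)) \<le> ennreal (C + 1)" for k
        unfolding E(2) using k0[of "k + k0"] by simp
    qed (use E(1) that in \<open>auto simp: V_def\<close>)
    then show ?thesis unfolding V_def by blast
  qed
  then obtain G where G: "G \<in> V" "gen_perimeter nrm N G \<le> ?J" by blast
  have "V = {F. gen_cluster N F \<and> (\<forall>i\<in>idx N. gen_measure F i = gen_measure G i)}"
    using G(1) by (auto simp: V_def)
  moreover have "gen_perimeter nrm N G = ?J"
    using G by (intro antisym INF_lower) auto
  ultimately have "minimal_gen_cluster nrm N G"
    using G(1) by (simp add: minimal_gen_cluster_def V_def)
  then show ?thesis using G(1) unfolding V_def by blast
qed

end
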